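(* Let $a,b\subseteq\omega$ be such that $a\oplus b$ is not $ITRM$-random. Then $a$ is not $ITRM$-random or $b$ is not $ITRM$-random relative to $a$.
   Context: An infinite time register machine ($ITRM$) has finitely many registers, each holding a natural number, and runs a program of the same kind as a classical unlimited register machine (with an additional instruction querying membership of a number in an oracle), but in transfinite ordinal time: successor steps are as for register machines; at limit times the active program line is the limit inferior of earlier program lines and each register holds the limit inferior of its earlier contents, reset to $0$ if that limit inferior is infinite. $a\oplus b=\{2i\mid i\in a\}\cup\{2j+1\mid j\in b\}$. $X\subseteq\mathfrak{P}(\omega)$ is $ITRM$-decidable iff some program $P$, with any oracle $x$, halts with output $1$ if $x\in X$ and $0$ otherwise; $X$ is $ITRM$-decidable in the oracle $y$ iff some program $P$, with oracle $x\oplus y$, halts with output $1$ if $x\in X$ and $0$ otherwise, for every $x$. $x$ is $ITRM$-random iff no $ITRM$-decidable meager set contains $x$; $x$ is $ITRM$-random relative to $y$ iff no meager set $X\ni x$ is $ITRM$-decidable in the oracle $y$. *)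

theory Defs
  imports "HOL-Analysis.Analysis" "HOL-Library.Extended_Nat" "HOL-Library.Countable_Set"
begin

datatype instr =
    Zero nat
  | Succ nat
  | Copy nat nat
  | Jump nat nat nat
  | Query nat

text \<open>A program mentions only finitely many registers, and all others stay \<open>0\<close> throughout.
  A configuration is the active program line together with the register contents.\<close>

type_synonym program = "instr list"
type_synonym config = "nat \<times> (nat \<Rightarrow> nat)"

fun exec :: "nat set \<Rightarrow> instr \<Rightarrow> config \<Rightarrow> config" where
  "exec x (Zero n) (l, R) = (Suc l, R(n := 0))"
| "exec x (Succ n) (l, R) = (Suc l, R(n := Suc (R n)))"
| "exec x (Copy m n) (l, R) = (Suc l, R(n := R m))"
| "exec x (Jump m n q) (l, R) = (if R m = R n then q else Suc l, R)"
| "exec x (Query n) (l, R) = (Suc l, R(n := (if R n \<in> x then 1 else 0)))"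

text \<open>Ordinal time is the field of a well-order \<open>r\<close> (reflexive, as in the library).\<close>

definition liminf_before :: "'o rel \<Rightarrow> 'o \<Rightarrow> ('o \<Rightarrow> nat) \<Rightarrow> enat" where
  "liminf_before r t f = (SUP s\<in>underS r t. INF u\<in>{u \<in> underS r t. (s, u) \<in> r}. enat (f u))"

definition lim_val :: "'o rel \<Rightarrow> 'o \<Rightarrow> ('o \<Rightarrow> nat) \<Rightarrow> nat" where
  "lim_val r t f = (case liminf_before r t f of enat n \<Rightarrow> n | \<infinity> \<Rightarrow> 0)"

text \<open>Program lines occurring before a limit time are bounded by the length of the program, so the
  overflow case of \<^const>\<open>lim_val\<close> only concerns registers.\<close>

definition lim_config :: "'o rel \<Rightarrow> ('o \<Rightarrow> config) \<Rightarrow> 'o \<Rightarrow> config" where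
  "lim_config r C t = (lim_val r t (\<lambda>s. fst (C s)), \<lambda>k. lim_val r t (\<lambda>s. snd (C s) k))"

definition is_pred :: "'o rel \<Rightarrow> 'o \<Rightarrow> 'o \<Rightarrow> bool" where
  "is_pred r s t \<longleftrightarrow> s \<in> Field r \<and> underS r t = under r s"

text \<open>The machine has stopped as soon as the active line is not a line of the program; hence every
  configuration that has a successor is required to have an active line in the program.\<close>

definition itrm_computation :: "program \<Rightarrow> nat set \<Rightarrow> 'o rel \<Rightarrow> ('o \<Rightarrow> config) \<Rightarrow> bool" where
  "itrm_computation P x r C \<longleftrightarrow> Well_order r \<and>
    (\<forall>t\<in>Field r.
      (underS r t = {} \<longrightarrow> C t = (0, \<lambda>_. 0)) \<and>
      (\<forall>s. is_pred r s t \<longrightarrow> fst (C s) < length P \<and> C t = exec x (P ! fst (C s)) (C s)) \<and>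
      (underS r t \<noteq> {} \<and> (\<nexists>s. is_pred r s t) \<longrightarrow> C t = lim_config r C t))"

text \<open>The output is the final content of register \<open>0\<close>. Since the existential quantifier needs a fixed
  type of times, it ranges over the well-orders on sets of sets of naturals. The choice of the type
  is immaterial: \<open>itrm_outputsI\<close> below shows that a computation which halts along a well-order on
  any type whatsoever yields one that halts along a well-order of this type.\<close>

definition itrm_outputs :: "program \<Rightarrow> nat set \<Rightarrow> nat \<Rightarrow> bool" where
  "itrm_outputs P x n \<longleftrightarrow>
    (\<exists>(r :: nat set rel) C t. itrm_computation P x r C \<and> t \<in> Field r \<and>
       length P \<le> fst (C t) \<and> snd (C t) 0 = n)"

definition join :: "nat set \<Rightarrow> nat set \<Rightarrow> nat set" (infixl "\<oplus>\<^sub>J" 65) where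
  "a \<oplus>\<^sub>J b = {2 * i |i. i \<in> a} \<union> {2 * j + 1 |j. j \<in> b}"

definition itrm_decidable :: "nat set set \<Rightarrow> bool" where
  "itrm_decidable X \<longleftrightarrow> (\<exists>P. \<forall>x. itrm_outputs P x (if x \<in> X then 1 else 0))"

definition itrm_decidable_in :: "nat set \<Rightarrow> nat set set \<Rightarrow> bool" where
  "itrm_decidable_in y X \<longleftrightarrow> (\<exists>P. \<forall>x. itrm_outputs P (x \<oplus>\<^sub>J y) (if x \<in> X then 1 else 0))"

definition nowhere_dense :: "'a::topological_space set \<Rightarrow> bool" where
  "nowhere_dense S \<longleftrightarrow> interior (closure S) = {}"

definition meager :: "'a::topological_space set \<Rightarrow> bool" where
  "meager S \<longleftrightarrow> (\<exists>F :: nat \<Rightarrow> 'a set. (\<forall>n. nowhere_dense (F n)) \<and> S = (\<Union>n. F n))"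

text \<open>Subsets of \<open>\<omega>\<close> are identified with their characteristic functions, i.e. with points of the
  Cantor space \<^typ>\<open>nat \<Rightarrow> bool\<close> with the product topology.\<close>

definition meager_reals :: "nat set set \<Rightarrow> bool" where
  "meager_reals X \<longleftrightarrow> meager ((\<lambda>x n. n \<in> x) ` X)"

definition itrm_random :: "nat set \<Rightarrow> bool" where
  "itrm_random x \<longleftrightarrow> (\<nexists>X. meager_reals X \<and> itrm_decidable X \<and> x \<in> X)"

definition itrm_random_in :: "nat set \<Rightarrow> nat set \<Rightarrow> bool" where
  "itrm_random_in y x \<longleftrightarrow> (\<nexists>X. meager_reals X \<and> itrm_decidable_in y X \<and> x \<in> X)"

text \<open>It remains to justify the choice of the time type in \<^const>\<open>itrm_outputs\<close>.\<close>

lemma le_liminf_before: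
  "enat n \<le> liminf_before r t f \<longleftrightarrow>
     n = 0 \<or> (\<exists>s\<in>underS r t. \<forall>u\<in>underS r t. (s, u) \<in> r \<longrightarrow> n \<le> f u)"
proof (cases n)
  case (Suc m)
  have "enat m < (INF u\<in>{u \<in> underS r t. (s, u) \<in> r}. enat (f u)) \<longleftrightarrow>
      (\<forall>u\<in>underS r t. (s, u) \<in> r \<longrightarrow> n \<le> f u)" for s
    by (auto simp: Suc_ile_eq[symmetric] le_INF_iff Suc)
  then show ?thesis
    by (simp add: liminf_before_def less_SUP_iff Suc Suc_ile_eq)
qed (simp add: zero_enat_def[symmetric])

lemma enat_eqI:
  assumes "\<And>n. enat n \<le> a \<longleftrightarrow> enat n \<le> b"
  shows "a = b"
proof -
  have "c \<le> d" if "\<And>n. enat n \<le> c \<Longrightarrow> enat n \<le> d" for c d :: enat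
  proof (rule ccontr)
    assume "\<not> c \<le> d"
    then obtain k where "d = enat k" "d < c" by (cases d) auto
    then show False using that[of "Suc k"] by (auto simp: Suc_ile_eq)
  qed
  then show ?thesis using assms by (metis antisym)
qed

lemma lim_val_eqI:
  assumes "s \<in> underS r t" "\<And>u. u \<in> underS r t \<Longrightarrow> (s, u) \<in> r \<Longrightarrow> v \<le> f u"
    and "\<And>s. s \<in> underS r t \<Longrightarrow> \<exists>u\<in>underS r t. (s, u) \<in> r \<and> f u = v"
  shows "lim_val r t f = v"
proof -
  have "liminf_before r t f = enat v"
    by (rule enat_eqI) (use assms in \<open>fastforce simp: le_liminf_before\<close>)
  then show ?thesis by (simp add: lim_val_def)
qed

lemma wo_le_cases:
  assumes "Well_order r" "a \<in> Field r" "b \<in> Field r"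
  shows "(a, b) \<in> r \<or> b \<in> underS r a"
  using assms wo_rel.TOTALS[of r] by (auto simp: wo_rel_def underS_def)

lemma wo_trans: "Well_order r \<Longrightarrow> (a, b) \<in> r \<Longrightarrow> (b, c) \<in> r \<Longrightarrow> (a, c) \<in> r"
  using wo_rel.TRANS[of r] by (auto simp: wo_rel_def dest: transD)

lemma wo_antisym: "Well_order r \<Longrightarrow> (a, b) \<in> r \<Longrightarrow> (b, a) \<in> r \<Longrightarrow> a = b"
  using wo_rel.ANTISYM[of r] by (auto simp: wo_rel_def dest: antisymD)

lemma wo_refl: "Well_order r \<Longrightarrow> a \<in> Field r \<Longrightarrow> (a, a) \<in> r"
  using wo_rel.REFL[of r] by (auto simp: wo_rel_def dest: refl_onD)

lemma wo_ls_trans: "Well_order r \<Longrightarrow> (a, b) \<in> r \<Longrightarrow> b \<in> underS r c \<Longrightarrow> a \<in> underS r c"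
  by (auto simp: underS_def dest: wo_trans wo_antisym)

lemma wo_sl_trans: "Well_order r \<Longrightarrow> a \<in> underS r b \<Longrightarrow> (b, c) \<in> r \<Longrightarrow> a \<in> underS r c"
  by (auto simp: underS_def dest: wo_trans wo_antisym)

lemma wo_not_less: "Well_order r \<Longrightarrow> (a, b) \<in> r \<Longrightarrow> b \<notin> underS r a"
  by (auto simp: underS_def dest: wo_antisym)

lemma wo_min:
  assumes W: "Well_order r" and "a \<in> Field r" "Q a"
  shows "\<exists>m. m \<in> Field r \<and> Q m \<and> (\<forall>a. a \<in> Field r \<longrightarrow> Q a \<longrightarrow> (m, a) \<in> r)"
proof -
  let ?A = "{a \<in> Field r. Q a}"
  have A: "?A \<subseteq> Field r" "?A \<noteq> {}" using assms by auto
  have "wo_rel.minim r ?A \<in> ?A" "\<forall>a\<in>?A. (wo_rel.minim r ?A, a) \<in> r"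
    using wo_rel.minim_in[OF _ A] wo_rel.minim_least[OF _ A(1)] W by (auto simp: wo_rel_def)
  then show ?thesis by blast
qed

lemma wo_induct:
  assumes "Well_order r" "\<And>a. (\<And>b. b \<in> underS r a \<Longrightarrow> Q b) \<Longrightarrow> Q a"
  shows "Q a"
proof (rule wo_rel.well_order_induct[of r])
  show "wo_rel r" using assms(1) by (simp add: wo_rel_def)
  show "Q x" if "\<forall>y. y \<noteq> x \<and> (y, x) \<in> r \<longrightarrow> Q y" for x
    by (rule assms(2)) (use that in \<open>simp add: underS_def\<close>)
qed

lemma ev_tail:
  assumes "Well_order r" "p \<in> underS r t"
  shows "(\<exists>s\<in>underS r t. \<forall>u\<in>underS r t. (s, u) \<in> r \<longrightarrow> Q u) \<longleftrightarrow>
    (\<exists>s\<in>underS r t. (p, s) \<in> r \<and> (\<forall>u\<in>underS r t. (p, u) \<in> r \<longrightarrow> (s, u) \<in> r \<longrightarrow> Q u))"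
    (is "?L \<longleftrightarrow> ?R")
proof
  assume ?L
  then obtain s where s: "s \<in> underS r t" "\<And>u. u\<in>underS r t \<Longrightarrow> (s, u) \<in> r \<Longrightarrow> Q u" by blast
  have F: "s \<in> Field r" "p \<in> Field r" using s assms by (auto simp: underS_def Field_def)
  show ?R
  proof (cases "(p, s) \<in> r")
    case True then show ?thesis using s by blast
  next
    case False
    then have "(s, p) \<in> r" using wo_le_cases[OF assms(1) F(2) F(1)] by (auto simp: underS_def)
    then show ?thesis using s assms wo_trans[OF assms(1)] wo_refl[OF assms(1) F(2)] by blast
  qed
next
  assume ?R
  then show ?L using wo_trans[OF assms(1)] by blast
qed

lemma liminf_transport:
  assumes "Well_order r" "Well_order r'" "p \<in> underS r t" "q \<in> underS r' t'"
    and img: "g ` {u \<in> underS r t. (p, u) \<in> r} = {u \<in> underS r' t'. (q, u) \<in> r'}"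
    and mono: "\<And>u v. u \<in> underS r t \<Longrightarrow> v \<in> underS r t \<Longrightarrow> (p, u) \<in> r \<Longrightarrow> (p, v) \<in> r \<Longrightarrow>
        (g u, g v) \<in> r' \<longleftrightarrow> (u, v) \<in> r"
    and eq: "\<And>u. u \<in> underS r t \<Longrightarrow> (p, u) \<in> r \<Longrightarrow> f' (g u) = f u"
  shows "lim_val r t f = lim_val r' t' f'"
proof -
  have "(\<exists>s\<in>{u \<in> underS r t. (p, u) \<in> r}. \<forall>u\<in>{u \<in> underS r t. (p, u) \<in> r}. (s, u) \<in> r \<longrightarrow> n \<le> f u) \<longleftrightarrow>
     (\<exists>s\<in>{u \<in> underS r' t'. (q, u) \<in> r'}. \<forall>u\<in>{u \<in> underS r' t'. (q, u) \<in> r'}. (s, u) \<in> r' \<longrightarrow> n \<le> f' u)" for n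
    unfolding img[symmetric] using mono eq by simp
  then have "liminf_before r t f = liminf_before r' t' f'"
    by (intro enat_eqI, unfold le_liminf_before ev_tail[OF assms(1,3)] ev_tail[OF assms(2,4)])
      (simp add: Bex_def Ball_def conj_assoc imp_conjL)
  then show ?thesis by (simp add: lim_val_def)
qed

lemma is_pred_nonempty: "Well_order r \<Longrightarrow> is_pred r s t \<Longrightarrow> s \<in> underS r t"
  by (auto simp: is_pred_def under_def wo_refl)

lemma is_predI:
  assumes "Well_order r" "s \<in> underS r t" "\<And>u. u \<in> underS r t \<Longrightarrow> (u, s) \<in> r"
  shows "is_pred r s t"
proof -
  have "under r s \<subseteq> underS r t" using wo_ls_trans[OF assms(1) _ assms(2)] by (auto simp: under_def)
  then show ?thesis using assms(2,3) by (auto simp: is_pred_def under_def underS_def Field_def)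
qed

lemma is_predD: "is_pred r s t \<Longrightarrow> u \<in> underS r t \<Longrightarrow> (u, s) \<in> r"
  by (auto simp: is_pred_def under_def)

text \<open>Computations are determined, from any time onwards, by their configuration at that time.\<close>

lemma computation_deterministic:
  assumes comp: "itrm_computation P x r C" "itrm_computation P x r' C'"
    and S: "S \<subseteq> Field r" "\<And>a. a \<in> S \<Longrightarrow> (p, a) \<in> r"
      "\<And>a b. a \<in> S \<Longrightarrow> (p, b) \<in> r \<Longrightarrow> (b, a) \<in> r \<Longrightarrow> b \<in> S"
    and g: "g p = q" "\<And>a. a \<in> S \<Longrightarrow> g a \<in> Field r'"
      "\<And>a b. a \<in> S \<Longrightarrow> b \<in> S \<Longrightarrow> (g a, g b) \<in> r' \<longleftrightarrow> (a, b) \<in> r"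
      "\<And>a. a \<in> S \<Longrightarrow> g ` {u \<in> underS r a. (p, u) \<in> r} = {u \<in> underS r' (g a). (q, u) \<in> r'}"
    and start: "C' q = C p"
    and a: "a \<in> S"
  shows "C' (g a) = C a"
  using a
proof (induction a rule: wo_induct[of r])
  show W: "Well_order r" using comp by (simp add: itrm_computation_def)
  have W': "Well_order r'" using comp by (simp add: itrm_computation_def)
  fix a assume IH: "\<And>b. b \<in> underS r a \<Longrightarrow> b \<in> S \<Longrightarrow> C' (g b) = C b" and a: "a \<in> S"
  have inS: "u \<in> S" if "u \<in> underS r a" "(p, u) \<in> r" for u
    using S(3)[OF a that(2)] that(1) by (auto simp: underS_def)
  show "C' (g a) = C a"
  proof (cases "a = p")
    case True then show ?thesis using g start by simp
  next
    case False
    then have pa: "p \<in> underS r a" using S(2)[OF a] by (auto simp: underS_def)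
    have pF: "p \<in> Field r" using pa by (auto simp: underS_def Field_def)
    have pp: "(p, p) \<in> r" using wo_refl[OF W pF] .
    have "q \<in> g ` {u \<in> underS r a. (p, u) \<in> r}" using pa pp g(1) by blast
    then have qa: "q \<in> underS r' (g a)" using g(4)[OF a] by blast
    have aF: "a \<in> Field r" and gaF: "g a \<in> Field r'" using a S(1) g(2)[OF a] by blast+
    show ?thesis
    proof (cases "\<exists>s. is_pred r s a")
      case True
      then obtain s where s: "is_pred r s a" by blast
      have sa: "s \<in> underS r a" using is_pred_nonempty[OF W s] .
      have ps: "(p, s) \<in> r" using is_predD[OF s pa] .
      have sS: "s \<in> S" using inS sa ps by blast
      have "is_pred r' (g s) (g a)"
      proof (rule is_predI[OF W'])
        have "g s \<in> g ` {u \<in> underS r a. (p, u) \<in> r}" using sa ps by blast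
        then show "g s \<in> underS r' (g a)" using g(4)[OF a] by blast
        have qs: "(q, g s) \<in> r'" using \<open>g s \<in> g ` _\<close> g(4)[OF a] by blast
        fix u assume u: "u \<in> underS r' (g a)"
        show "(u, g s) \<in> r'"
        proof (cases "(q, u) \<in> r'")
          case True
          then obtain b where b: "u = g b" "b \<in> underS r a" "(p, b) \<in> r" using g(4)[OF a] u by blast
          then show ?thesis using is_predD[OF s b(2)] g(3)[OF inS[OF b(2,3)] sS] by simp
        next
          case False
          then have "(u, q) \<in> r'" using wo_le_cases[OF W', of q u] u qa
            by (auto simp: underS_def Field_def)
          then show ?thesis using wo_trans[OF W'] qs by blast
        qed
      qed
      then have "C' (g a) = exec x (P ! fst (C' (g s))) (C' (g s))"
        using comp(2) gaF by (simp add: itrm_computation_def)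
      moreover have "C a = exec x (P ! fst (C s)) (C s)"
        using comp(1) aF s by (simp add: itrm_computation_def)
      ultimately show ?thesis using IH[OF sa sS] by simp
    next
      case False
      have "\<not> is_pred r' z (g a)" for z
      proof
        assume z: "is_pred r' z (g a)"
        have "z \<in> underS r' (g a)" "(q, z) \<in> r'" using is_pred_nonempty[OF W' z] is_predD[OF z qa] .
        then obtain b where b: "z = g b" "b \<in> underS r a" "(p, b) \<in> r" using g(4)[OF a] by blast
        have "is_pred r b a"
        proof (rule is_predI[OF W b(2)])
          fix u assume u: "u \<in> underS r a"
          show "(u, b) \<in> r"
          proof (cases "(p, u) \<in> r")
            case True
            have "g u \<in> underS r' (g a)" using g(4)[OF a] u True by blast
            then have "(g u, g b) \<in> r'" using is_predD[OF z] b by blast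
            then show ?thesis using g(3) inS u True b by blast
          next
            case False
            then have "(u, p) \<in> r" using wo_le_cases[OF W pF, of u] u
              by (auto simp: underS_def Field_def)
            then show ?thesis using wo_trans[OF W] b by blast
          qed
        qed
        then show False using False by blast
      qed
      then have "C' (g a) = lim_config r' C' (g a)"
        using comp(2) gaF qa by (auto simp: itrm_computation_def)
      moreover have "C a = lim_config r C a"
        using comp(1) aF False pa by (auto simp: itrm_computation_def)
      moreover have lim: "lim_val r a (\<lambda>s. h (C s)) = lim_val r' (g a) (\<lambda>s. h (C' s))" for h :: "config \<Rightarrow> nat"
        by (rule liminf_transport[OF W W' pa qa g(4)[OF a]]) (use g(3) inS IH in auto)
      ultimately show ?thesis using lim[of fst] lim[of "\<lambda>c. snd c k" for k]
        by (simp add: lim_config_def)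
    qed
  qed
qed


definition interval_from :: "'o rel \<Rightarrow> 'o \<Rightarrow> 'o set \<Rightarrow> bool" where
  "interval_from r p S \<longleftrightarrow> S \<subseteq> Field r \<and> p \<in> S \<and> (\<forall>a\<in>S. (p, a) \<in> r) \<and>
    (\<forall>a\<in>S. \<forall>b. (p, b) \<in> r \<longrightarrow> (b, a) \<in> r \<longrightarrow> b \<in> S)"

lemma interval_embed:
  assumes comp: "itrm_computation P x r C" "itrm_computation P x r' C'"
    and IS: "interval_from r p S" and IT: "interval_from r' q T"
    and start: "C' q = C p"
    and emb: "embed (Restr r S) (Restr r' T) f"
  shows "f p = q" "\<And>a. a \<in> S \<Longrightarrow> f a \<in> T" "\<And>a. a \<in> S \<Longrightarrow> C' (f a) = C a"
    "\<And>a b. a \<in> S \<Longrightarrow> b \<in> S \<Longrightarrow> (f a, f b) \<in> r' \<longleftrightarrow> (a, b) \<in> r"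
    "\<And>a. a \<in> S \<Longrightarrow> f ` {u \<in> underS r a. (p, u) \<in> r} = {u \<in> underS r' (f a). (q, u) \<in> r'}"
proof -
  have S: "S \<subseteq> Field r" "p \<in> S" "\<And>a. a \<in> S \<Longrightarrow> (p, a) \<in> r"
      "\<And>a b. a \<in> S \<Longrightarrow> (p, b) \<in> r \<Longrightarrow> (b, a) \<in> r \<Longrightarrow> b \<in> S"
    using IS unfolding interval_from_def by blast+
  have T: "T \<subseteq> Field r'" "q \<in> T" "\<And>a. a \<in> T \<Longrightarrow> (q, a) \<in> r'"
      "\<And>a b. a \<in> T \<Longrightarrow> (q, b) \<in> r' \<Longrightarrow> (b, a) \<in> r' \<Longrightarrow> b \<in> T"
    using IT unfolding interval_from_def by blast+
  have W: "Well_order r" "Well_order r'" using comp by (simp_all add: itrm_computation_def)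
  have R: "Refl r" "Refl r'" using W wo_rel.REFL by (auto simp: wo_rel_def)
  have F: "Field (Restr r S) = S" "Field (Restr r' T) = T"
    using Refl_Field_Restr2 R S(1) T(1) by blast+
  have WR: "Well_order (Restr r S)" "Well_order (Restr r' T)" using W Well_order_Restr by blast+
  show fT: "f a \<in> T" if "a \<in> S" for a
    using embed_in_Field[OF emb] that F by auto
  have inj: "inj_on f S" using embed_inj_on[OF WR(1) emb] F by simp
  have mono: "(f a, f b) \<in> r'" if "a \<in> S" "b \<in> S" "(a, b) \<in> r" for a b
    using embed_compat[OF emb] that by (auto simp: compat_def)
  show iff: "(f a, f b) \<in> r' \<longleftrightarrow> (a, b) \<in> r" if "a \<in> S" "b \<in> S" for a b
  proof
    assume fab: "(f a, f b) \<in> r'"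
    show "(a, b) \<in> r"
    proof (rule ccontr)
      assume *: "(a, b) \<notin> r"
      then have "(b, a) \<in> r" using wo_le_cases[OF W(1), of a b] that S(1) by (auto simp: underS_def)
      then have "f a = f b" using mono that fab wo_antisym[OF W(2)] by blast
      then have "a = b" using inj that by (auto dest: inj_onD)
      then show False using * wo_refl[OF W(1)] that S(1) by blast
    qed
  qed (use mono that in blast)
  have b1: "bij_betw f (underS (Restr r S) a) (underS (Restr r' T) (f a))" if "a \<in> S" for a
    using embed_underS[OF WR(1) emb] that F by simp
  have b2: "underS (Restr r S) a = {u \<in> underS r a. (p, u) \<in> r}" if "a \<in> S" for a
    unfolding underS_def using that S(3) S(4)[OF that] by blast
  have b3: "underS (Restr r' T) a = {u \<in> underS r' a. (q, u) \<in> r'}" if "a \<in> T" for a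
    unfolding underS_def using that T(3) T(4)[OF that] by blast
  show img: "f ` {u \<in> underS r a. (p, u) \<in> r} = {u \<in> underS r' (f a). (q, u) \<in> r'}"
    if "a \<in> S" for a
    using bij_betw_imp_surj_on[OF b1[OF that]] b2[OF that] b3[OF fT[OF that]] by simp
  have "{u \<in> underS r p. (p, u) \<in> r} = {}" using wo_not_less[OF W(1)] by blast
  then have "{u \<in> underS r' (f p). (q, u) \<in> r'} = {}"
    unfolding img[OF S(2), symmetric] by (simp only: image_empty)
  moreover have "(q, f p) \<in> r'" "(q, q) \<in> r'" using T fT S(2) by blast+
  ultimately show fp: "f p = q" by (auto simp: underS_def)
  show "C' (f a) = C a" if "a \<in> S" for a
    by (rule computation_deterministic[where g = f and q = q, OF comp S(1,3,4) fp _ iff img start that])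
      (use fT T(1) in auto)
qed

definition comp_of :: "nat \<Rightarrow> config \<Rightarrow> nat" where
  "comp_of k c = (case k of 0 \<Rightarrow> fst c | Suc j \<Rightarrow> snd c j)"

lemma config_eqI: "(\<And>k. comp_of k c = comp_of k d) \<Longrightarrow> c = d"
proof -
  assume *: "\<And>k. comp_of k c = comp_of k d"
  have "fst c = fst d" using *[of 0] by (simp add: comp_of_def)
  moreover have "snd c j = snd d j" for j using *[of "Suc j"] by (simp add: comp_of_def)
  ultimately show ?thesis by (auto simp: prod_eq_iff)
qed

lemma comp_of_lim:
  assumes "itrm_computation P x r C" "t \<in> Field r" "underS r t \<noteq> {}" "\<And>s. \<not> is_pred r s t"
  shows "comp_of k (C t) = lim_val r t (\<lambda>s. comp_of k (C s))"
proof -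
  have "C t = lim_config r C t" using assms by (simp add: itrm_computation_def)
  then show ?thesis by (cases k) (simp_all add: lim_config_def comp_of_def)
qed

lemma running_before:
  assumes comp: "itrm_computation P x r C" and u: "u \<in> underS r s"
  shows "fst (C u) < length P"
proof -
  have W: "Well_order r" using comp by (simp add: itrm_computation_def)
  have uF: "z \<in> Field r" if "u \<in> underS r z" for z using that by (auto simp: underS_def Field_def)
  obtain z where z: "u \<in> underS r z" "\<And>y. u \<in> underS r y \<Longrightarrow> (z, y) \<in> r"
    using wo_min[OF W uF[OF u], of "\<lambda>z. u \<in> underS r z", OF u] uF by blast
  have "is_pred r u z"
  proof (rule is_predI[OF W z(1)])
    fix y assume y: "y \<in> underS r z"
    then have "u \<notin> underS r y" using z(2) wo_not_less[OF W] by blast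
    then show "(y, u) \<in> r" using wo_le_cases[OF W, of y u] y u by (auto simp: underS_def Field_def)
  qed
  moreover have "z \<in> Field r" using z(1) by (auto simp: underS_def Field_def)
  ultimately show ?thesis using comp by (auto simp: itrm_computation_def)
qed

text \<open>A computation that is still running at the first uncountable time is in a loop.\<close>

lemma halting_countable:
  assumes comp: "itrm_computation P x r C" and t: "t \<in> Field r" and halt: "length P \<le> fst (C t)"
  shows "countable (Field r)"
proof (rule ccontr)
  assume unc: "\<not> countable (Field r)"
  have W: "Well_order r" using comp by (simp add: itrm_computation_def)
  note cs = wo_le_cases[OF W] and tr = wo_trans[OF W] and ls = wo_ls_trans[OF W]
    and sl = wo_sl_trans[OF W] and nl = wo_not_less[OF W] and re = wo_refl[OF W]
  have le: "a \<in> underS r b \<Longrightarrow> (a, b) \<in> r" for a b by (simp add: underS_def)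
  have fld: "(a, b) \<in> r \<Longrightarrow> a \<in> Field r \<and> b \<in> Field r" for a b by (auto simp: Field_def)
  have last: "(u, t) \<in> r" if "u \<in> Field r" for u
    using cs[OF that t] running_before[OF comp, of t u] halt by auto
  have "Field r \<subseteq> insert t (underS r t)" using last by (auto simp: underS_def)
  then have "uncountable (underS r t)" using unc by (meson countable_insert countable_subset)
  from wo_min[OF W t, of "\<lambda>w. uncountable (underS r w)", OF this]
  obtain w where w: "w \<in> Field r" "uncountable (underS r w)"
      and wmin: "\<And>a. a \<in> Field r \<Longrightarrow> uncountable (underS r a) \<Longrightarrow> (w, a) \<in> r"
    by blast
  define A where "A = underS r w"
  have AF: "a \<in> Field r" if "a \<in> A" for a using that le fld by (auto simp: A_def)
  have cA: "countable (underS r a)" if "a \<in> A" for a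
    using wmin[OF AF[OF that]] nl that by (auto simp: A_def)
  have bounded: "\<exists>s\<in>A. \<forall>b\<in>B. b \<in> underS r s" if B: "B \<subseteq> A" "countable B" for B
  proof (rule ccontr)
    assume "\<not> ?thesis"
    then have "A \<subseteq> (\<Union>b\<in>B. insert b (underS r b))"
      using cs AF B(1) by (fastforce simp: underS_def)
    moreover have "countable (\<Union>b\<in>B. insert b (underS r b))" using B cA by auto
    ultimately show False using w(2) countable_subset by (auto simp: A_def)
  qed
  have nopred_w: "\<not> is_pred r s w" for s
  proof
    assume s: "is_pred r s w"
    then have "{s} \<subseteq> A" using is_pred_nonempty[OF W] by (auto simp: A_def)
    then obtain u where "u \<in> A" "s \<in> underS r u" using bounded[of "{s}"] by auto
    then show False using is_predD[OF s] nl by (auto simp: A_def)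
  qed
  have Ane: "underS r w \<noteq> {}" using w(2) by auto
  define v where "v k = comp_of k (C w)" for k
  have V: "(\<forall>s\<in>A. \<exists>u\<in>A. (s, u) \<in> r \<and> comp_of k (C u) = v k) \<and>
     (\<exists>s\<in>A. \<forall>u\<in>A. (s, u) \<in> r \<longrightarrow> v k \<le> comp_of k (C u))" for k
  proof -
    define Q where "Q m \<longleftrightarrow> (\<forall>s\<in>A. \<exists>u\<in>A. (s, u) \<in> r \<and> comp_of k (C u) = m)" for m
    have "\<exists>m. Q m"
    proof (rule ccontr)
      assume "\<nexists>m. Q m"
      then have "\<forall>m. \<exists>s\<in>A. \<forall>u\<in>A. (s, u) \<in> r \<longrightarrow> comp_of k (C u) \<noteq> m" by (auto simp: Q_def)
      then obtain z where z: "\<And>m. z m \<in> A" "\<And>m u. u \<in> A \<Longrightarrow> (z m, u) \<in> r \<Longrightarrow> comp_of k (C u) \<noteq> m"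
        by metis
      obtain s where "s \<in> A" "\<And>m. z m \<in> underS r s" using bounded[of "range z"] z(1) by auto
      then show False using z(2)[of s "comp_of k (C s)"] le by blast
    qed
    then obtain m where m: "Q m" "\<And>n. n < m \<Longrightarrow> \<not> Q n" by (metis exists_least_iff)
    have "\<forall>n. \<exists>s. n < m \<longrightarrow> s \<in> A \<and> (\<forall>u\<in>A. (s, u) \<in> r \<longrightarrow> comp_of k (C u) \<noteq> n)"
      using m(2) unfolding Q_def by blast
    then obtain z where z: "\<And>n. n < m \<Longrightarrow> z n \<in> A"
        "\<And>n u. n < m \<Longrightarrow> u \<in> A \<Longrightarrow> (z n, u) \<in> r \<Longrightarrow> comp_of k (C u) \<noteq> n"
      by metis
    obtain s where s: "s \<in> A" "\<And>n. n < m \<Longrightarrow> z n \<in> underS r s"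
      using bounded[of "z ` {..<m}"] z(1) by auto
    have ge: "m \<le> comp_of k (C u)" if "u \<in> A" "(s, u) \<in> r" for u
    proof (rule ccontr)
      assume "\<not> ?thesis"
      then have "comp_of k (C u) < m" by simp
      from z(2)[OF this that(1)] s(2)[OF this] that tr le show False by blast
    qed
    have "lim_val r w (\<lambda>s. comp_of k (C s)) = m"
      by (rule lim_val_eqI[of s]) (use s ge m(1) in \<open>auto simp: A_def Q_def\<close>)
    then have "v k = m" using comp_of_lim[OF comp w(1) Ane nopred_w] by (simp add: v_def)
    then show ?thesis using m(1) ge s(1) by (auto simp: Q_def)
  qed
  then obtain z where z: "\<And>k. z k \<in> A" "\<And>k u. u \<in> A \<Longrightarrow> (z k, u) \<in> r \<Longrightarrow> v k \<le> comp_of k (C u)"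
    by metis
  obtain s0 where s0: "s0 \<in> A" "\<And>k. z k \<in> underS r s0" using bounded[of "range z"] z(1) by auto
  have ge0: "v k \<le> comp_of k (C u)" if "u \<in> A" "(s0, u) \<in> r" for u k
    using z(2)[OF that(1)] s0(2) that tr le by blast
  have "\<exists>s'. s' \<in> A \<and> s \<in> underS r s' \<and> (\<forall>k. \<exists>u. (s, u) \<in> r \<and> u \<in> underS r s' \<and> comp_of k (C u) = v k)"
    if "s \<in> A" for s
  proof -
    have "\<forall>k. \<exists>u. u \<in> A \<and> (s, u) \<in> r \<and> comp_of k (C u) = v k" using V that by blast
    from choice[OF this] obtain y where y: "\<And>k. y k \<in> A" "\<And>k. (s, y k) \<in> r" "\<And>k. comp_of k (C (y k)) = v k"
      by blast
    have "insert s (range y) \<subseteq> A" using y(1) that by auto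
    then obtain s' where "s' \<in> A" "\<forall>b\<in>insert s (range y). b \<in> underS r s'"
      using bounded[of "insert s (range y)"] by auto
    then show ?thesis using y by blast
  qed
  then have "\<forall>s\<in>A. \<exists>s'. s' \<in> A \<and> s \<in> underS r s' \<and>
      (\<forall>k. \<exists>u. (s, u) \<in> r \<and> u \<in> underS r s' \<and> comp_of k (C u) = v k)" by simp
  from bchoice[OF this] obtain nx where nx': "\<forall>s\<in>A. nx s \<in> A \<and> s \<in> underS r (nx s) \<and>
      (\<forall>k. \<exists>u. (s, u) \<in> r \<and> u \<in> underS r (nx s) \<and> comp_of k (C u) = v k)" ..
  have nx: "\<And>s. s \<in> A \<Longrightarrow> nx s \<in> A" "\<And>s. s \<in> A \<Longrightarrow> s \<in> underS r (nx s)"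
     "\<And>s k. s \<in> A \<Longrightarrow> \<exists>u. (s, u) \<in> r \<and> u \<in> underS r (nx s) \<and> comp_of k (C u) = v k"
    using nx' by simp_all
  define y where "y n = (nx ^^ n) s0" for n
  have yA: "y n \<in> A" for n by (induction n) (auto simp: y_def s0 nx)
  have ySuc: "y (Suc n) = nx (y n)" for n by (simp add: y_def)
  obtain bd where bd: "bd \<in> A" "\<And>n. y n \<in> underS r bd" using bounded[of "range y"] yA by blast
  obtain p where p: "p \<in> Field r" "\<And>n. y n \<in> underS r p"
      and pmin: "\<And>a. a \<in> Field r \<Longrightarrow> (\<And>n. y n \<in> underS r a) \<Longrightarrow> (p, a) \<in> r"
    using wo_min[OF W AF[OF bd(1)], of "\<lambda>a. \<forall>n. y n \<in> underS r a"] bd(2) by blast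
  have pA: "p \<in> A" using pmin[OF AF[OF bd(1)] bd(2)] bd(1) ls by (auto simp: A_def)
  have p_lim: "\<exists>n. (s, y n) \<in> r" if "s \<in> underS r p" for s
  proof (rule ccontr)
    assume "\<nexists>n. (s, y n) \<in> r"
    then have "y n \<in> underS r s" for n using cs[of s "y n"] AF[OF yA] that le fld by blast
    then have "(p, s) \<in> r" using pmin that le fld by blast
    then show False using nl that by blast
  qed
  have nopred_p: "\<not> is_pred r s p" for s
  proof
    assume s: "is_pred r s p"
    obtain n where "(s, y n) \<in> r" using p_lim is_pred_nonempty[OF W s] by blast
    then have "s \<in> underS r (y (Suc n))" using ls nx(2) yA ySuc by metis
    then show False using is_predD[OF s p(2)] nl by blast
  qed
  have y0: "y 0 = s0" by (simp add: y_def)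
  have s0p: "s0 \<in> underS r p" using p(2)[of 0] y0 by simp
  have Cp: "C p = C w"
  proof (rule config_eqI)
    fix k
    have "comp_of k (C p) = lim_val r p (\<lambda>s. comp_of k (C s))"
      by (rule comp_of_lim[OF comp p(1) _ nopred_p]) (use s0p in blast)
    also have "\<dots> = v k"
    proof (rule lim_val_eqI[OF s0p])
      show "v k \<le> comp_of k (C u)" if "u \<in> underS r p" "(s0, u) \<in> r" for u
        using ge0 that pA sl le by (auto simp: A_def)
      fix s assume "s \<in> underS r p"
      then obtain n where n: "(s, y n) \<in> r" using p_lim by blast
      obtain u where "(y n, u) \<in> r" "u \<in> underS r (y (Suc n))" "comp_of k (C u) = v k"
        using nx(3)[OF yA] ySuc by metis
      then show "\<exists>u\<in>underS r p. (s, u) \<in> r \<and> comp_of k (C u) = v k"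
        using n tr sl le p(2) by blast
    qed
    finally show "comp_of k (C p) = comp_of k (C w)" by (simp add: v_def)
  qed
  have ge: "v k \<le> comp_of k (C u)" if "u \<in> A" "(p, u) \<in> r" for u k
    using ge0 that s0p tr le by blast
  have pw: "p \<in> underS r w" using pA by (simp add: A_def)

  define D where "D = {q \<in> Field r. (w, q) \<in> r \<and> C q = C w \<and>
    (\<forall>u k. (p, u) \<in> r \<longrightarrow> (u, q) \<in> r \<longrightarrow> v k \<le> comp_of k (C u))}"
  have "v k \<le> comp_of k (C u)" if "(p, u) \<in> r" "(u, w) \<in> r" for u k
    using ge[of u k] that by (cases "u = w") (auto simp: v_def A_def underS_def)
  then have wD: "w \<in> D" using w(1) re[OF w(1)] by (simp add: D_def)
  have DF: "d \<in> Field r" if "d \<in> D" for d using that by (simp add: D_def)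
  obtain q where q: "q \<in> Field r" "\<And>d. d \<in> D \<Longrightarrow> (d, q) \<in> r"
     and qmin: "\<And>a. a \<in> Field r \<Longrightarrow> (\<And>d. d \<in> D \<Longrightarrow> (d, a) \<in> r) \<Longrightarrow> (q, a) \<in> r"
    using wo_min[OF W t, of "\<lambda>a. \<forall>d\<in>D. (d, a) \<in> r"] last DF by blast
  have "q \<in> D"
  proof (rule ccontr)
    assume "q \<notin> D"
    then have Dq: "d \<in> underS r q" if "d \<in> D" for d using q(2)[OF that] that by (auto simp: underS_def)
    have q_lim: "\<exists>d\<in>D. s \<in> underS r d" if "s \<in> underS r q" for s
    proof (rule ccontr)
      assume *: "\<not> ?thesis"
      have sF: "s \<in> Field r" using that le fld by blast
      have "(d, s) \<in> r" if "d \<in> D" for d using cs[of d s] sF that * by (auto simp: D_def)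
      then show False using qmin[OF sF] nl that by blast
    qed
    have nopred_q: "\<not> is_pred r s q" for s
    proof
      assume s: "is_pred r s q"
      then obtain d where "d \<in> D" "s \<in> underS r d" using q_lim is_pred_nonempty[OF W s] by blast
      then show False using is_predD[OF s Dq] nl by blast
    qed
    have geq: "v k \<le> comp_of k (C u)" if gq: "(p, u) \<in> r" "u \<in> underS r q" for u k
    proof -
      obtain d where "d \<in> D" "u \<in> underS r d" using q_lim gq(2) by blast
      then show ?thesis using gq(1) le by (auto simp: D_def)
    qed
    have Cq: "C q = C w"
    proof (rule config_eqI)
      fix k
      have "comp_of k (C q) = lim_val r q (\<lambda>s. comp_of k (C s))"
        by (rule comp_of_lim[OF comp q(1) _ nopred_q]) (use Dq[OF wD] in blast)
      also have "\<dots> = v k"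
      proof (rule lim_val_eqI[OF Dq[OF wD]])
        show "v k \<le> comp_of k (C u)" if "u \<in> underS r q" "(w, u) \<in> r" for u
          using geq that tr pw le by blast
        fix s assume "s \<in> underS r q"
        then obtain d where d: "d \<in> D" "s \<in> underS r d" using q_lim by blast
        moreover have "C d = C w" using d(1) by (simp add: D_def)
        ultimately show "\<exists>u\<in>underS r q. (s, u) \<in> r \<and> comp_of k (C u) = v k"
          using Dq[of d] le[of s d] by (auto simp: v_def)
      qed
      finally show "comp_of k (C q) = comp_of k (C w)" by (simp add: v_def)
    qed
    have "v k \<le> comp_of k (C u)" if "(p, u) \<in> r" "(u, q) \<in> r" for u k
      using that geq[of u k] Cq by (cases "u = q") (auto simp: underS_def v_def)
    then have "q \<in> D" using q Cq wD by (auto simp: D_def)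
    then show False using \<open>q \<notin> D\<close> by simp
  qed
  then have wq: "(w, q) \<in> r" and Cq: "C q = C p"
      and geD: "\<And>u k. (p, u) \<in> r \<Longrightarrow> (u, q) \<in> r \<Longrightarrow> v k \<le> comp_of k (C u)"
    by (auto simp: D_def Cp)

  define S where "S = {u. (p, u) \<in> r \<and> u \<in> underS r w}"
  define T where "T = {u. (q, u) \<in> r}"
  have S: "S \<subseteq> Field r" "p \<in> S" "\<And>a. a \<in> S \<Longrightarrow> (p, a) \<in> r"
      "\<And>a b. a \<in> S \<Longrightarrow> (p, b) \<in> r \<Longrightarrow> (b, a) \<in> r \<Longrightarrow> b \<in> S"
    using fld pw re[OF p(1)] ls by (auto simp: S_def)
  have T: "T \<subseteq> Field r" "q \<in> T" "\<And>a. a \<in> T \<Longrightarrow> (q, a) \<in> r"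
      "\<And>a b. a \<in> T \<Longrightarrow> (q, b) \<in> r \<Longrightarrow> (b, a) \<in> r \<Longrightarrow> b \<in> T"
    using fld re[OF q(1)] by (auto simp: T_def)
  have IS: "interval_from r p S" and IT: "interval_from r q T"
    using S T unfolding interval_from_def by blast+
  have tT: "t \<in> T" using last q(1) by (auto simp: T_def)
  have runS: "fst (C a) < length P" if "a \<in> S" for a
    using that running_before[OF comp, of a w] by (auto simp: S_def)
  have "Well_order (Restr r S)" "Well_order (Restr r T)" using W Well_order_Restr by blast+
  then consider f where "embed (Restr r S) (Restr r T) f" | f where "embed (Restr r T) (Restr r S) f"
    using wellorders_totally_ordered by blast
  then show False
  proof cases
    case 2
    note E = interval_embed[OF comp comp IT IS Cq[symmetric] 2]
    show False using E(3)[OF tT] runS[OF E(2)[OF tT]] halt by simp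
  next
    case 1
    note E = interval_embed[OF comp comp IS IT Cq 1]
    have "t \<notin> f ` S" using E(3) runS halt by fastforce
    then obtain z where z: "z \<in> T" "z \<notin> f ` S" and zmin: "\<And>a. a \<in> T \<Longrightarrow> a \<notin> f ` S \<Longrightarrow> (z, a) \<in> r"
      using wo_min[OF W t, of "\<lambda>a. a \<in> T \<and> a \<notin> f ` S"] tT T(1) by blast
    have zF: "z \<in> Field r" using z T by blast
    have below: "f a \<in> underS r z" if "a \<in> S" for a
    proof (rule ccontr)
      assume *: "f a \<notin> underS r z"
      then have "(z, f a) \<in> r" using cs[OF zF, of "f a"] E(2)[OF that] T(1) by blast
      then have "z \<in> underS r (f a)" using z(2) that by (auto simp: underS_def)
      then have "z \<in> f ` {u \<in> underS r a. (p, u) \<in> r}" using E(5)[OF that] z(1) by (auto simp: T_def)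
      then show False using z(2) S(4)[OF that] le by blast
    qed
    have above: "u \<in> f ` S" if "u \<in> underS r z" "(q, u) \<in> r" for u
      using zmin[of u] nl that by (auto simp: T_def)
    have img: "f ` {u \<in> underS r w. (p, u) \<in> r} = {u \<in> underS r z. (q, u) \<in> r}"
      using below above E(2) by (fastforce simp: S_def T_def)
    have qz: "q \<in> underS r z" using below[OF S(2)] E(1) by simp
    have nopred_z: "\<not> is_pred r s z" for s
    proof
      assume s: "is_pred r s z"
      then obtain a where a: "a \<in> S" "s = f a"
        using above is_pred_nonempty[OF W s] is_predD[OF s qz] by blast
      have "{a} \<subseteq> A" using a by (auto simp: S_def A_def)
      then obtain b where b: "b \<in> A" "a \<in> underS r b" using bounded[of "{a}"] by auto
      have bS: "b \<in> S" using a b tr le by (auto simp: S_def A_def)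
      then have "(b, a) \<in> r" using is_predD[OF s below[OF bS]] a E(4) by blast
      then show False using b nl by blast
    qed
    have Cz: "C z = C w"
    proof (rule config_eqI)
      fix k
      have "comp_of k (C z) = lim_val r z (\<lambda>s. comp_of k (C s))"
        by (rule comp_of_lim[OF comp zF _ nopred_z]) (use qz in blast)
      also have "\<dots> = lim_val r w (\<lambda>s. comp_of k (C s))"
        by (rule liminf_transport[OF W W pw qz img, symmetric])
          (use E(3,4) in \<open>auto simp: S_def\<close>)
      also have "\<dots> = comp_of k (C w)"
        by (rule comp_of_lim[OF comp w(1) Ane nopred_w, symmetric])
      finally show "comp_of k (C z) = comp_of k (C w)" .
    qed
    have "v k \<le> comp_of k (C u)" if u: "(p, u) \<in> r" "(u, z) \<in> r" for u k
    proof (cases "(u, q) \<in> r \<or> u = z")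
      case True
      then show ?thesis using geD u Cz by (auto simp: v_def)
    next
      case False
      have uF: "u \<in> Field r" using fld[OF u(1)] ..
      have "(q, u) \<in> r" using cs[OF uF q(1)] False le by blast
      moreover have "u \<in> underS r z" using u(2) False by (simp add: underS_def)
      ultimately obtain a where a: "a \<in> S" "u = f a" using above by blast
      then show ?thesis using E(3)[OF a(1)] ge[of a k] by (simp add: S_def A_def)
    qed
    then have "z \<in> D" using zF Cz tr[OF wq le[OF qz]] by (auto simp: D_def)
    then show False using q(2) qz nl by blast
  qed
qed

lemma itrm_computation_dir_image:
  assumes comp: "itrm_computation P x r C" and inj: "inj_on f (Field r)"
  shows "itrm_computation P x (dir_image r f) (\<lambda>s. C (inv_into (Field r) f s))"
    (is "itrm_computation P x ?r ?C")
proof -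
  have W: "Well_order r" using comp by (simp add: itrm_computation_def)
  have W': "Well_order ?r" using Well_order_dir_image[OF W inj] .
  have fld: "(a, b) \<in> r \<Longrightarrow> a \<in> Field r \<and> b \<in> Field r" for a b by (auto simp: Field_def)
  have iff: "(f a, f b) \<in> ?r \<longleftrightarrow> (a, b) \<in> r" if "a \<in> Field r" "b \<in> Field r" for a b
    using that fld inj unfolding dir_image_def inj_on_def by blast
  have uS: "underS ?r (f a) = f ` underS r a" if "a \<in> Field r" for a
    using that fld inj unfolding dir_image_def underS_def inj_on_def by blast
  have un: "under ?r (f a) = f ` under r a" if "a \<in> Field r" for a
    using that fld inj unfolding dir_image_def under_def inj_on_def by blast
  have sub: "underS r a \<subseteq> Field r" "under r a \<subseteq> Field r" for a
    by (auto simp: underS_def under_def Field_def)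
  have pr: "is_pred ?r (f s) (f a) \<longleftrightarrow> is_pred r s a" if "a \<in> Field r" "s \<in> Field r" for a s
    using that uS un inj_on_image_eq_iff[OF inj sub(1) sub(2)] by (auto simp: is_pred_def dir_image_Field)
  have C: "?C (f a) = C a" if "a \<in> Field r" for a using that inj by simp
  have lim: "lim_config ?r ?C (f a) = lim_config r C a" if a: "a \<in> Field r" "underS r a \<noteq> {}" for a
  proof -
    obtain p where p: "p \<in> underS r a" "\<And>u. u \<in> underS r a \<Longrightarrow> (p, u) \<in> r"
    proof -
      obtain b where b: "b \<in> underS r a" using a(2) by blast
      then have "b \<in> Field r" using sub(1) by blast
      from wo_min[OF W this, of "\<lambda>u. u \<in> underS r a", OF b]
      obtain m where "m \<in> underS r a" "\<forall>u. u \<in> Field r \<longrightarrow> u \<in> underS r a \<longrightarrow> (m, u) \<in> r" by blast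
      then show thesis using that[of m] sub(1)[of a] by (meson subsetD)
    qed
    have lim: "lim_val r a (\<lambda>s. h (C s)) = lim_val ?r (f a) (\<lambda>s. h (?C s))" for h :: "config \<Rightarrow> nat"
    proof (rule liminf_transport[OF W W' p(1)])
      show "f p \<in> underS ?r (f a)" using uS a p by simp
      show "f ` {u \<in> underS r a. (p, u) \<in> r} = {u \<in> underS ?r (f a). (f p, u) \<in> ?r}"
        unfolding uS[OF a(1)] using p iff[of p] sub(1)[of a] by blast
      show "(f u, f v) \<in> ?r \<longleftrightarrow> (u, v) \<in> r" if "u \<in> underS r a" "v \<in> underS r a" for u v
        using iff[of u v] that sub(1)[of a] by blast
      show "h (?C (f u)) = h (C u)" if "u \<in> underS r a" for u
        using C[of u] that sub(1)[of a] by auto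
    qed
    show ?thesis using lim[of fst] lim[of "\<lambda>c. snd c k" for k] by (simp add: lim_config_def)
  qed
  show ?thesis unfolding itrm_computation_def
  proof (intro conjI ballI W')
    fix t assume "t \<in> Field ?r"
    then obtain a where a: "a \<in> Field r" "t = f a" by (auto simp: dir_image_Field)
    note c = comp[unfolded itrm_computation_def, THEN conjunct2, rule_format, OF a(1)]
    show "underS ?r t = {} \<longrightarrow> ?C t = (0, \<lambda>_. 0)"
      using c a uS C by simp
    show "\<forall>s. is_pred ?r s t \<longrightarrow> fst (?C s) < length P \<and> ?C t = exec x (P ! fst (?C s)) (?C s)"
    proof (intro allI impI)
      fix s assume s: "is_pred ?r s t"
      then obtain b where b: "b \<in> Field r" "s = f b" by (auto simp: is_pred_def dir_image_Field)
      then have "is_pred r b a" using pr s a by simp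
      then show "fst (?C s) < length P \<and> ?C t = exec x (P ! fst (?C s)) (?C s)"
        using c a b C by simp
    qed
    show "underS ?r t \<noteq> {} \<and> (\<nexists>s. is_pred ?r s t) \<longrightarrow> ?C t = lim_config ?r ?C t"
    proof
      assume *: "underS ?r t \<noteq> {} \<and> (\<nexists>s. is_pred ?r s t)"
      then have "underS r a \<noteq> {}" using uS a by simp
      moreover have "\<nexists>s. is_pred r s a" using * pr a by (metis is_pred_def)
      ultimately show "?C t = lim_config ?r ?C t" using c lim a C by simp
    qed
  qed
qed

lemma itrm_outputsI:
  fixes r :: "'o rel"
  assumes "itrm_computation P x r C" "t \<in> Field r" "length P \<le> fst (C t)"
  shows "itrm_outputs P x (snd (C t) 0)"
proof -
  define f :: "'o \<Rightarrow> nat set" where "f u = {to_nat_on (Field r) u}" for u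
  have inj: "inj_on f (Field r)"
    using inj_on_to_nat_on[OF halting_countable[OF assms]] by (auto simp: f_def inj_on_def)
  then have "inv_into (Field r) f (f t) = t" using assms(2) by simp
  then show ?thesis unfolding itrm_outputs_def
    using itrm_computation_dir_image[OF assms(1) inj] assms(2,3)
    by (intro exI[of _ "dir_image r f"] exI[of _ "\<lambda>s. C (inv_into (Field r) f s)"] exI[of _ "f t"])
      (simp add: dir_image_Field)
qed

end

theory Submission
  imports Defs
begin

text \<open>Let \<open>X\<close> be a decidable meager set containing \<open>a \<oplus> b\<close>. If the section of \<open>X\<close> at \<open>a\<close> is meager, it
  witnesses that \<open>b\<close> is not random relative to \<open>a\<close>. Otherwise \<open>a\<close> lies in the set \<open>Z\<close> of all \<open>x\<close> at which
  the section is not meager, and \<open>Z\<close> is meager by Kuratowski and Ulam; it remains to decide \<open>Z\<close>.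

  ITRMs can decide whether a decidable tree has an infinite branch, by a depth-first search that uses
  the limit behaviour of two registers. Hence the decidable relations are closed under number
  quantifiers and under the quantifier ``the second player wins the closed game''. Conversely, a
  relation decided by an ITRM can be built with these operations: whether a configuration leads to
  another one is an inductive definition, except for limits at which registers overflow, and those
  are infinite branches for inductive definitions in which fewer registers overflow. Finally, relations
  built in this way have the Baire property and are closed under the category quantifier, since
  Cohen forcing for the game quantifier is again expressed by a closed game.\<close>

section \<open>Runs through the countable ordinals\<close>

text \<open>The obstacle is the quantifier over \<open>y\<close> in "the section at \<open>x\<close>
  is not meager": a machine with oracle \<open>x\<close> cannot run the given program on every
  \<open>x \<oplus>\<^sub>J y\<close>. A program offers no structure along which such a quantifier
  could be eliminated, hence the detour through an inductively generated class of relations. Closed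
  games enter instead of infinite branches because this class must be closed under forcing: while a
  branch is being forced, an opponent may extend the condition before each of its moves, so forcing
  a branch is already a game. Games are nevertheless no harder than branches, since a positional
  strategy is one sequence of numbers and to be winning is a condition on its finite initial
  segments. The description of runs is uniform in the oracle because the nesting of overflows is
  bounded by the number of components of a configuration, which depends on the program alone; each
  level costs a fixed number of uses of the game quantifier. Time is \<open>omega1\<close> because
  halting computations have countable length, so that one type carries all runs as total
  functions.\<close>

typedef omega1 = "Field (cardSuc natLeq)"
proof -
  have "infinite (Field (cardSuc natLeq))"
    using cardSuc_finite[OF natLeq_Card_order] by (simp add: Field_natLeq)
  then show ?thesis by (metis equals0I finite.emptyI)
qed

lemma omega1_Well_order: "Well_order (cardSuc natLeq)"
  using cardSuc_Card_order[OF natLeq_Card_order] card_order_on_well_order_on by blast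

instantiation omega1 :: wellorder
begin
definition less_eq_omega1 :: "omega1 \<Rightarrow> omega1 \<Rightarrow> bool" where
  "a \<le> b \<longleftrightarrow> (Rep_omega1 a, Rep_omega1 b) \<in> cardSuc natLeq"
definition less_omega1 :: "omega1 \<Rightarrow> omega1 \<Rightarrow> bool" where
  "(a :: omega1) < b \<longleftrightarrow> a \<le> b \<and> a \<noteq> b"
instance
proof
  note W = omega1_Well_order
  show "a < b \<longleftrightarrow> a \<le> b \<and> \<not> b \<le> a" for a b :: omega1
    using wo_antisym[OF W] by (auto simp: less_eq_omega1_def less_omega1_def Rep_omega1_inject[symmetric])
  show "a \<le> a" for a :: omega1 using wo_refl[OF W Rep_omega1] by (simp add: less_eq_omega1_def)
  show "a \<le> b \<Longrightarrow> b \<le> c \<Longrightarrow> a \<le> c" for a b c :: omega1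
    using wo_trans[OF W] by (simp add: less_eq_omega1_def)
  show "a \<le> b \<Longrightarrow> b \<le> a \<Longrightarrow> a = b" for a b :: omega1
    using wo_antisym[OF W] by (simp add: less_eq_omega1_def Rep_omega1_inject[symmetric])
  show "a \<le> b \<or> b \<le> a" for a b :: omega1
    using wo_le_cases[OF W Rep_omega1 Rep_omega1, of a b] by (auto simp: less_eq_omega1_def underS_def)
  show "Q a" if IH: "\<And>b. (\<And>c. c < b \<Longrightarrow> Q c) \<Longrightarrow> Q b" for Q and a :: omega1
  proof -
    have "b = Rep_omega1 a \<Longrightarrow> Q a" for a b
    proof (induction b arbitrary: a rule: wo_induct[OF W])
      case (1 b)
      show ?case
        by (rule IH, rule 1(1)[OF _ refl])
          (use 1(2) in \<open>auto simp: less_omega1_def less_eq_omega1_def underS_def Rep_omega1_inject\<close>)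
    qed
    then show ?thesis by blast
  qed
qed
end

context includes cardinal_syntax
begin

lemma countable_iff_le_natLeq: "countable A \<longleftrightarrow> |A| \<le>o natLeq"
proof -
  have "countable A \<longleftrightarrow> |A| \<le>o |UNIV :: nat set|"
    unfolding countable_def card_of_ordLeq[symmetric] by auto
  then show ?thesis
    using card_of_nat ordLeq_ordIso_trans ordIso_symmetric by blast
qed

lemma countable_below_omega1: "countable {s. s < (t :: omega1)}"
proof -
  have "|underS (cardSuc natLeq) (Rep_omega1 t)| <o cardSuc natLeq"
    using card_of_underS[OF cardSuc_Card_order[OF natLeq_Card_order] Rep_omega1] .
  then have "countable (underS (cardSuc natLeq) (Rep_omega1 t))"
    using cardSuc_ordLeq_ordLess[OF natLeq_Card_order card_of_Card_order] countable_iff_le_natLeq by blast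
  moreover have "Rep_omega1 ` {s. s < t} \<subseteq> underS (cardSuc natLeq) (Rep_omega1 t)"
    by (auto simp: less_omega1_def less_eq_omega1_def underS_def Rep_omega1_inject)
  ultimately have "countable (Rep_omega1 ` {s. s < t})" by (rule countable_subset[rotated])
  then show ?thesis by (rule countable_image_inj_on) (auto simp: inj_on_def Rep_omega1_inject)
qed

lemma uncountable_omega1: "uncountable (UNIV :: omega1 set)"
proof
  assume "countable (UNIV :: omega1 set)"
  then have "countable (range Rep_omega1)" by simp
  moreover have "range Rep_omega1 = Field (cardSuc natLeq)"
    using type_definition.Rep_range[OF type_definition_omega1] .
  ultimately have "|Field (cardSuc natLeq)| \<le>o natLeq" using countable_iff_le_natLeq by metis
  moreover have "|Field (cardSuc natLeq)| =o cardSuc natLeq"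
    using card_of_Field_ordIso[OF cardSuc_Card_order[OF natLeq_Card_order]] .
  ultimately have "cardSuc natLeq \<le>o natLeq" using ordIso_ordLeq_trans ordIso_symmetric by blast
  then show False using cardSuc_greater[OF natLeq_Card_order] not_ordLess_ordLeq by blast
qed

end

text \<open>Regularity of the first uncountable ordinal: a countable union of countable initial
  segments cannot be the whole type. It makes \<open>osuc\<close> total and supplies the limit
  stages in \<open>osup\<close>.\<close>

lemma omega1_bounded: "\<exists>b. \<forall>n. f n < (b :: omega1)" for f :: "nat \<Rightarrow> omega1"
proof (rule ccontr)
  assume "\<not> ?thesis"
  then have "b \<in> (\<Union>n. insert (f n) {s. s < f n})" for b by (auto simp: not_less) (meson le_less)
  then have "(UNIV :: omega1 set) = (\<Union>n. insert (f n) {s. s < f n})" by blast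
  moreover have "countable (\<Union>n. insert (f n) {s. s < f n})" using countable_below_omega1 by auto
  ultimately show False using uncountable_omega1 by simp
qed

definition osuc :: "omega1 \<Rightarrow> omega1" where "osuc s = (LEAST t. s < t)"

lemma osuc_gt [simp]: "s < osuc s"
  unfolding osuc_def using omega1_bounded[of "\<lambda>_. s"] by (auto intro: LeastI)

lemma osuc_le: "s < t \<Longrightarrow> osuc s \<le> t"
  unfolding osuc_def by (rule Least_le)

lemma less_osuc_iff: "u < osuc s \<longleftrightarrow> u \<le> s"
  using osuc_gt osuc_le by (meson leD le_less_trans not_less)

abbreviation le1 :: "omega1 rel" where "le1 \<equiv> {(a, b). a \<le> b}"

lemma Field_le1: "Field le1 = UNIV" by (auto simp: Field_def)

lemma Well_order_le1: "Well_order le1"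
proof -
  have "Linear_order le1"
    unfolding linear_order_on_def partial_order_on_def preorder_on_def Field_le1
    by (auto simp: refl_on_def trans_def antisym_def total_on_def Field_le1)
  moreover have "le1 - Id = {(a, b). a < b}" by auto
  ultimately show ?thesis by (simp add: well_order_on_def wf)
qed

lemma underS_le1 [simp]: "underS le1 t = {..<t}" by (auto simp: underS_def)
lemma under_le1 [simp]: "under le1 t = {..t}" by (auto simp: under_def)

lemma is_pred_le1: "is_pred le1 s t \<longleftrightarrow> t = osuc s"
proof
  assume "is_pred le1 s t"
  then have "{..<t} = {..s}" by (simp add: is_pred_def)
  then have "u < t \<longleftrightarrow> u \<le> s" for u by auto
  then show "t = osuc s" by (metis less_osuc_iff linorder_neqE order_less_irrefl)
qed (auto simp: is_pred_def Field_le1 less_osuc_iff)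

definition olimit :: "omega1 \<Rightarrow> bool" where
  "olimit t \<longleftrightarrow> (\<exists>s. s < t) \<and> (\<forall>s<t. osuc s < t)"

lemma omega1_cases:
  obtains (bot) "\<And>s. t \<le> s" | (suc) s where "t = osuc s" | (lim) "olimit t"
proof (cases "\<exists>s. t = osuc s")
  case False
  then have "osuc s < t" if "s < t" for s using osuc_le[OF that] by (auto simp: le_less)
  then show ?thesis using bot lim unfolding olimit_def by (meson not_less)
qed (use suc in blast)

text \<open>The least strict upper bound of \<open>\<tau>\<close> works. Strict increase makes it a
  limit and makes the stages \<open>\<tau> n\<close> cofinal in it; every limit stage constructed
  below arises in this way.\<close>

lemma osup:
  assumes "\<And>n. \<tau> n < \<tau> (Suc n)"
  obtains l :: omega1 where "olimit l" "\<And>n. \<tau> n < l" "\<And>u. u < l \<Longrightarrow> \<exists>n. u < \<tau> n"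
proof -
  define l where "l = (LEAST b. \<forall>n. \<tau> n < b)"
  have l: "\<tau> n < l" for n
    using LeastI_ex[OF omega1_bounded[of \<tau>]] by (simp add: l_def)
  have c: "\<exists>n. u < \<tau> n" if "u < l" for u
    using not_less_Least[OF that[unfolded l_def]] assms by (metis le_less_trans not_less)
  have "olimit l" unfolding olimit_def using l c osuc_le by (metis le_less_trans)
  then show ?thesis using that l c by blast
qed

section \<open>Limits of register contents\<close>

lemma wo_max:
  assumes W: "Well_order r" and s: "s \<in> underS r t" "s' \<in> underS r t"
  obtains m where "m \<in> underS r t" "\<And>u. (m, u) \<in> r \<Longrightarrow> (s, u) \<in> r \<and> (s', u) \<in> r"
proof -
  have F: "s \<in> Field r" "s' \<in> Field r" using s by (auto simp: underS_def Field_def)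
  have "(s, s') \<in> r \<or> (s', s) \<in> r" using wo_le_cases[OF W F] by (auto simp: underS_def)
  then show thesis
  proof
    assume "(s, s') \<in> r"
    then show thesis using that[OF s(2)] wo_trans[OF W, of s s'] by blast
  next
    assume "(s', s) \<in> r"
    then show thesis using that[OF s(1)] wo_trans[OF W, of s' s] by blast
  qed
qed

text \<open>A limit inferior 0 and an overflow both yield 0, so it need not be known whether the
  zeros recur. A positive finite limit inferior is impossible: the values would eventually be
  nonzero and hence exceed it.\<close>

lemma lim_val_zeroI:
  assumes W: "Well_order r"
    and *: "\<And>M. \<exists>s\<in>underS r t. \<forall>u\<in>underS r t. (s, u) \<in> r \<longrightarrow> f u = 0 \<or> M \<le> f u"
  shows "lim_val r t f = 0"
proof (rule ccontr)
  assume "lim_val r t f \<noteq> 0"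
  then obtain n where n: "liminf_before r t f = enat n" "n > 0"
    by (auto simp: lim_val_def split: enat.splits)
  have "enat n \<le> liminf_before r t f" using n by simp
  then obtain s where s: "s \<in> underS r t" "\<And>u. u \<in> underS r t \<Longrightarrow> (s, u) \<in> r \<Longrightarrow> n \<le> f u"
    unfolding le_liminf_before using n(2) by blast
  obtain s' where s': "s' \<in> underS r t"
      "\<And>u. u \<in> underS r t \<Longrightarrow> (s', u) \<in> r \<Longrightarrow> f u = 0 \<or> Suc n \<le> f u"
    using * by meson
  obtain m where m: "m \<in> underS r t" "\<And>u. (m, u) \<in> r \<Longrightarrow> (s, u) \<in> r \<and> (s', u) \<in> r"
    using wo_max[OF W s(1) s'(1)] by blast
  have "Suc n \<le> f u" if "u \<in> underS r t" "(m, u) \<in> r" for u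
    using s(2)[OF that(1)] s'(2)[OF that(1)] m(2)[OF that(2)] n(2) by auto
  then have "enat (Suc n) \<le> liminf_before r t f" unfolding le_liminf_before using m(1) by blast
  then show False using n by simp
qed

text \<open>For natural numbers a finite limit inferior is eventually a lower bound and is attained
  cofinally often; otherwise the values tend to infinity. These two cases become the two limit rules
  for reachability.\<close>

lemma lim_val_cases:
  assumes W: "Well_order r" and ne: "underS r t \<noteq> {}"
  shows "(\<exists>s\<in>underS r t. \<forall>u\<in>underS r t. (s, u) \<in> r \<longrightarrow> lim_val r t f \<le> f u) \<and>
      (\<forall>s\<in>underS r t. \<exists>u\<in>underS r t. (s, u) \<in> r \<and> f u = lim_val r t f) \<or>
    lim_val r t f = 0 \<and> (\<forall>M. \<exists>s\<in>underS r t. \<forall>u\<in>underS r t. (s, u) \<in> r \<longrightarrow> M \<le> f u)"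
proof (cases "liminf_before r t f")
  case (enat n)
  then have v: "lim_val r t f = n" by (simp add: lim_val_def)
  have "enat n \<le> liminf_before r t f" using enat by simp
  then obtain s where s: "s \<in> underS r t" "\<And>u. u \<in> underS r t \<Longrightarrow> (s, u) \<in> r \<Longrightarrow> n \<le> f u"
    unfolding le_liminf_before using ne by blast
  have "\<exists>u\<in>underS r t. (s', u) \<in> r \<and> f u = n" if s': "s' \<in> underS r t" for s'
  proof -
    obtain m where m: "m \<in> underS r t" "\<And>u. (m, u) \<in> r \<Longrightarrow> (s, u) \<in> r \<and> (s', u) \<in> r"
      using wo_max[OF W s(1) s'] by blast
    have "\<not> enat (Suc n) \<le> liminf_before r t f" using enat by simp
    then obtain u where u: "u \<in> underS r t" "(m, u) \<in> r" "\<not> Suc n \<le> f u"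
      using m(1) unfolding le_liminf_before by blast
    then have "f u = n" using s(2)[OF u(1)] m(2)[OF u(2)] by simp
    then show ?thesis using u m(2) by blast
  qed
  then show ?thesis using s unfolding v by blast
next
  case infinity
  then have v: "lim_val r t f = 0" by (simp add: lim_val_def)
  have "\<exists>s\<in>underS r t. \<forall>u\<in>underS r t. (s, u) \<in> r \<longrightarrow> M \<le> f u" for M
  proof -
    have "enat M \<le> liminf_before r t f" using infinity by simp
    then show ?thesis unfolding le_liminf_before using ne by blast
  qed
  then show ?thesis using v by blast
qed

section \<open>Runs as functions on the countable ordinals\<close>

definition nxt :: "program \<Rightarrow> nat set \<Rightarrow> config \<Rightarrow> config" where
  "nxt P x c = (if fst c < length P then exec x (P ! fst c) c else c)"

text \<open>A halted machine keeps its configuration, so that the run goes through all countable ordinals.\<close>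

definition timeline :: "program \<Rightarrow> nat set \<Rightarrow> (omega1 \<Rightarrow> config) \<Rightarrow> bool" where
  "timeline P x C \<longleftrightarrow> (\<forall>t. (\<forall>s. t \<le> s) \<longrightarrow> C t = (0, \<lambda>_. 0)) \<and>
    (\<forall>s. C (osuc s) = nxt P x (C s)) \<and> (\<forall>t. olimit t \<longrightarrow> C t = lim_config le1 C t)"

lemma liminf_before_cong:
  "(\<And>u. u \<in> underS r t \<Longrightarrow> f u = g u) \<Longrightarrow> liminf_before r t f = liminf_before r t g"
  by (rule enat_eqI) (simp add: le_liminf_before)

lemma lim_config_cong:
  "(\<And>u. u \<in> underS r t \<Longrightarrow> C u = C' u) \<Longrightarrow> lim_config r C t = lim_config r C' t"
  unfolding lim_config_def lim_val_def
  by (simp cong: liminf_before_cong)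

lemma timeline_exists: "\<exists>C. timeline P x C"
proof -
  define F where "F f t = (if \<forall>s. t \<le> s then (0, \<lambda>_. 0)
    else if \<exists>s. t = osuc s then nxt P x (f (SOME s. t = osuc s)) else lim_config le1 f t)"
    for f :: "omega1 \<Rightarrow> config" and t
  define C where "C = wfrec {(a, b). a < b} F"
  have C: "C t = F (cut C {(a, b). a < b} t) t" for t
    unfolding C_def by (rule wfrec) (rule wf)
  \<comment> \<open>Injectivity of \<open>osuc\<close> ensures that \<open>SOME\<close> in
    \<open>F\<close> picks the actual predecessor.\<close>
  have inj: "osuc a = osuc b \<Longrightarrow> a = b" for a b
    by (rule antisym) (metis less_osuc_iff order_refl)+
  have "C (osuc s) = nxt P x (C s)" for s
  proof -
    have "(SOME s'. osuc s = osuc s') = s" using inj by (metis (mono_tags, lifting) someI_ex)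
    moreover have "\<not> (\<forall>u. osuc s \<le> u)" using osuc_gt not_less by blast
    ultimately show ?thesis using C[of "osuc s"] by (auto simp: F_def cut_apply)
  qed
  moreover have "C t = lim_config le1 C t" if "olimit t" for t
  proof -
    have nb: "\<not> (\<forall>s. t \<le> s)" "\<not> (\<exists>s. t = osuc s)" using that
      by (auto simp: olimit_def not_le) (metis osuc_gt less_irrefl)
    have "C t = lim_config le1 (cut C {(a, b). a < b} t) t" using C[of t]
      by (simp only: F_def if_not_P[OF nb(1)] if_not_P[OF nb(2)])
    also have "\<dots> = lim_config le1 C t" by (rule lim_config_cong) (simp add: cut_apply)
    finally show ?thesis .
  qed
  moreover have "C t = (0, \<lambda>_. 0)" if "\<forall>s. t \<le> s" for t using C[of t] that by (simp add: F_def)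
  ultimately show ?thesis unfolding timeline_def by blast
qed

lemma timeline_lim:
  assumes "timeline P x C" "olimit t"
  shows "comp_of k (C t) = lim_val le1 t (\<lambda>s. comp_of k (C s))"
proof -
  have "C t = lim_config le1 C t" using assms by (simp add: timeline_def)
  then show ?thesis by (cases k) (simp_all add: lim_config_def comp_of_def)
qed

lemma timeline_lim_eqI:
  assumes "timeline P x C" "olimit t" "s < t"
    and "\<And>u. s \<le> u \<Longrightarrow> u < t \<Longrightarrow> v \<le> comp_of k (C u)"
    and "\<And>s. s < t \<Longrightarrow> \<exists>u. s \<le> u \<and> u < t \<and> comp_of k (C u) = v"
  shows "comp_of k (C t) = v"
  unfolding timeline_lim[OF assms(1,2)]
  by (rule lim_val_eqI[of s]) (use assms(3-5) in auto)

lemma timeline_lim_zeroI: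
  assumes "timeline P x C" "olimit t"
    and "\<And>M. \<exists>s<t. \<forall>u. s \<le> u \<longrightarrow> u < t \<longrightarrow> comp_of k (C u) = 0 \<or> M \<le> comp_of k (C u)"
  shows "comp_of k (C t) = 0"
  unfolding timeline_lim[OF assms(1,2)]
proof (rule lim_val_zeroI[OF Well_order_le1])
  fix M
  obtain s where "s < t" "\<forall>u. s \<le> u \<longrightarrow> u < t \<longrightarrow> comp_of k (C u) = 0 \<or> M \<le> comp_of k (C u)"
    using assms(3) by blast
  then show "\<exists>s\<in>underS le1 t. \<forall>u\<in>underS le1 t. (s, u) \<in> le1 \<longrightarrow> comp_of k (C u) = 0 \<or> M \<le> comp_of k (C u)"
    by (intro bexI[of _ s]) auto
qed

lemma timeline_halted:
  assumes T: "timeline P x C" and h: "length P \<le> fst (C s)" and "s \<le> t"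
  shows "C t = C s"
  using assms(3)
proof (induction t rule: less_induct)
  case (less t)
  show ?case
  proof (cases "t = s")
    case False
    then have st: "s < t" using less by auto
    show ?thesis
    proof (cases t rule: omega1_cases)
      case bot then show ?thesis using st by (simp add: not_less[symmetric])
    next
      case (suc u)
      then have "C u = C s" using less.IH[of u] st by (simp add: less_osuc_iff)
      then show ?thesis using T h suc by (simp add: timeline_def nxt_def)
    next
      case lim
      show ?thesis
      proof (rule config_eqI)
        show "comp_of k (C t) = comp_of k (C s)" for k
        proof (rule timeline_lim_eqI[OF T lim st])
          show "\<exists>u\<ge>s'. u < t \<and> comp_of k (C u) = comp_of k (C s)" if "s' < t" for s'
            using less.IH[of "max s s'"] st that by (intro exI[of _ "max s s'"]) simp
          show "comp_of k (C s) \<le> comp_of k (C u)" if "s \<le> u" "u < t" for u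
            using less.IH[OF that(2,1)] by simp
        qed
      qed
    qed
  qed simp
qed

text \<open>Cutting a run down to an initial segment gives a computation in the original sense. A
  halted configuration has no successor there, whereas a run repeats it; \<open>run\<close> keeps
  such repetitions out of \<open>S\<close>.\<close>

lemma timeline_computation:
  assumes T: "timeline P x C" and down: "\<And>u v. v \<in> S \<Longrightarrow> u \<le> v \<Longrightarrow> u \<in> S"
    and run: "\<And>u v. v \<in> S \<Longrightarrow> u < v \<Longrightarrow> fst (C u) < length P"
  shows "itrm_computation P x (Restr le1 S) C"
proof -
  let ?r = "Restr le1 S"
  have F: "Field ?r = S" by (auto simp: Field_def)
  have uS: "underS ?r s = {..<s}" "under ?r s = {..s}" if "s \<in> S" for s
    using that down[OF that] by (auto simp: underS_def under_def)
  have pr: "is_pred ?r s u \<longleftrightarrow> u = osuc s" if "u \<in> S" for s u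
  proof -
    have "is_pred ?r s u \<longleftrightarrow> s \<in> S \<and> is_pred le1 s u"
      using that uS by (auto simp: is_pred_def F Field_le1)
    then show ?thesis using down[OF that, of s] less_imp_le[OF osuc_gt[of s]] by (auto simp: is_pred_le1)
  qed
  have lv: "liminf_before ?r u f = liminf_before le1 u f" if "u \<in> S" for u f
    unfolding liminf_before_def uS[OF that] underS_le1
    by (rule arg_cong[where f = Sup], rule image_cong[OF refl], rule arg_cong[where f = Inf],
      rule image_cong) (use down[OF that] in auto)
  show ?thesis
    unfolding itrm_computation_def
  proof (intro conjI ballI)
    show "Well_order ?r" using Well_order_Restr[OF Well_order_le1] .
    fix u assume "u \<in> Field ?r"
    then have u: "u \<in> S" by (simp add: F)
    show "underS ?r u = {} \<longrightarrow> C u = (0, \<lambda>_. 0)"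
    proof
      assume "underS ?r u = {}"
      then have "\<forall>s. u \<le> s" using uS(1)[OF u] by (auto simp: not_less[symmetric])
      then show "C u = (0, \<lambda>_. 0)" using T by (simp add: timeline_def)
    qed
    show "\<forall>s. is_pred ?r s u \<longrightarrow> fst (C s) < length P \<and> C u = exec x (P ! fst (C s)) (C s)"
    proof (intro allI impI)
      fix s assume "is_pred ?r s u"
      then have s: "u = osuc s" using pr[OF u] by simp
      then have "fst (C s) < length P" using run[OF u, of s] by simp
      then show "fst (C s) < length P \<and> C u = exec x (P ! fst (C s)) (C s)"
        using T s by (simp add: timeline_def nxt_def)
    qed
    show "underS ?r u \<noteq> {} \<and> (\<nexists>s. is_pred ?r s u) \<longrightarrow> C u = lim_config ?r C u"
    proof
      assume *: "underS ?r u \<noteq> {} \<and> (\<nexists>s. is_pred ?r s u)"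
      have "olimit u"
      proof (cases u rule: omega1_cases)
        assume "\<And>s. u \<le> s"
        then show "olimit u" using * uS(1)[OF u] by (auto simp: not_less[symmetric])
      qed (use * pr[OF u] in auto)
      then show "C u = lim_config ?r C u"
        using T lv[OF u] by (simp add: timeline_def lim_config_def lim_val_def)
    qed
  qed
qed

lemma timeline_outputs:
  assumes T: "timeline P x C" and h: "length P \<le> fst (C t)"
  shows "itrm_outputs P x (snd (C t) 0)"
proof -
  \<comment> \<open>The cut is made at the first halting time; all later times show the same
    configuration.\<close>
  define m where "m = (LEAST t. length P \<le> fst (C t))"
  have m: "length P \<le> fst (C m)" "m \<le> t" unfolding m_def using h by (auto intro: LeastI Least_le)
  have b: "fst (C u) < length P" if "u < m" for u
    using not_less_Least[OF that[unfolded m_def]] by simp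
  have "itrm_computation P x (Restr le1 {..m}) C"
    by (rule timeline_computation[OF T]) (use b in auto)
  then have "itrm_outputs P x (snd (C m) 0)" by (rule itrm_outputsI) (use m in \<open>auto simp: Field_def\<close>)
  then show ?thesis using timeline_halted[OF T m] by simp
qed

text \<open>With a predicate as postcondition there is no need to know that the run from \<open>c\<close> is determined
  by \<open>c\<close>.\<close>

definition seg :: "program \<Rightarrow> nat set \<Rightarrow> (config \<Rightarrow> bool) \<Rightarrow> config \<Rightarrow> (config \<Rightarrow> bool) \<Rightarrow> bool" where
  "seg P x I c Q \<longleftrightarrow> (\<forall>C s. timeline P x C \<longrightarrow> C s = c \<longrightarrow>
     (\<exists>t>s. Q (C t) \<and> (\<forall>u. s \<le> u \<longrightarrow> u < t \<longrightarrow> I (C u))))"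

lemma seg_mono:
  "seg P x I c Q \<Longrightarrow> (\<And>e. I e \<Longrightarrow> J e) \<Longrightarrow> (\<And>e. Q e \<Longrightarrow> Q' e) \<Longrightarrow> seg P x J c Q'"
  unfolding seg_def by blast

lemma seg_fin: "I c \<Longrightarrow> Q (nxt P x c) \<Longrightarrow> seg P x I c Q"
  unfolding seg_def timeline_def
  by (intro allI impI, rule_tac x = "osuc s" in exI) (auto simp: less_osuc_iff)

lemma seg_trans:
  assumes "seg P x I c Q" "\<And>d. Q d \<Longrightarrow> seg P x I d Q'"
  shows "seg P x I c Q'"
  unfolding seg_def
proof (intro allI impI)
  fix C s assume T: "timeline P x C" and c: "C s = c"
  obtain t where t: "t > s" "Q (C t)" "\<forall>u. s \<le> u \<longrightarrow> u < t \<longrightarrow> I (C u)"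
    using assms(1) T c unfolding seg_def by blast
  obtain t' where t': "t' > t" "Q' (C t')" "\<forall>u. t \<le> u \<longrightarrow> u < t' \<longrightarrow> I (C u)"
    using assms(2)[OF t(2)] T unfolding seg_def by blast
  show "\<exists>t>s. Q' (C t) \<and> (\<forall>u. s \<le> u \<longrightarrow> u < t \<longrightarrow> I (C u))"
    using t t' by (intro exI[of _ t']) (meson less_trans not_less)
qed

lemma seg_step: "I c \<Longrightarrow> seg P x I (nxt P x c) Q \<Longrightarrow> seg P x I c Q"
  by (rule seg_trans[OF seg_fin[of I c "\<lambda>d. d = nxt P x c"]]) auto

text \<open>Infinitely many segments in succession, followed by their limit: \<open>Q n\<close>
  holds where segment \<open>n\<close> starts and \<open>J n\<close> throughout it. As the starts
  are cofinal in the limit, a component that is always at least \<open>v\<close> and equals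
  \<open>v\<close> at the starts has the value \<open>v\<close> there; one that is eventually zero
  or large becomes 0 by \<open>timeline_lim_zeroI\<close>.\<close>

lemma seg_limit:
  assumes step: "\<And>n c. Q n c \<Longrightarrow> seg P x (J n) c (Q (Suc n))" and init: "Q 0 c"
  shows "seg P x (\<lambda>e. \<exists>n. J n e) c (\<lambda>d.
    (\<forall>k v. (\<forall>n e. J n e \<longrightarrow> v \<le> comp_of k e) \<longrightarrow> (\<forall>n c. Q n c \<longrightarrow> comp_of k c = v) \<longrightarrow> comp_of k d = v) \<and>
    (\<forall>k. (\<forall>M. \<exists>N. \<forall>n\<ge>N. \<forall>e. J n e \<longrightarrow> comp_of k e = 0 \<or> M \<le> comp_of k e) \<longrightarrow> comp_of k d = 0))"
  unfolding seg_def
proof (intro allI impI)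
  fix C s assume T: "timeline P x C" and c: "C s = c"
  have ex: "\<exists>t'>t. Q (Suc n) (C t') \<and> (\<forall>u. t \<le> u \<longrightarrow> u < t' \<longrightarrow> J n (C u))" if "Q n (C t)" for n t
    using step[OF that] T unfolding seg_def by blast
  define g where "g n t = (SOME t'. t' > t \<and> Q (Suc n) (C t') \<and> (\<forall>u. t \<le> u \<longrightarrow> u < t' \<longrightarrow> J n (C u)))" for n t
  have g: "g n t > t \<and> Q (Suc n) (C (g n t)) \<and> (\<forall>u. t \<le> u \<longrightarrow> u < g n t \<longrightarrow> J n (C u))"
    if "Q n (C t)" for n t
    unfolding g_def by (rule someI_ex) (rule ex[OF that])
  define \<tau> where "\<tau> = rec_nat s g"
  have Q: "Q n (C (\<tau> n))" for n
    by (induction n) (use init c g in \<open>auto simp: \<tau>_def\<close>)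
  have \<tau>: "\<tau> n < \<tau> (Suc n)" and J: "\<And>u. \<tau> n \<le> u \<Longrightarrow> u < \<tau> (Suc n) \<Longrightarrow> J n (C u)" for n
    using g[OF Q[of n]] by (simp_all add: \<tau>_def)
  obtain l where l: "olimit l" "\<And>n. \<tau> n < l" "\<And>u. u < l \<Longrightarrow> \<exists>n. u < \<tau> n" using osup[of \<tau>, OF \<tau>] by blast
  have mono: "\<tau> m \<le> \<tau> n" if "m \<le> n" for m n
    using lift_Suc_mono_le[of \<tau>, OF _ that] \<tau> by (simp add: less_imp_le)
  \<comment> \<open>The predecessor of the least \<open>m\<close> with \<open>u < \<tau> m\<close>
    names the segment containing \<open>u\<close>.\<close>
  have loc: "\<exists>n\<ge>N. \<tau> n \<le> u \<and> u < \<tau> (Suc n)" if u: "\<tau> N \<le> u" "u < l" for u N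
  proof -
    define m where "m = (LEAST m. u < \<tau> m)"
    have m: "u < \<tau> m" unfolding m_def using l(3)[OF u(2)] by (auto intro: LeastI)
    have "N < m" using m u(1) mono by (meson le_less_trans not_le order_less_irrefl)
    then obtain n where n: "m = Suc n" by (cases m) auto
    then have "\<not> u < \<tau> n" using not_less_Least[of n "\<lambda>m. u < \<tau> m"] by (simp add: m_def)
    then show ?thesis using m n \<open>N < m\<close> by (intro exI[of _ n]) auto
  qed
  have s: "s = \<tau> 0" by (simp add: \<tau>_def)
  show "\<exists>t>s. ((\<forall>k v. (\<forall>n e. J n e \<longrightarrow> v \<le> comp_of k e) \<longrightarrow> (\<forall>n c. Q n c \<longrightarrow> comp_of k c = v) \<longrightarrow> comp_of k (C t) = v) \<and>
    (\<forall>k. (\<forall>M. \<exists>N. \<forall>n\<ge>N. \<forall>e. J n e \<longrightarrow> comp_of k e = 0 \<or> M \<le> comp_of k e) \<longrightarrow> comp_of k (C t) = 0)) \<and>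
    (\<forall>u\<ge>s. u < t \<longrightarrow> (\<exists>n. J n (C u)))"
  proof (intro exI[of _ l] conjI allI impI)
    show "s < l" using l s by simp
    fix u assume "s \<le> u" "u < l"
    then show "\<exists>n. J n (C u)" using loc[of 0 u] J s by blast
  next
    fix k v assume v: "\<forall>n e. J n e \<longrightarrow> v \<le> comp_of k e" "\<forall>n c. Q n c \<longrightarrow> comp_of k c = v"
    show "comp_of k (C l) = v"
    proof (rule timeline_lim_eqI[OF T l(1) l(2)[of 0]])
      fix u assume "\<tau> 0 \<le> u" "u < l"
      then show "v \<le> comp_of k (C u)" using loc[of 0 u] J v by blast
    next
      fix u assume "u < l"
      then obtain n where "u < \<tau> n" using l(3) by blast
      then show "\<exists>u'\<ge>u. u' < l \<and> comp_of k (C u') = v" using Q v l(2) by (meson less_imp_le)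
    qed
  next
    fix k assume *: "\<forall>M. \<exists>N. \<forall>n\<ge>N. \<forall>e. J n e \<longrightarrow> comp_of k e = 0 \<or> M \<le> comp_of k e"
    show "comp_of k (C l) = 0"
    proof (rule timeline_lim_zeroI[OF T l(1)])
      fix M
      obtain N where N: "\<forall>n\<ge>N. \<forall>e. J n e \<longrightarrow> comp_of k e = 0 \<or> M \<le> comp_of k e" using * by blast
      show "\<exists>s<l. \<forall>u\<ge>s. u < l \<longrightarrow> comp_of k (C u) = 0 \<or> M \<le> comp_of k (C u)"
        using N loc J l(2) by (intro exI[of _ "\<tau> N"]) blast
    qed
  qed
qed

section \<open>Deciding relations by program fragments\<close>

definition ins :: "program \<Rightarrow> nat \<Rightarrow> instr \<Rightarrow> bool" where
  "ins P l i \<longleftrightarrow> l < length P \<and> P ! l = i"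

definition code_at :: "program \<Rightarrow> nat \<Rightarrow> program \<Rightarrow> bool" where
  "code_at P q Q \<longleftrightarrow> (\<forall>j<length Q. ins P (q + j) (Q ! j))"

lemma code_at_Nil [simp]: "code_at P q []" by (simp add: code_at_def)

lemma code_at_Cons [simp]: "code_at P q (i # Q) \<longleftrightarrow> ins P q i \<and> code_at P (Suc q) Q"
  by (auto simp: code_at_def nth_Cons less_Suc_eq_0_disj split: nat.splits)

lemma code_at_append [simp]:
  "code_at P q (Q @ Q') \<longleftrightarrow> code_at P q Q \<and> code_at P (q + length Q) Q'"
  by (induction Q arbitrary: q) auto

lemma code_at_whole: "code_at (A @ Q) (length A) Q"
  by (auto simp: code_at_def ins_def nth_append)

text \<open>\<open>seg\<close> requires that time passes; the reflexive version allows a chain of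
  instructions to end exactly at the goal.\<close>

definition segr :: "program \<Rightarrow> nat set \<Rightarrow> (config \<Rightarrow> bool) \<Rightarrow> config \<Rightarrow> (config \<Rightarrow> bool) \<Rightarrow> bool" where
  "segr P x I c Q \<longleftrightarrow> Q c \<or> seg P x I c Q"

lemma segr_here: "Q c \<Longrightarrow> segr P x I c Q" by (simp add: segr_def)

lemma seg_segr: "seg P x I c Q \<Longrightarrow> segr P x I c Q" by (simp add: segr_def)

lemma seg_ins:
  assumes "ins P l i" "I (l, \<rho>)" "segr P x I (exec x i (l, \<rho>)) Q"
  shows "seg P x I (l, \<rho>) Q"
proof -
  have "nxt P x (l, \<rho>) = exec x i (l, \<rho>)" using assms(1) by (simp add: nxt_def ins_def)
  then show ?thesis using assms(2,3) seg_fin[of I "(l, \<rho>)" Q P x] seg_step[of I "(l, \<rho>)" P x Q]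
    by (auto simp: segr_def)
qed

lemmas segr_ins = seg_ins[THEN seg_segr]

lemma seg_segr_trans:
  assumes "seg P x I c Q" "\<And>d. Q d \<Longrightarrow> segr P x I d Q'"
  shows "seg P x I c Q'"
  unfolding seg_def
proof (intro allI impI)
  fix C s assume T: "timeline P x C" and c: "C s = c"
  obtain t where t: "t > s" "Q (C t)" "\<forall>u. s \<le> u \<longrightarrow> u < t \<longrightarrow> I (C u)"
    using assms(1) T c unfolding seg_def by blast
  show "\<exists>t>s. Q' (C t) \<and> (\<forall>u. s \<le> u \<longrightarrow> u < t \<longrightarrow> I (C u))"
  proof (cases "Q' (C t)")
    case True then show ?thesis using t by blast
  next
    case False
    then have "seg P x I (C t) Q'" using assms(2)[OF t(2)] by (simp add: segr_def)
    then obtain t' where t': "t' > t" "Q' (C t')" "\<forall>u. t \<le> u \<longrightarrow> u < t' \<longrightarrow> I (C u)"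
      using T unfolding seg_def by blast
    then show ?thesis using t by (intro exI[of _ t']) (meson less_trans not_less)
  qed
qed

lemma segr_trans:
  assumes "segr P x I c Q" "\<And>d. Q d \<Longrightarrow> segr P x I d Q'"
  shows "segr P x I c Q'"
  using assms seg_segr_trans[of P x I c Q Q'] unfolding segr_def by blast

lemma seg_limit_regs:
  assumes "\<And>n c. Q n c \<Longrightarrow> seg P x (J n) c (Q (Suc n))" "Q 0 c"
  shows "seg P x (\<lambda>e. \<exists>n. J n e) c (\<lambda>(l, \<sigma>).
    (\<forall>v. (\<forall>n e. J n e \<longrightarrow> v \<le> fst e) \<longrightarrow> (\<forall>n c. Q n c \<longrightarrow> fst c = v) \<longrightarrow> l = v) \<and>
    (\<forall>i v. (\<forall>n e. J n e \<longrightarrow> v \<le> snd e i) \<longrightarrow> (\<forall>n c. Q n c \<longrightarrow> snd c i = v) \<longrightarrow> \<sigma> i = v) \<and>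
    (\<forall>i. (\<forall>M. \<exists>N. \<forall>n\<ge>N. \<forall>e. J n e \<longrightarrow> snd e i = 0 \<or> M \<le> snd e i) \<longrightarrow> \<sigma> i = 0))"
proof (rule seg_mono[OF seg_limit[of Q P x J, OF assms]], assumption, assumption)
  fix e :: config
  assume a: "(\<forall>k v. (\<forall>n e. J n e \<longrightarrow> v \<le> comp_of k e) \<longrightarrow> (\<forall>n c. Q n c \<longrightarrow> comp_of k c = v) \<longrightarrow> comp_of k e = v) \<and>
    (\<forall>k. (\<forall>M. \<exists>N. \<forall>n\<ge>N. \<forall>e. J n e \<longrightarrow> comp_of k e = 0 \<or> M \<le> comp_of k e) \<longrightarrow> comp_of k e = 0)"
  obtain l \<sigma> where e: "e = (l, \<sigma>)" by (cases e)
  have c0: "comp_of 0 = fst" "comp_of (Suc i) = (\<lambda>c. snd c i)" for i by (auto simp: comp_of_def)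
  show "case e of (l, \<sigma>) \<Rightarrow> (\<forall>v. (\<forall>n e. J n e \<longrightarrow> v \<le> fst e) \<longrightarrow> (\<forall>n c. Q n c \<longrightarrow> fst c = v) \<longrightarrow> l = v) \<and>
    (\<forall>i v. (\<forall>n e. J n e \<longrightarrow> v \<le> snd e i) \<longrightarrow> (\<forall>n c. Q n c \<longrightarrow> snd c i = v) \<longrightarrow> \<sigma> i = v) \<and>
    (\<forall>i. (\<forall>M. \<exists>N. \<forall>n\<ge>N. \<forall>e. J n e \<longrightarrow> snd e i = 0 \<or> M \<le> snd e i) \<longrightarrow> \<sigma> i = 0)"
    using a[THEN conjunct1, THEN spec[of _ 0]] a[THEN conjunct1, THEN spec[of _ "Suc i" for i]]
      a[THEN conjunct2, THEN spec[of _ "Suc i" for i]]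
    unfolding e c0 prod.case fst_conv snd_conv by blast
qed

definition truth :: "bool \<Rightarrow> nat" where "truth b = (if b then 1 else 0)"

lemma truth_simps [simp]: "truth True = Suc 0" "truth False = 0" "truth b = 0 \<longleftrightarrow> \<not> b" "0 = truth b \<longleftrightarrow> \<not> b"
  by (auto simp: truth_def)

type_synonym orel = "nat set \<Rightarrow> (nat \<Rightarrow> nat) \<Rightarrow> bool"

text \<open>The registers below \<open>k\<close> must be kept at every intermediate stage and not
  only at the end: a fragment may run cofinally often below a limit of an enclosing loop, whose
  limit inferior sees all these stages. For the same reason the line stays within the
  fragment.\<close>

definition confined :: "nat \<Rightarrow> nat \<Rightarrow> nat \<Rightarrow> (nat \<Rightarrow> nat) \<Rightarrow> config \<Rightarrow> bool" where
  "confined lo hi k \<rho> = (\<lambda>(l, \<sigma>). lo \<le> l \<and> l < hi \<and> (\<forall>i<k. \<sigma> i = \<rho> i))"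

definition decides :: "nat \<Rightarrow> nat \<Rightarrow> program \<Rightarrow> orel \<Rightarrow> bool" where
  "decides q k Q R \<longleftrightarrow> (\<forall>P x \<rho>. code_at P q Q \<longrightarrow>
     seg P x (confined q (q + length Q) k \<rho>) (q, \<rho>)
       (\<lambda>(l, \<sigma>). l = q + length Q \<and> (\<forall>i<k. \<sigma> i = \<rho> i) \<and> \<sigma> k = truth (R x \<rho>)))"

text \<open>Fragments overwrite registers from \<open>k\<close> on; locality guarantees that the
  truth value survives this.\<close>

definition local :: "nat \<Rightarrow> orel \<Rightarrow> bool" where
  "local n R \<longleftrightarrow> (\<forall>x \<rho> \<rho>'. (\<forall>i<n. \<rho> i = \<rho>' i) \<longrightarrow> R x \<rho> = R x \<rho>')"

lemma localD: "local n R \<Longrightarrow> \<forall>i<n. \<rho> i = \<rho>' i \<Longrightarrow> R x \<rho> = R x \<rho>'"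
  by (simp add: local_def)

text \<open>The variables of a relation may be held in arbitrary registers \<open>\<tau> i\<close>; this makes
  substitution of variables trivial.\<close>

definition computable_at :: "nat \<Rightarrow> orel \<Rightarrow> bool" where
  "computable_at n R \<longleftrightarrow> local n R \<and> (\<forall>\<tau> k q. (\<forall>i<n. \<tau> i < k) \<longrightarrow>
     (\<exists>Q. decides q k Q (\<lambda>x \<rho>. R x (\<lambda>i. \<rho> (\<tau> i)))))"

definition computable_rel :: "orel \<Rightarrow> bool" where
  "computable_rel R \<longleftrightarrow> (\<exists>n. computable_at n R)"

lemma computable_at_mono: "computable_at n R \<Longrightarrow> n \<le> m \<Longrightarrow> computable_at m R"
  unfolding computable_at_def local_def
  by (intro conjI allI impI) (auto dest: less_le_trans)

section \<open>Program fragments for atomic relations, connectives and quantifiers\<close>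

lemma computable_eq: "computable_rel (\<lambda>x \<rho>. \<rho> i = \<rho> j)"
  unfolding computable_rel_def computable_at_def
proof (intro exI[of _ "Suc (max i j)"] conjI allI impI)
  show "local (Suc (max i j)) (\<lambda>x \<rho>. \<rho> i = \<rho> j)" by (auto simp: local_def less_Suc_eq_le)
  fix \<tau> :: "nat \<Rightarrow> nat" and k q assume "\<forall>l<Suc (max i j). \<tau> l < k"
  then have t: "\<tau> i < k" "\<tau> j < k" by auto
  let ?Q = "[Zero k, Succ k, Jump (\<tau> i) (\<tau> j) (Suc (Suc (Suc (Suc q)))), Zero k]"
  have "decides q k ?Q (\<lambda>x \<rho>. \<rho> (\<tau> i) = \<rho> (\<tau> j))"
    unfolding decides_def
  proof (intro allI impI)
    fix P x \<rho> assume "code_at P q ?Q"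
    then have c: "ins P q (Zero k)" "ins P (Suc q) (Succ k)"
      "ins P (Suc (Suc q)) (Jump (\<tau> i) (\<tau> j) (Suc (Suc (Suc (Suc q)))))"
      "ins P (Suc (Suc (Suc q))) (Zero k)" by simp_all
    show "seg P x (confined q (q + length ?Q) k \<rho>) (q, \<rho>) (\<lambda>(l, \<sigma>). l = q + length ?Q \<and>
       (\<forall>i<k. \<sigma> i = \<rho> i) \<and> \<sigma> k = truth (\<rho> (\<tau> i) = \<rho> (\<tau> j)))"
      apply (rule seg_ins[OF c(1)], simp add: confined_def, simp)
      apply (rule segr_ins[OF c(2)], simp add: confined_def, simp)
      apply (rule segr_ins[OF c(3)], simp add: confined_def)
      apply (cases "\<rho> (\<tau> i) = \<rho> (\<tau> j)")
      subgoal using t by (intro segr_here) simp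
      subgoal using t by (simp, intro segr_ins[OF c(4)] segr_here) (simp_all add: confined_def)
      done
  qed
  then show "\<exists>Q. decides q k Q (\<lambda>x \<rho>. \<rho> (\<tau> i) = \<rho> (\<tau> j))" by blast
qed

lemma computable_Suc: "computable_rel (\<lambda>x \<rho>. \<rho> i = Suc (\<rho> j))"
  unfolding computable_rel_def computable_at_def
proof (intro exI[of _ "Suc (max i j)"] conjI allI impI)
  show "local (Suc (max i j)) (\<lambda>x \<rho>. \<rho> i = Suc (\<rho> j))" by (auto simp: local_def less_Suc_eq_le)
  fix \<tau> :: "nat \<Rightarrow> nat" and k q assume "\<forall>l<Suc (max i j). \<tau> l < k"
  then have t: "\<tau> i < k" "\<tau> j < k" by auto
  let ?L = "Suc (Suc q)"
  let ?Q = "[Copy (\<tau> j) (Suc k), Succ (Suc k), Zero k, Succ k,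
    Jump (\<tau> i) (Suc k) (Suc (Suc (Suc (Suc ?L)))), Zero k]"
  have "decides q k ?Q (\<lambda>x \<rho>. \<rho> (\<tau> i) = Suc (\<rho> (\<tau> j)))"
    unfolding decides_def
  proof (intro allI impI)
    fix P x \<rho> assume "code_at P q ?Q"
    then have c: "ins P q (Copy (\<tau> j) (Suc k))" "ins P (Suc q) (Succ (Suc k))"
      "ins P ?L (Zero k)" "ins P (Suc ?L) (Succ k)"
      "ins P (Suc (Suc ?L)) (Jump (\<tau> i) (Suc k) (Suc (Suc (Suc (Suc ?L)))))"
      "ins P (Suc (Suc (Suc ?L))) (Zero k)" by simp_all
    show "seg P x (confined q (q + length ?Q) k \<rho>) (q, \<rho>) (\<lambda>(l, \<sigma>). l = q + length ?Q \<and>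
       (\<forall>i<k. \<sigma> i = \<rho> i) \<and> \<sigma> k = truth (\<rho> (\<tau> i) = Suc (\<rho> (\<tau> j))))"
      apply (rule seg_ins[OF c(1)], simp add: confined_def, simp)
      apply (rule segr_ins[OF c(2)], simp add: confined_def, simp)
      apply (rule segr_ins[OF c(3)], simp add: confined_def, simp)
      apply (rule segr_ins[OF c(4)], simp add: confined_def, simp)
      apply (rule segr_ins[OF c(5)], simp add: confined_def)
      apply (cases "\<rho> (\<tau> i) = Suc (\<rho> (\<tau> j))")
      subgoal using t by (intro segr_here) simp
      subgoal using t by (simp, intro segr_ins[OF c(6)] segr_here) (simp_all add: confined_def)
      done
  qed
  then show "\<exists>Q. decides q k Q (\<lambda>x \<rho>. \<rho> (\<tau> i) = Suc (\<rho> (\<tau> j)))" by blast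
qed

lemma computable_mem: "computable_rel (\<lambda>x \<rho>. \<rho> i \<in> x)"
  unfolding computable_rel_def computable_at_def
proof (intro exI[of _ "Suc i"] conjI allI impI)
  show "local (Suc i) (\<lambda>x \<rho>. \<rho> i \<in> x)" by (auto simp: local_def)
  fix \<tau> :: "nat \<Rightarrow> nat" and k q assume "\<forall>l<Suc i. \<tau> l < k"
  let ?Q = "[Copy (\<tau> i) k, Query k]"
  have "decides q k ?Q (\<lambda>x \<rho>. \<rho> (\<tau> i) \<in> x)"
    unfolding decides_def
  proof (intro allI impI)
    fix P x \<rho> assume "code_at P q ?Q"
    then have c: "ins P q (Copy (\<tau> i) k)" "ins P (Suc q) (Query k)" by simp_all
    show "seg P x (confined q (q + length ?Q) k \<rho>) (q, \<rho>) (\<lambda>(l, \<sigma>). l = q + length ?Q \<and>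
       (\<forall>i<k. \<sigma> i = \<rho> i) \<and> \<sigma> k = truth (\<rho> (\<tau> i) \<in> x))"
      by (intro seg_ins[OF c(1)], simp add: confined_def, simp, intro segr_ins[OF c(2)] segr_here)
        (auto simp: confined_def)
  qed
  then show "\<exists>Q. decides q k Q (\<lambda>x \<rho>. \<rho> (\<tau> i) \<in> x)" by blast
qed

lemma computable_ren:
  assumes "computable_rel R" shows "computable_rel (\<lambda>x \<rho>. R x (\<lambda>i. \<rho> (\<sigma> i)))"
proof -
  obtain n where n: "local n R" "\<And>\<tau> k q. (\<forall>i<n. \<tau> i < k) \<Longrightarrow>
     (\<exists>Q. decides q k Q (\<lambda>x \<rho>. R x (\<lambda>i. \<rho> (\<tau> i))))"
    using assms unfolding computable_rel_def computable_at_def by blast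
  let ?m = "Suc (Max (insert 0 (\<sigma> ` {..<n})))"
  have m: "\<sigma> i < ?m" if "i < n" for i using that by (auto simp: less_Suc_eq_le intro!: Max_ge)
  show ?thesis unfolding computable_rel_def computable_at_def
  proof (intro exI[of _ ?m] conjI allI impI)
    show "local ?m (\<lambda>x \<rho>. R x (\<lambda>i. \<rho> (\<sigma> i)))"
      unfolding local_def
    proof (intro allI impI)
      fix x \<rho> \<rho>' assume "\<forall>i<?m. \<rho> i = (\<rho>' i :: nat)"
      then have "\<forall>i<n. \<rho> (\<sigma> i) = \<rho>' (\<sigma> i)" using m by blast
      then show "R x (\<lambda>i. \<rho> (\<sigma> i)) = R x (\<lambda>i. \<rho>' (\<sigma> i))"
        using n(1)[unfolded local_def, rule_format, of "\<lambda>i. \<rho> (\<sigma> i)" "\<lambda>i. \<rho>' (\<sigma> i)"] by blast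
    qed
    fix \<tau> :: "nat \<Rightarrow> nat" and k q :: nat assume "\<forall>i<?m. \<tau> i < k"
    then show "\<exists>Q. decides q k Q (\<lambda>x \<rho>. R x (\<lambda>i. \<rho> (\<tau> (\<sigma> i))))"
      using n(2)[of "\<lambda>i. \<tau> (\<sigma> i)" k q] m by blast
  qed
qed

lemma computable_not:
  assumes "computable_rel R" shows "computable_rel (\<lambda>x \<rho>. \<not> R x \<rho>)"
proof -
  obtain n where n: "local n R" "\<And>\<tau> k q. (\<forall>i<n. \<tau> i < k) \<Longrightarrow>
     (\<exists>Q. decides q k Q (\<lambda>x \<rho>. R x (\<lambda>i. \<rho> (\<tau> i))))"
    using assms unfolding computable_rel_def computable_at_def by blast
  show ?thesis unfolding computable_rel_def computable_at_def
  proof (intro exI[of _ n] conjI allI impI)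
    show "local n (\<lambda>x \<rho>. \<not> R x \<rho>)" unfolding local_def
      by (intro allI impI arg_cong[where f = Not] localD[OF n(1)]) simp_all
    fix \<tau> :: "nat \<Rightarrow> nat" and k q :: nat assume "\<forall>i<n. \<tau> i < k"
    then obtain Q where Q: "decides q k Q (\<lambda>x \<rho>. R x (\<lambda>i. \<rho> (\<tau> i)))" using n(2) by blast
    define e where "e = q + length Q"
    let ?E = "Suc (Suc (Suc (Suc (Suc e))))"
    let ?Q = "Q @ [Zero (Suc k), Jump k (Suc k) (Suc (Suc (Suc (Suc e)))), Zero k, Jump k k ?E, Succ k]"
    have "decides q k ?Q (\<lambda>x \<rho>. \<not> R x (\<lambda>i. \<rho> (\<tau> i)))"
      unfolding decides_def
    proof (intro allI impI)
      fix P x \<rho> assume "code_at P q ?Q"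
      then have c: "code_at P q Q" "ins P e (Zero (Suc k))"
        "ins P (Suc e) (Jump k (Suc k) (Suc (Suc (Suc (Suc e)))))" "ins P (Suc (Suc e)) (Zero k)"
        "ins P (Suc (Suc (Suc e))) (Jump k k ?E)" "ins P (Suc (Suc (Suc (Suc e)))) (Succ k)"
        by (simp_all add: e_def)
      let ?I = "confined q ?E k \<rho>"
      let ?b = "R x (\<lambda>i. \<rho> (\<tau> i))"
      let ?F = "\<lambda>(l, \<sigma>). l = ?E \<and> (\<forall>i<k. \<sigma> i = \<rho> i) \<and> \<sigma> k = truth (\<not> ?b)"
      have "seg P x ?I (q, \<rho>) (\<lambda>(l, \<sigma>). l = e \<and> (\<forall>i<k. \<sigma> i = \<rho> i) \<and> \<sigma> k = truth ?b)"
        by (rule seg_mono[OF Q[unfolded decides_def, rule_format, OF c(1)]])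
          (auto simp: confined_def e_def)
      then have "seg P x ?I (q, \<rho>) ?F"
      proof (rule seg_segr_trans, clarify)
        fix l \<sigma> assume \<sigma>: "\<forall>i<k. \<sigma> i = \<rho> i" "\<sigma> k = truth ?b"
        have qe: "q \<le> e" by (simp add: e_def)
        show "segr P x ?I (e, \<sigma>) ?F"
          apply (rule segr_ins[OF c(2)], use \<sigma> qe in \<open>simp add: confined_def\<close>, simp)
          apply (rule segr_ins[OF c(3)], use \<sigma> qe in \<open>simp add: confined_def\<close>)
          apply (cases ?b)
          subgoal using \<sigma> qe
            by (simp, intro segr_ins[OF c(4)], simp add: confined_def,
              simp, intro segr_ins[OF c(5)] segr_here) (simp_all add: confined_def)
          subgoal using \<sigma> qe
            by (simp, intro segr_ins[OF c(6)] segr_here) (simp_all add: confined_def)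
          done
      qed
      then show "seg P x (confined q (q + length ?Q) k \<rho>) (q, \<rho>)
         (\<lambda>(l, \<sigma>). l = q + length ?Q \<and> (\<forall>i<k. \<sigma> i = \<rho> i) \<and> \<sigma> k = truth (\<not> ?b))"
        by (simp add: e_def)
    qed
    then show "\<exists>Q. decides q k Q (\<lambda>x \<rho>. \<not> R x (\<lambda>i. \<rho> (\<tau> i)))" by blast
  qed
qed

lemma computable_and:
  assumes "computable_rel R" "computable_rel S" shows "computable_rel (\<lambda>x \<rho>. R x \<rho> \<and> S x \<rho>)"
proof -
  obtain n1 n2 where "computable_at n1 R" "computable_at n2 S"
    using assms computable_rel_def by blast
  then obtain n where n: "computable_at n R" "computable_at n S"
    using computable_at_mono[of n1 R "max n1 n2"] computable_at_mono[of n2 S "max n1 n2"] by auto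
  show ?thesis unfolding computable_rel_def computable_at_def
  proof (intro exI[of _ n] conjI allI impI)
    have loc: "local n R" "local n S" using n unfolding computable_at_def by blast+
    show "local n (\<lambda>x \<rho>. R x \<rho> \<and> S x \<rho>)" unfolding local_def
      by (intro allI impI arg_cong2[where f = "(\<and>)"] localD[OF loc(1)] localD[OF loc(2)]) simp_all
    fix \<tau> :: "nat \<Rightarrow> nat" and k q :: nat assume t: "\<forall>i<n. \<tau> i < k"
    then obtain Q where Q: "decides q k Q (\<lambda>x \<rho>. R x (\<lambda>i. \<rho> (\<tau> i)))"
      using n(1) unfolding computable_at_def by blast
    define e where "e = q + length Q"
    \<comment> \<open>The second fragment counts register \<open>k\<close>, which holds the first
      answer, among those it must keep.\<close>
    have "\<forall>i<n. \<tau> i < Suc k" using t by auto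
    then obtain Q2 where Q2: "decides e (Suc k) Q2 (\<lambda>x \<rho>. S x (\<lambda>i. \<rho> (\<tau> i)))"
      using n(2) unfolding computable_at_def by blast
    define f where "f = e + length Q2"
    let ?E = "Suc (Suc (Suc f))"
    let ?Q = "Q @ Q2 @ [Zero (Suc (Suc k)), Jump k (Suc (Suc k)) ?E, Copy (Suc k) k]"
    have "decides q k ?Q (\<lambda>x \<rho>. R x (\<lambda>i. \<rho> (\<tau> i)) \<and> S x (\<lambda>i. \<rho> (\<tau> i)))"
      unfolding decides_def
    proof (intro allI impI)
      fix P x \<rho> assume "code_at P q ?Q"
      then have c: "code_at P q Q" "code_at P e Q2" "ins P f (Zero (Suc (Suc k)))"
        "ins P (Suc f) (Jump k (Suc (Suc k)) ?E)" "ins P (Suc (Suc f)) (Copy (Suc k) k)"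
        by (simp_all add: e_def f_def)
      have qe: "q \<le> e" "e \<le> f" by (simp_all add: e_def f_def)
      let ?I = "confined q ?E k \<rho>"
      let ?b = "R x (\<lambda>i. \<rho> (\<tau> i))" and ?d = "S x (\<lambda>i. \<rho> (\<tau> i))"
      let ?F = "\<lambda>(l, \<sigma>). l = ?E \<and> (\<forall>i<k. \<sigma> i = \<rho> i) \<and> \<sigma> k = truth (?b \<and> ?d)"
      have "seg P x ?I (q, \<rho>) (\<lambda>(l, \<sigma>). l = e \<and> (\<forall>i<k. \<sigma> i = \<rho> i) \<and> \<sigma> k = truth ?b)"
        by (rule seg_mono[OF Q[unfolded decides_def, rule_format, OF c(1)]])
          (use qe in \<open>auto simp: confined_def e_def[symmetric]\<close>)
      then have "seg P x ?I (q, \<rho>) ?F"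
      proof (rule seg_segr_trans, clarify)
        fix l \<sigma> assume \<sigma>: "\<forall>i<k. \<sigma> i = \<rho> i" "\<sigma> k = truth ?b"
        have S: "S x (\<lambda>i. \<sigma> (\<tau> i)) = ?d" by (rule localD[OF loc(2)]) (use \<sigma>(1) t in blast)
        have "seg P x ?I (e, \<sigma>) (\<lambda>(l, \<sigma>'). l = f \<and> (\<forall>i<k. \<sigma>' i = \<rho> i) \<and> \<sigma>' k = truth ?b \<and> \<sigma>' (Suc k) = truth ?d)"
          by (rule seg_mono[OF Q2[unfolded decides_def, rule_format, OF c(2)]])
            (use qe \<sigma> S in \<open>auto simp: confined_def f_def[symmetric]\<close>)
        then show "segr P x ?I (e, \<sigma>) ?F"
        proof (rule segr_trans[OF seg_segr], clarify)
          fix l \<sigma> assume \<sigma>: "\<forall>i<k. \<sigma> i = \<rho> i" "\<sigma> k = truth ?b" "\<sigma> (Suc k) = truth ?d"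
          show "segr P x ?I (f, \<sigma>) ?F"
            apply (rule segr_ins[OF c(3)], use \<sigma> qe in \<open>simp add: confined_def\<close>, simp)
            apply (rule segr_ins[OF c(4)], use \<sigma> qe in \<open>simp add: confined_def\<close>)
            apply (cases ?b)
            subgoal using \<sigma> qe by (simp, intro segr_ins[OF c(5)] segr_here) (simp_all add: confined_def)
            subgoal using \<sigma> qe by (intro segr_here) simp
            done
        qed
      qed
      then show "seg P x (confined q (q + length ?Q) k \<rho>) (q, \<rho>)
         (\<lambda>(l, \<sigma>). l = q + length ?Q \<and> (\<forall>i<k. \<sigma> i = \<rho> i) \<and> \<sigma> k = truth (?b \<and> ?d))"
        by (simp add: e_def f_def add.assoc)
    qed
    then show "\<exists>Q. decides q k Q (\<lambda>x \<rho>. R x (\<lambda>i. \<rho> (\<tau> i)) \<and> S x (\<lambda>i. \<rho> (\<tau> i)))" by blast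
  qed
qed

lemma fragment:
  assumes "computable_at n R" "\<forall>i<n. \<tau> i < k"
  obtains Q where "\<And>P x \<rho>. code_at P q Q \<Longrightarrow> seg P x (confined q (q + length Q) k \<rho>) (q, \<rho>)
     (\<lambda>(l, \<sigma>). l = q + length Q \<and> (\<forall>i<k. \<sigma> i = \<rho> i) \<and> \<sigma> k = truth (R x (\<lambda>i. \<rho> (\<tau> i))))"
proof -
  obtain Q where "decides q k Q (\<lambda>x \<rho>. R x (\<lambda>i. \<rho> (\<tau> i)))"
    using assms unfolding computable_at_def by blast
  then show thesis unfolding decides_def by (intro that[of Q]) simp
qed

text \<open>Search through \<open>n = 0, 1, ...\<close> with the candidate in \<open>K2\<close> and
  \<open>n + 1\<close> in \<open>K1\<close>. A fruitless search makes \<open>K1\<close> overflow,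
  and the test at line \<open>L\<close> detects the reset; the candidate cannot be the signal itself
  because 0 is a legitimate candidate. The answer register \<open>k\<close> is 0 during the search
  and doubles as the constant 0.\<close>

lemma computable_ex:
  assumes "computable_rel (\<lambda>x \<rho>. \<phi> x (\<lambda>i. \<rho> (Suc i)) (\<rho> 0))"
  shows "computable_rel (\<lambda>x \<rho>. \<exists>n. \<phi> x \<rho> n)"
proof -
  define R :: orel where "R = (\<lambda>x \<rho>. \<phi> x (\<lambda>i. \<rho> (Suc i)) (\<rho> 0))"
  obtain n0 where n0: "computable_at n0 R" using assms computable_rel_def R_def by auto
  have loc: "local n0 R" using n0 by (simp add: computable_at_def)
  have R: "R x (case_nat m \<rho>) = \<phi> x \<rho> m" for x m \<rho> by (simp add: R_def)
  have loc': "\<phi> x \<rho> m = \<phi> x \<rho>' m" if "\<forall>i<n0. \<rho> i = \<rho>' i" for x \<rho> \<rho>' m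
    unfolding R[symmetric] by (rule localD[OF loc]) (use that in \<open>auto split: nat.split\<close>)
  show ?thesis unfolding computable_rel_def computable_at_def
  proof (intro exI[of _ n0] conjI allI impI)
    show "local n0 (\<lambda>x \<rho>. \<exists>n. \<phi> x \<rho> n)"
      unfolding local_def by (intro allI impI arg_cong[where f = Ex] ext loc') simp
    fix \<tau> :: "nat \<Rightarrow> nat" and k q :: nat assume t: "\<forall>i<n0. \<tau> i < k"
    define K1 K2 K3 where K: "K1 = Suc k" "K2 = Suc (Suc k)" "K3 = Suc (Suc (Suc k))"
    have [simp]: "K1 \<noteq> K2" "K2 \<noteq> K1" "k \<noteq> K1" "k \<noteq> K2" "K1 \<noteq> k" "K2 \<noteq> k" by (simp_all add: K)
    define L where "L = Suc (Suc (Suc (Suc q)))"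
    have "\<forall>i<n0. case_nat K2 \<tau> i < K3" 
    proof (intro allI impI)
      fix i assume "i < n0"
      then show "case_nat K2 \<tau> i < K3" using t[rule_format, of "i - 1"] by (cases i) (auto simp: K)
    qed
    then obtain Qs where Qs: "\<And>P x \<rho>. code_at P (Suc L) Qs \<Longrightarrow>
       seg P x (confined (Suc L) (Suc L + length Qs) K3 \<rho>) (Suc L, \<rho>)
       (\<lambda>(l, \<sigma>). l = Suc L + length Qs \<and> (\<forall>i<K3. \<sigma> i = \<rho> i) \<and>
          \<sigma> K3 = truth (R x (\<lambda>i. \<rho> (case_nat K2 \<tau> i))))"
      using fragment[OF n0, of "case_nat K2 \<tau>" K3 "Suc L"] by blast
    define e where "e = Suc L + length Qs"
    define E where "E = Suc (Suc (Suc (Suc (Suc (Suc e)))))"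
    let ?Q = "[Zero k, Zero K2, Zero K1, Succ K1, Jump K1 k E] @ Qs @
      [Jump K3 k (Suc (Suc (Suc e))), Succ k, Jump k k E, Succ K1, Succ K2, Jump k k L]"
    have len: "q + length ?Q = E" by (simp add: E_def e_def L_def)
    have "decides q k ?Q (\<lambda>x \<rho>. \<exists>n. \<phi> x (\<lambda>i. \<rho> (\<tau> i)) n)"
      unfolding decides_def len
    proof (intro allI impI)
      fix P x \<rho> assume "code_at P q ?Q"
      then have c: "ins P q (Zero k)" "ins P (Suc q) (Zero K2)" "ins P (Suc (Suc q)) (Zero K1)"
          "ins P (Suc (Suc (Suc q))) (Succ K1)" "ins P L (Jump K1 k E)" "code_at P (Suc L) Qs"
        and d: "ins P e (Jump K3 k (Suc (Suc (Suc e))))" "ins P (Suc e) (Succ k)"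
          "ins P (Suc (Suc e)) (Jump k k E)" "ins P (Suc (Suc (Suc e))) (Succ K1)"
          "ins P (Suc (Suc (Suc (Suc e)))) (Succ K2)" "ins P (Suc (Suc (Suc (Suc (Suc e))))) (Jump k k L)"
        by (simp_all add: e_def L_def)
      have ql: "q < L" "L < e" by (simp_all add: e_def L_def)
      define b where "b n = \<phi> x (\<lambda>i. \<rho> (\<tau> i)) n" for n
      define St where "St n = (\<lambda>(l, \<sigma>). l = L \<and> (\<forall>i<k. \<sigma> i = \<rho> i) \<and> \<sigma> k = 0 \<and> \<sigma> K1 = Suc n \<and> \<sigma> K2 = n)" for n
      \<comment> \<open>The growing lower bound on \<open>K1\<close> is what yields its overflow in
        the limit.\<close>
      define J where "J n = (\<lambda>(l, \<sigma>). L \<le> l \<and> l < E \<and> (\<forall>i<k. \<sigma> i = \<rho> i) \<and> \<sigma> k = 0 \<and> Suc n \<le> \<sigma> K1)" for n :: nat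
      define I where "I = confined q E k \<rho>"
      define F where "F v = (\<lambda>(l, \<sigma>). l = E \<and> (\<forall>i<k. \<sigma> i = \<rho> i) \<and> \<sigma> k = truth v)" for v
      have JI: "I c" if "J n c" for n c using that ql by (auto simp: J_def I_def confined_def)
      have bodyQ: "seg P x (J n) c (\<lambda>(l, \<sigma>). l = e \<and> (\<forall>i<k. \<sigma> i = \<rho> i) \<and> \<sigma> k = 0 \<and> \<sigma> K1 = Suc n \<and>
         \<sigma> K2 = n \<and> \<sigma> K3 = truth (b n))" if at: "St n c" for n c
      proof -
        obtain \<sigma> where \<sigma>: "c = (L, \<sigma>)" "\<forall>i<k. \<sigma> i = \<rho> i" "\<sigma> k = 0" "\<sigma> K1 = Suc n" "\<sigma> K2 = n"
          using at by (cases c) (auto simp: St_def)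
        have bn: "R x (\<lambda>i. \<sigma> (case_nat K2 \<tau> i)) = b n"
          unfolding b_def R[symmetric]
          by (rule localD[OF loc]) (use \<sigma> t in \<open>auto split: nat.split\<close>)
        show ?thesis unfolding \<sigma>(1)
          apply (rule seg_ins[OF c(5)], use \<sigma> ql in \<open>simp add: J_def E_def\<close>)
          apply (simp add: \<sigma>)
          apply (rule seg_segr, rule seg_mono[OF Qs[OF c(6)]])
          subgoal using \<sigma> ql by (auto simp: confined_def J_def E_def K e_def)
          subgoal using \<sigma> unfolding bn by (auto simp: K e_def)
          done
      qed
      have no: "seg P x (J n) c (St (Suc n))" if n: "\<not> b n" "St n c" for n c
      proof (rule seg_segr_trans[OF bodyQ[OF n(2)]])
        fix d' :: config assume dd: "case d' of (l, \<sigma>) \<Rightarrow> l = e \<and> (\<forall>i<k. \<sigma> i = \<rho> i) \<and> \<sigma> k = 0 \<and>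
          \<sigma> K1 = Suc n \<and> \<sigma> K2 = n \<and> \<sigma> K3 = truth (b n)"
        obtain \<sigma> where \<sigma>: "d' = (e, \<sigma>)" "\<forall>i<k. \<sigma> i = \<rho> i" "\<sigma> k = 0" "\<sigma> K1 = Suc n" "\<sigma> K2 = n" "\<sigma> K3 = truth (b n)"
          using dd by (cases d') auto
        have k3: "\<sigma> K3 = 0" using n(1) \<sigma>(6) by simp
        show "segr P x (J n) d' (St (Suc n))" unfolding \<sigma>(1)
          apply (rule segr_ins[OF d(1)], use \<sigma> ql in \<open>simp add: J_def E_def\<close>, simp add: \<sigma>(3) k3)
          apply (rule segr_ins[OF d(4)], use \<sigma> ql in \<open>simp add: J_def E_def\<close>, simp)
          apply (rule segr_ins[OF d(5)], use \<sigma> ql in \<open>simp add: J_def E_def K\<close>, simp)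
          apply (rule segr_ins[OF d(6)], use \<sigma> ql in \<open>simp add: J_def E_def K\<close>, simp)
          apply (rule segr_here, use \<sigma> in \<open>simp add: St_def K\<close>)
          done
      qed
      have yes: "seg P x I c (F True)" if n: "b n" "St n c" for n c
      proof (rule seg_segr_trans[OF seg_mono[OF bodyQ[OF n(2)] JI]], assumption, assumption)
        fix d' :: config assume dd: "case d' of (l, \<sigma>) \<Rightarrow> l = e \<and> (\<forall>i<k. \<sigma> i = \<rho> i) \<and> \<sigma> k = 0 \<and>
          \<sigma> K1 = Suc n \<and> \<sigma> K2 = n \<and> \<sigma> K3 = truth (b n)"
        obtain \<sigma> where \<sigma>: "d' = (e, \<sigma>)" "\<forall>i<k. \<sigma> i = \<rho> i" "\<sigma> k = 0" "\<sigma> K1 = Suc n" "\<sigma> K2 = n" "\<sigma> K3 = truth (b n)"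
          using dd by (cases d') auto
        have s3: "\<sigma> K3 = Suc 0" using n(1) \<sigma>(6) by simp
        show "segr P x I d' (F True)" unfolding \<sigma>(1)
          apply (rule segr_ins[OF d(1)], use \<sigma>(2) ql in \<open>simp add: I_def confined_def E_def\<close>, simp add: \<sigma>(3) s3)
          apply (rule segr_ins[OF d(2)], use \<sigma>(2) ql in \<open>simp add: I_def confined_def E_def\<close>, simp)
          apply (rule segr_ins[OF d(3)], use \<sigma>(2) ql in \<open>simp add: I_def confined_def E_def\<close>, simp)
          apply (rule segr_here, use \<sigma>(2,3) in \<open>simp add: F_def\<close>)
          done
      qed
      have St0: "St 0 (L, \<rho>(k := 0, K2 := 0, K1 := Suc 0))" by (simp add: St_def K)
      have all: "segr P x I (L, \<rho>(k := 0, K2 := 0, K1 := Suc 0)) (F (\<exists>n. b n))"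
      proof (cases "\<exists>n. b n")
        case True
        define m where "m = (LEAST n. b n)"
        have m: "b m" "\<And>n. n < m \<Longrightarrow> \<not> b n" using True by (auto simp: m_def intro: LeastI_ex dest: not_less_Least)
        have "j \<le> m \<Longrightarrow> segr P x I (L, \<rho>(k := 0, K2 := 0, K1 := Suc 0)) (St j)" for j
        proof (induction j)
          case 0 then show ?case using St0 by (intro segr_here)
        next
          case (Suc j)
          show ?case
          proof (rule segr_trans)
            show "segr P x I (L, \<rho>(k := 0, K2 := 0, K1 := Suc 0)) (St j)"
              by (rule Suc.IH) (use Suc.prems in simp)
            fix d assume "St j d"
            then have "seg P x (J j) d (St (Suc j))" using no m(2)[of j] Suc.prems by simp
            then show "segr P x I d (St (Suc j))" by (intro seg_segr) (erule seg_mono, erule JI)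
          qed
        qed
        from segr_trans[OF this[OF order_refl] seg_segr[OF yes[OF m(1)]]]
        have "segr P x I (L, \<rho>(k := 0, K2 := 0, K1 := Suc 0)) (F True)" by simp
        then show ?thesis using True by simp
      next
        case False
        have "seg P x I (L, \<rho>(k := 0, K2 := 0, K1 := Suc 0)) (\<lambda>(l, \<sigma>). l = L \<and> (\<forall>i<k. \<sigma> i = \<rho> i) \<and> \<sigma> k = 0 \<and> \<sigma> K1 = 0)"
        proof (rule seg_mono[OF seg_limit_regs[of St P x J, OF no St0]])
          show "\<not> b n" for n using False by blast
          show "I e" if "\<exists>n. J n e" for e using that JI by blast
          fix c :: config
          obtain l \<sigma> where c: "c = (l, \<sigma>)" by (cases c)
          assume lim: "case c of (l, \<sigma>) \<Rightarrow>
            (\<forall>v. (\<forall>n e. J n e \<longrightarrow> v \<le> fst e) \<longrightarrow> (\<forall>n c. St n c \<longrightarrow> fst c = v) \<longrightarrow> l = v) \<and>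
            (\<forall>i v. (\<forall>n e. J n e \<longrightarrow> v \<le> snd e i) \<longrightarrow> (\<forall>n c. St n c \<longrightarrow> snd c i = v) \<longrightarrow> \<sigma> i = v) \<and>
            (\<forall>i. (\<forall>M. \<exists>N. \<forall>n\<ge>N. \<forall>e. J n e \<longrightarrow> snd e i = 0 \<or> M \<le> snd e i) \<longrightarrow> \<sigma> i = 0)"
          have "l = L" using lim[unfolded c prod.case, THEN conjunct1, rule_format, of L]
            by (auto simp: J_def St_def)
          moreover have "\<sigma> i = \<rho> i" if "i < k" for i
            using lim[unfolded c prod.case, THEN conjunct2, THEN conjunct1, rule_format, of "\<rho> i" i] that
            by (auto simp: J_def St_def)
          moreover have "\<sigma> k = 0"
            using lim[unfolded c prod.case, THEN conjunct2, THEN conjunct1, rule_format, of 0 k]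
            by (auto simp: J_def St_def)
          moreover have "\<exists>N. \<forall>n\<ge>N. \<forall>e. J n e \<longrightarrow> snd e K1 = 0 \<or> M \<le> snd e K1" for M
            by (rule exI[of _ M]) (auto simp: J_def)
          then have "\<sigma> K1 = 0"
            by (intro lim[unfolded c prod.case, THEN conjunct2, THEN conjunct2, THEN spec, THEN mp] allI)
          ultimately show "case c of (l, \<sigma>) \<Rightarrow> l = L \<and> (\<forall>i<k. \<sigma> i = \<rho> i) \<and> \<sigma> k = 0 \<and> \<sigma> K1 = 0"
            by (simp add: c)
        qed
        then show ?thesis
        proof (rule segr_trans[OF seg_segr], clarify)
          fix \<sigma> assume \<sigma>: "\<forall>i<k. \<sigma> i = \<rho> i" "\<sigma> k = 0" "\<sigma> K1 = 0"
          show "segr P x I (L, \<sigma>) (F (\<exists>n. b n))"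
            apply (rule segr_ins[OF c(5)], use \<sigma> ql in \<open>simp add: I_def confined_def E_def\<close>, simp add: \<sigma>)
            apply (rule segr_here, use \<sigma> False in \<open>simp add: F_def\<close>)
            done
        qed
      qed
      have "seg P x I (q, \<rho>) (F (\<exists>n. b n))"
        apply (rule seg_ins[OF c(1)], use ql in \<open>simp add: I_def confined_def E_def\<close>, simp)
        apply (rule segr_ins[OF c(2)], use ql in \<open>simp add: I_def confined_def E_def K L_def\<close>, simp)
        apply (rule segr_ins[OF c(3)], use ql in \<open>simp add: I_def confined_def E_def K L_def\<close>, simp)
        apply (rule segr_ins[OF c(4)], use ql in \<open>simp add: I_def confined_def E_def K L_def\<close>)
        using all by (simp add: L_def)
      then show "seg P x (confined q E k \<rho>) (q, \<rho>) (\<lambda>(l, \<sigma>). l = E \<and> (\<forall>i<k. \<sigma> i = \<rho> i) \<and>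
          \<sigma> k = truth (\<exists>n. \<phi> x (\<lambda>i. \<rho> (\<tau> i)) n))"
        by (simp add: I_def F_def b_def)
    qed
    then show "\<exists>Q. decides q k Q (\<lambda>x \<rho>. \<exists>n. \<phi> x (\<lambda>i. \<rho> (\<tau> i)) n)" by blast
  qed
qed

text \<open>Only the graph of \<open>g\<close> is decidable, so each value of the recursion is found
  by search: \<open>V\<close> runs upwards until it equals \<open>g\<close> of \<open>I\<close> and
  \<open>A\<close>. As \<open>g\<close> is total, each search stops, and the loop itself passes
  through no limit.\<close>

lemma computable_rec:
  assumes "computable_rel (\<lambda>x \<rho>. \<rho> (Suc (Suc 0)) = g (\<rho> 0) (\<rho> (Suc 0)))"
  shows "computable_rel (\<lambda>x \<rho>. \<rho> h = rec_nat (\<rho> i) g (\<rho> j))"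
proof -
  define R :: orel where "R = (\<lambda>x \<rho>. \<rho> (Suc (Suc 0)) = g (\<rho> 0) (\<rho> (Suc 0)))"
  obtain n0 where n0: "computable_at n0 R" using assms computable_rel_def R_def by auto
  let ?n = "Suc (max h (max i j))"
  show ?thesis unfolding computable_rel_def computable_at_def
  proof (intro exI[of _ ?n] conjI allI impI)
    show "local ?n (\<lambda>x \<rho>. \<rho> h = rec_nat (\<rho> i) g (\<rho> j))"
      by (auto simp: local_def less_Suc_eq_le)
    fix \<tau> :: "nat \<Rightarrow> nat" and k q :: nat assume "\<forall>i<?n. \<tau> i < k"
    then have t: "\<tau> h < k" "\<tau> i < k" "\<tau> j < k" by auto
    define A I V K4 where K: "A = Suc k" "I = Suc (Suc k)" "V = Suc (Suc (Suc k))"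
      "K4 = Suc (Suc (Suc (Suc k)))"
    have [simp]: "A \<noteq> I" "I \<noteq> A" "A \<noteq> V" "V \<noteq> A" "I \<noteq> V" "V \<noteq> I" "k \<noteq> A" "k \<noteq> I" "k \<noteq> V" "A \<noteq> k" "I \<noteq> k" "V \<noteq> k"
      by (simp_all add: K)
    define L where "L = Suc (Suc (Suc q))"
    define S where "S = Suc (Suc L)"
    let ?t = "case_nat I (case_nat A (\<lambda>_. V))"
    have "\<forall>i<n0. ?t i < K4" by (auto simp: K split: nat.split)
    then obtain Qs where Qs: "\<And>P x \<rho>. code_at P S Qs \<Longrightarrow>
       seg P x (confined S (S + length Qs) K4 \<rho>) (S, \<rho>)
       (\<lambda>(l, \<sigma>). l = S + length Qs \<and> (\<forall>i<K4. \<sigma> i = \<rho> i) \<and>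
          \<sigma> K4 = truth (R x (\<lambda>i. \<rho> (?t i))))"
      using fragment[OF n0, of ?t K4 S] by blast
    define e where "e = S + length Qs"
    define X where "X = Suc (Suc (Suc (Suc (Suc (Suc e)))))"
    define E where "E = Suc (Suc (Suc X))"
    let ?Q = "[Zero k, Copy (\<tau> i) A, Zero I, Jump I (\<tau> j) X, Zero V] @ Qs @
      [Jump K4 k (Suc (Suc (Suc (Suc e)))), Copy V A, Succ I, Jump k k L, Succ V, Jump k k S,
       Jump A (\<tau> h) (Suc (Suc X)), Jump k k E, Succ k]"
    have len: "q + length ?Q = E" by (simp add: E_def X_def e_def S_def L_def)
    have "decides q k ?Q (\<lambda>x \<rho>. \<rho> (\<tau> h) = rec_nat (\<rho> (\<tau> i)) g (\<rho> (\<tau> j)))"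
      unfolding decides_def len
    proof (intro allI impI)
      fix P x \<rho> assume "code_at P q ?Q"
      then have c: "ins P q (Zero k)" "ins P (Suc q) (Copy (\<tau> i) A)" "ins P (Suc (Suc q)) (Zero I)"
          "ins P L (Jump I (\<tau> j) X)" "ins P (Suc L) (Zero V)" "code_at P S Qs"
        and d: "ins P e (Jump K4 k (Suc (Suc (Suc (Suc e)))))" "ins P (Suc e) (Copy V A)"
          "ins P (Suc (Suc e)) (Succ I)" "ins P (Suc (Suc (Suc e))) (Jump k k L)"
          "ins P (Suc (Suc (Suc (Suc e)))) (Succ V)" "ins P (Suc (Suc (Suc (Suc (Suc e))))) (Jump k k S)"
          "ins P X (Jump A (\<tau> h) (Suc (Suc X)))" "ins P (Suc X) (Jump k k E)" "ins P (Suc (Suc X)) (Succ k)"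
        by (simp_all add: e_def L_def S_def X_def)
      have ql: "q < L" "L < S" "Suc L < S \<or> Suc L < e" "S \<le> e" "e < X" "X < E"
        "Suc L < E" "Suc q < L" "Suc (Suc q) < L" "Suc L < X"
        by (simp_all add: e_def L_def S_def X_def E_def)
      define r where "r n = rec_nat (\<rho> (\<tau> i)) g n" for n
      have rS: "r (Suc n) = g n (r n)" for n by (simp add: r_def)
      define J where "J = confined q E k \<rho>"
      have Jc: "J (l, \<sigma>) \<longleftrightarrow> q \<le> l \<and> l < E \<and> (\<forall>i<k. \<sigma> i = \<rho> i)" for l \<sigma>
        by (simp add: J_def confined_def)
      define At where "At n = (\<lambda>(l, \<sigma>). l = L \<and> (\<forall>i<k. \<sigma> i = \<rho> i) \<and> \<sigma> k = 0 \<and> \<sigma> A = r n \<and> \<sigma> I = n)" for n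
      define Sr where "Sr n v = (\<lambda>(l, \<sigma>). l = S \<and> (\<forall>i<k. \<sigma> i = \<rho> i) \<and> \<sigma> k = 0 \<and> \<sigma> A = r n \<and> \<sigma> I = n \<and> \<sigma> V = v)" for n v
      define F where "F v = (\<lambda>(l, \<sigma>). l = E \<and> (\<forall>i<k. \<sigma> i = \<rho> i) \<and> \<sigma> k = truth v)" for v
      have body: "seg P x J c (\<lambda>(l, \<sigma>). l = e \<and> (\<forall>i<k. \<sigma> i = \<rho> i) \<and> \<sigma> k = 0 \<and> \<sigma> A = r n \<and>
         \<sigma> I = n \<and> \<sigma> V = v \<and> \<sigma> K4 = truth (v = r (Suc n)))" if at: "Sr n v c" for n v c
      proof -
        obtain \<sigma> where \<sigma>: "c = (S, \<sigma>)" "\<forall>i<k. \<sigma> i = \<rho> i" "\<sigma> k = 0" "\<sigma> A = r n" "\<sigma> I = n" "\<sigma> V = v"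
          using at by (cases c) (auto simp: Sr_def)
        have Rn: "R x (\<lambda>i. \<sigma> (?t i)) = (v = r (Suc n))" by (simp add: R_def \<sigma> rS)
        show ?thesis unfolding \<sigma>(1)
          by (rule seg_mono[OF Qs[OF c(6)]])
            (use \<sigma> ql in \<open>auto simp: confined_def Jc K e_def[symmetric] Rn\<close>)
      qed
      have search: "segr P x J c (At (Suc n))" if "Sr n v c" "v \<le> r (Suc n)" for n v c
        using that
      proof (induction "r (Suc n) - v" arbitrary: v c)
        case 0
        then have v: "v = r (Suc n)" by simp
        show ?case
        proof (rule segr_trans[OF seg_segr[OF body[OF 0(2)]]], clarify)
          fix \<sigma> assume \<sigma>: "\<forall>i<k. \<sigma> i = \<rho> i" "\<sigma> k = 0" "\<sigma> A = r (\<sigma> I)" "n = \<sigma> I" "v = \<sigma> V" "\<sigma> K4 = truth (\<sigma> V = r (Suc (\<sigma> I)))"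
          have k4: "\<sigma> K4 = Suc 0" using \<sigma> v by simp
          show "segr P x J (e, \<sigma>) (At (Suc (\<sigma> I)))"
            apply (rule segr_ins[OF d(1)], use \<sigma> ql in \<open>simp add: Jc\<close>, simp add: \<sigma>(2) k4)
            apply (rule segr_ins[OF d(2)], use \<sigma> ql in \<open>simp add: Jc X_def\<close>, simp add: \<sigma>(2))
            apply (rule segr_ins[OF d(3)], use \<sigma> ql in \<open>simp add: Jc X_def K\<close>, simp add: \<sigma>(2))
            apply (rule segr_ins[OF d(4)], use \<sigma> ql in \<open>simp add: Jc X_def K\<close>, simp add: \<sigma>(2))
            apply (rule segr_here, use \<sigma> v in \<open>simp add: At_def K\<close>)
            done
        qed
      next
        case (Suc m)
        then have v: "v \<noteq> r (Suc n)" by simp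
        show ?case
        proof (rule segr_trans[OF seg_segr[OF body[OF Suc(3)]]], clarify)
          fix \<sigma> assume \<sigma>: "\<forall>i<k. \<sigma> i = \<rho> i" "\<sigma> k = 0" "\<sigma> A = r (\<sigma> I)" "n = \<sigma> I" "v = \<sigma> V" "\<sigma> K4 = truth (\<sigma> V = r (Suc (\<sigma> I)))"
          have k4: "\<sigma> K4 = 0" using \<sigma> v by simp
          have nxt: "segr P x J (S, \<sigma>(V := Suc (\<sigma> V))) (At (Suc n))"
            by (rule Suc.hyps(1)[of "Suc v"]) (use Suc.hyps(2) Suc.prems \<sigma> v in \<open>auto simp: Sr_def K\<close>)
          show "segr P x J (e, \<sigma>) (At (Suc (\<sigma> I)))"
            apply (rule segr_ins[OF d(1)], use \<sigma> ql in \<open>simp add: Jc\<close>, simp add: \<sigma>(2) k4)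
            apply (rule segr_ins[OF d(5)], use \<sigma> ql in \<open>simp add: Jc X_def\<close>, simp add: \<sigma>(2))
            apply (rule segr_ins[OF d(6)], use \<sigma> ql in \<open>simp add: Jc X_def K\<close>)
            using nxt \<sigma>(4) by simp
        qed
      qed
      have loop: "segr P x J c (At (n + m))" if "At n c" "n + m \<le> \<rho> (\<tau> j)" for n m c
        using that
      proof (induction m)
        case 0 then show ?case by (simp add: segr_here)
      next
        case (Suc m)
        have "segr P x J c (At (n + m))" using Suc by simp
        then show ?case
        proof (rule segr_trans)
          fix d assume "At (n + m) d"
          then obtain \<sigma> where \<sigma>: "d = (L, \<sigma>)" "\<forall>i<k. \<sigma> i = \<rho> i" "\<sigma> k = 0" "\<sigma> A = r (n + m)" "\<sigma> I = n + m"
            by (cases d) (auto simp: At_def)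
          have ne: "\<sigma> I \<noteq> \<sigma> (\<tau> j)" using \<sigma> Suc.prems t by simp
          show "segr P x J d (At (n + Suc m))" unfolding \<sigma>(1)
            apply (rule segr_ins[OF c(4)], use \<sigma> ql in \<open>simp add: Jc\<close>, simp add: ne)
            apply (rule segr_ins[OF c(5)], use \<sigma> ql in \<open>simp add: Jc\<close>, simp add: S_def[symmetric])
            using search[of "n + m" 0] \<sigma> by (simp add: Sr_def K)
        qed
      qed
      have "seg P x J (q, \<rho>) (F (\<rho> (\<tau> h) = r (\<rho> (\<tau> j))))"
        apply (rule seg_ins[OF c(1)], use ql in \<open>simp add: Jc\<close>, simp)
        apply (rule segr_ins[OF c(2)], use ql in \<open>simp add: Jc K\<close>, use t in simp)
        apply (rule segr_ins[OF c(3)], use ql in \<open>simp add: Jc K\<close>, simp add: L_def[symmetric])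
        apply (rule segr_trans[OF loop[of 0 _ "\<rho> (\<tau> j)"]])
        subgoal using t by (simp add: At_def K r_def)
        subgoal by simp
        subgoal for d
        proof -
          assume "At (0 + \<rho> (\<tau> j)) d"
          then obtain \<sigma> where \<sigma>: "d = (L, \<sigma>)" "\<forall>i<k. \<sigma> i = \<rho> i" "\<sigma> k = 0" "\<sigma> A = r (\<rho> (\<tau> j))" "\<sigma> I = \<rho> (\<tau> j)"
            by (cases d) (auto simp: At_def)
          have eq: "\<sigma> I = \<sigma> (\<tau> j)" using \<sigma> t by simp
          show ?thesis unfolding \<sigma>(1)
            apply (rule segr_ins[OF c(4)], use \<sigma> ql in \<open>simp add: Jc\<close>, simp add: eq)
            apply (rule segr_ins[OF d(7)], use \<sigma> ql in \<open>simp add: Jc\<close>)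
            apply (cases "\<sigma> A = \<sigma> (\<tau> h)")
            subgoal
              apply simp
              apply (rule segr_ins[OF d(9)], use \<sigma> ql in \<open>simp add: Jc E_def\<close>, simp)
              apply (rule segr_here, use \<sigma> t in \<open>simp add: F_def E_def\<close>)
              done
            subgoal
              apply simp
              apply (rule segr_ins[OF d(8)], use \<sigma> ql in \<open>simp add: Jc E_def\<close>, simp)
              apply (rule segr_here, use \<sigma> t in \<open>auto simp: F_def E_def\<close>)
              done
            done
        qed
        done
      then show "seg P x (confined q E k \<rho>) (q, \<rho>) (\<lambda>(l, \<sigma>). l = E \<and> (\<forall>i<k. \<sigma> i = \<rho> i) \<and>
          \<sigma> k = truth (\<rho> (\<tau> h) = rec_nat (\<rho> (\<tau> i)) g (\<rho> (\<tau> j))))"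
        by (simp add: J_def F_def r_def)
    qed
    then show "\<exists>Q. decides q k Q (\<lambda>x \<rho>. \<rho> (\<tau> h) = rec_nat (\<rho> (\<tau> i)) g (\<rho> (\<tau> j)))" by blast
  qed
qed

section \<open>Infinite paths\<close>

text \<open>Depth-first search for an infinite path starting at \<open>1\<close>: register \<open>A\<close> holds the current node
  and \<open>B\<close> the next candidate for a child. When all children of \<open>s\<close> have been treated, \<open>A\<close> has been \<open>s\<close>
  cofinally often and never smaller, while \<open>B\<close> overflows; so \<open>B = 0\<close> signals the end of the subtree of
  the node in \<open>A\<close>. On an infinite path \<open>A\<close> overflows as well.\<close>

lemma computable_path:
  assumes "computable_rel (\<lambda>x \<rho>. ed x (\<lambda>i. \<rho> (Suc (Suc i))) (\<rho> 0) (\<rho> (Suc 0)))"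
    and lt: "\<And>x \<rho> s t. ed x \<rho> s t \<Longrightarrow> s < t"
    and un: "\<And>x \<rho> s s' t. ed x \<rho> s t \<Longrightarrow> ed x \<rho> s' t \<Longrightarrow> s = s'"
  shows "computable_rel (\<lambda>x \<rho>. \<exists>f. f 0 = Suc 0 \<and> (\<forall>n. ed x \<rho> (f n) (f (Suc n))))"
proof -
  define R :: orel where "R = (\<lambda>x \<rho>. ed x (\<lambda>i. \<rho> (Suc (Suc i))) (\<rho> 0) (\<rho> (Suc 0)))"
  obtain n0 where n0: "computable_at n0 R" using assms(1) computable_rel_def R_def by auto
  have loc: "local n0 R" using n0 by (simp add: computable_at_def)
  have R: "R x (case_nat s (case_nat t \<rho>)) = ed x \<rho> s t" for x s t \<rho> by (simp add: R_def)
  have loc': "ed x \<rho> s t = ed x \<rho>' s t" if "\<forall>i<n0. \<rho> i = \<rho>' i" for x \<rho> \<rho>' s t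
    unfolding R[symmetric] by (rule localD[OF loc]) (use that in \<open>auto split: nat.split\<close>)
  show ?thesis unfolding computable_rel_def computable_at_def
  proof (intro exI[of _ n0] conjI allI impI)
    show "local n0 (\<lambda>x \<rho>. \<exists>f. f 0 = Suc 0 \<and> (\<forall>n. ed x \<rho> (f n) (f (Suc n))))"
      unfolding local_def
    proof (intro allI impI)
      fix x and \<rho> \<rho>' :: "nat \<Rightarrow> nat" assume "\<forall>i<n0. \<rho> i = \<rho>' i"
      then have "ed x \<rho> = ed x \<rho>'" by (intro ext loc')
      then show "(\<exists>f. f 0 = Suc 0 \<and> (\<forall>n. ed x \<rho> (f n) (f (Suc n)))) = (\<exists>f. f 0 = Suc 0 \<and> (\<forall>n. ed x \<rho>' (f n) (f (Suc n))))"
        by simp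
    qed
    fix \<tau> :: "nat \<Rightarrow> nat" and k q :: nat assume t: "\<forall>i<n0. \<tau> i < k"
    \<comment> \<open>\<open>D\<close> runs through candidates for the parent of the node in
      \<open>A\<close>, \<open>U\<close> holds the root, and \<open>K\<close> receives the answers
      of the two fragments. The root is 1, so that \<open>A = 0\<close> can arise only from an
      overflow.\<close>
    define A B D U K where K: "A = Suc k" "B = Suc (Suc k)" "D = Suc (Suc (Suc k))"
      "U = Suc (Suc (Suc (Suc k)))" "K = Suc (Suc (Suc (Suc (Suc k))))"
    have [simp]: "A \<noteq> B" "B \<noteq> A" "A \<noteq> D" "D \<noteq> A" "A \<noteq> U" "U \<noteq> A" "B \<noteq> D" "D \<noteq> B" "B \<noteq> U" "U \<noteq> B"
      "D \<noteq> U" "U \<noteq> D" "k \<noteq> A" "k \<noteq> B" "k \<noteq> D" "k \<noteq> U" "A \<noteq> k" "B \<noteq> k" "D \<noteq> k" "U \<noteq> k"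
      "A < K" "B < K" "D < K" "U < K" "k < K" "i < k \<Longrightarrow> i < K" "i < k \<Longrightarrow> i \<noteq> A" "i < k \<Longrightarrow> i \<noteq> B"
      "i < k \<Longrightarrow> i \<noteq> D" "i < k \<Longrightarrow> i \<noteq> U" for i
      by (auto simp: K)
    define L where "L = Suc (Suc (Suc (Suc (Suc (Suc q)))))"
    have tk: "case_nat a (case_nat b \<tau>) i < K" if "a < K" "b < K" "i < n0" for a b i
      using t[rule_format, of "i - 2"] that by (auto split: nat.split)
    obtain Q1 where Q1: "\<And>P x \<rho>. code_at P (Suc L) Q1 \<Longrightarrow>
       seg P x (confined (Suc L) (Suc L + length Q1) K \<rho>) (Suc L, \<rho>)
       (\<lambda>(l, \<sigma>). l = Suc L + length Q1 \<and> (\<forall>i<K. \<sigma> i = \<rho> i) \<and>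
          \<sigma> K = truth (R x (\<lambda>i. \<rho> (case_nat A (case_nat B \<tau>) i))))"
      using fragment[OF n0, of "case_nat A (case_nat B \<tau>)" K "Suc L"] tk[of A B] by auto
    define e where "e = Suc L + length Q1"
    define F where "F = Suc (Suc (Suc (Suc (Suc (Suc (Suc e))))))"
    obtain Q2 where Q2: "\<And>P x \<rho>. code_at P F Q2 \<Longrightarrow>
       seg P x (confined F (F + length Q2) K \<rho>) (F, \<rho>)
       (\<lambda>(l, \<sigma>). l = F + length Q2 \<and> (\<forall>i<K. \<sigma> i = \<rho> i) \<and>
          \<sigma> K = truth (R x (\<lambda>i. \<rho> (case_nat D (case_nat A \<tau>) i))))"
      using fragment[OF n0, of "case_nat D (case_nat A \<tau>)" K F] tk[of D A] by auto
    define g where "g = F + length Q2"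
    define Il where "Il = Suc (Suc (Suc (Suc (Suc (Suc (Suc g))))))"
    define H where "H = Suc Il"
    define X where "X = Suc (Suc (Suc (Suc e)))"
    define G where "G = Suc (Suc (Suc (Suc (Suc g))))"
    let ?Q = "[Zero k, Zero U, Succ U, Copy U A, Copy A B, Succ B, Jump B k X] @ Q1 @
      [Jump K k (Suc (Suc e)), Copy B A, Succ B, Jump k k L, Jump A k Il, Jump A U H, Zero D] @ Q2 @
      [Jump K k G, Copy A B, Succ B, Copy D A, Jump k k L, Succ D, Jump k k F, Succ k]"
    have len: "q + length ?Q = H" by (simp add: H_def Il_def g_def F_def e_def L_def)
    have "decides q k ?Q (\<lambda>x \<rho>. \<exists>f. f 0 = Suc 0 \<and> (\<forall>n. ed x (\<lambda>i. \<rho> (\<tau> i)) (f n) (f (Suc n))))"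
      unfolding decides_def len
    proof (intro allI impI)
      fix P x \<rho> assume "code_at P q ?Q"
      then have c: "ins P q (Zero k)" "ins P (Suc q) (Zero U)" "ins P (Suc (Suc q)) (Succ U)"
          "ins P (Suc (Suc (Suc q))) (Copy U A)" "ins P (Suc (Suc (Suc (Suc q)))) (Copy A B)"
          "ins P (Suc (Suc (Suc (Suc (Suc q))))) (Succ B)" "ins P L (Jump B k X)" "code_at P (Suc L) Q1"
        and d: "ins P e (Jump K k (Suc (Suc e)))" "ins P (Suc e) (Copy B A)" "ins P (Suc (Suc e)) (Succ B)"
          "ins P (Suc (Suc (Suc e))) (Jump k k L)" "ins P X (Jump A k Il)" "ins P (Suc X) (Jump A U H)"
          "ins P (Suc (Suc X)) (Zero D)" "code_at P F Q2"
        and h: "ins P g (Jump K k G)" "ins P (Suc g) (Copy A B)" "ins P (Suc (Suc g)) (Succ B)"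
          "ins P (Suc (Suc (Suc g))) (Copy D A)" "ins P (Suc (Suc (Suc (Suc g)))) (Jump k k L)"
          "ins P G (Succ D)" "ins P (Suc G) (Jump k k F)" "ins P Il (Succ k)"
        by (simp_all add: e_def L_def X_def F_def g_def G_def Il_def)
      have ql: "q < L" "L < e" "Suc (Suc (Suc e)) < X" "Suc (Suc X) < F" "F \<le> g" "Suc (Suc (Suc (Suc g))) < G"
        "Suc G < Il" "Il < H" "F = Suc (Suc (Suc X))" "Suc (Suc (Suc (Suc (Suc q)))) < L"
        by (simp_all add: e_def L_def X_def F_def g_def G_def Il_def H_def)
      define ee where "ee s t = ed x (\<lambda>i. \<rho> (\<tau> i)) s t" for s t
      have eelt: "s < t" if "ee s t" for s t using lt that by (simp add: ee_def)
      have eeun: "s = s'" if "ee s t" "ee s' t" for s s' t using un that by (simp add: ee_def)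
      define Bs where "Bs \<sigma> \<longleftrightarrow> (\<forall>i<k. \<sigma> i = \<rho> i) \<and> \<sigma> k = 0 \<and> \<sigma> U = Suc 0" for \<sigma> :: "nat \<Rightarrow> nat"
      have Bsu: "Bs (\<sigma>(A := v)) = Bs \<sigma>" "Bs (\<sigma>(B := v)) = Bs \<sigma>" "Bs (\<sigma>(D := v)) = Bs \<sigma>" for \<sigma> v
        by (auto simp: Bs_def)
      have Bs0: "\<sigma> k = 0" "\<sigma> U = Suc 0" if "Bs \<sigma>" for \<sigma> using that by (simp_all add: Bs_def)
      have Bsc: "Bs \<sigma>'" if "Bs \<sigma>" "\<forall>i<K. \<sigma>' i = \<sigma> i" for \<sigma> \<sigma>' using that by (simp add: Bs_def)
      \<comment> \<open>\<open>B = 0\<close> must be allowed, being the signal with which the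
        subtrees below \<open>s\<close> end. By the zero-or-large criterion it does not disturb the
        overflow of \<open>B\<close>.\<close>
      define J where "J s b = (\<lambda>(l, \<sigma>). L \<le> l \<and> l < Il \<and> Bs \<sigma> \<and> s \<le> \<sigma> A \<and> (\<sigma> B = 0 \<or> b \<le> \<sigma> B))" for s b :: nat
      have Jc: "J s b (l, \<sigma>) \<longleftrightarrow> L \<le> l \<and> l < Il \<and> Bs \<sigma> \<and> s \<le> \<sigma> A \<and> (\<sigma> B = 0 \<or> b \<le> \<sigma> B)" for s b l \<sigma>
        by (simp add: J_def)
      have Jmono: "J s' b' c \<Longrightarrow> s \<le> s' \<Longrightarrow> b \<le> b' \<Longrightarrow> J s b c" for s s' b b' c
        by (auto simp: J_def)
      define At where "At s b = (\<lambda>(l, \<sigma>). l = L \<and> Bs \<sigma> \<and> \<sigma> A = s \<and> \<sigma> B = b)" for s b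
      have Atc: "\<exists>\<sigma>. c = (L, \<sigma>) \<and> Bs \<sigma> \<and> \<sigma> A = s \<and> \<sigma> B = b" if "At s b c" for s b c
        using that by (cases c) (simp add: At_def)
      have eeR: "R x (\<lambda>i. \<sigma> (case_nat a (case_nat b \<tau>) i)) = ee (\<sigma> a) (\<sigma> b)" if "Bs \<sigma>" for \<sigma> a b
        unfolding ee_def R[symmetric]
        by (rule localD[OF loc]) (use that t in \<open>auto simp: Bs_def split: nat.split\<close>)
      have test: "seg P x (J s b) c (\<lambda>c'. \<exists>\<sigma>. c' = (e, \<sigma>) \<and> Bs \<sigma> \<and> \<sigma> A = s \<and> \<sigma> B = b \<and> \<sigma> K = truth (ee s b))"
        if at: "At s b c" and b: "b > 0" for s b c
      proof -
        obtain \<sigma> where \<sigma>: "c = (L, \<sigma>)" "Bs \<sigma>" "\<sigma> A = s" "\<sigma> B = b" using Atc[OF at] by blast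
        show ?thesis unfolding \<sigma>(1)
          apply (rule seg_ins[OF c(7)], use \<sigma> ql in \<open>simp add: Jc\<close>, use b in \<open>simp add: \<sigma>(4) Bs0[OF \<sigma>(2)]\<close>)
          apply (rule seg_segr, rule seg_mono[OF Q1[OF c(8)]])
          subgoal for c' using ql \<sigma> Bsc[OF \<sigma>(2)]
            by (cases c') (simp add: confined_def J_def e_def)
          subgoal for c' using \<sigma> Bsc[OF \<sigma>(2)]
            by (cases c') (simp add: eeR e_def)
          done
      qed
      have try_no: "seg P x (J s b) c (At s (Suc b))" if at: "At s b c" and b: "b > 0" "\<not> ee s b" for s b c
      proof (rule seg_segr_trans[OF test[OF at b(1)]])
        fix c' assume "\<exists>\<sigma>. c' = (e, \<sigma>) \<and> Bs \<sigma> \<and> \<sigma> A = s \<and> \<sigma> B = b \<and> \<sigma> K = truth (ee s b)"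
        then obtain \<sigma> where \<sigma>: "c' = (e, \<sigma>)" "Bs \<sigma>" "\<sigma> A = s" "\<sigma> B = b" "\<sigma> K = 0" using b by auto
        show "segr P x (J s b) c' (At s (Suc b))" unfolding \<sigma>(1)
          apply (rule segr_ins[OF d(1)], use \<sigma> ql in \<open>simp add: Jc\<close>, simp add: \<sigma>(5) Bs0[OF \<sigma>(2)])
          apply (rule segr_ins[OF d(3)], use \<sigma> ql in \<open>simp add: Jc\<close>, simp)
          apply (rule segr_ins[OF d(4)], use \<sigma> ql in \<open>simp add: Jc Bsu\<close>, simp)
          apply (rule segr_here, use \<sigma> in \<open>simp add: At_def Bsu\<close>)
          done
      qed
      have try_yes: "seg P x (J s b) c (At b (Suc b))" if at: "At s b c" and b: "b > 0" "ee s b" for s b c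
      proof (rule seg_segr_trans[OF test[OF at b(1)]])
        fix c' assume "\<exists>\<sigma>. c' = (e, \<sigma>) \<and> Bs \<sigma> \<and> \<sigma> A = s \<and> \<sigma> B = b \<and> \<sigma> K = truth (ee s b)"
        then obtain \<sigma> where \<sigma>: "c' = (e, \<sigma>)" "Bs \<sigma>" "\<sigma> A = s" "\<sigma> B = b" "\<sigma> K = Suc 0" using b by auto
        have sb: "s < b" using eelt[OF b(2)] .
        show "segr P x (J s b) c' (At b (Suc b))" unfolding \<sigma>(1)
          apply (rule segr_ins[OF d(1)], use \<sigma> ql in \<open>simp add: Jc\<close>, simp add: \<sigma>(5) Bs0[OF \<sigma>(2)])
          apply (rule segr_ins[OF d(2)], use \<sigma> ql in \<open>simp add: Jc\<close>, simp)
          apply (rule segr_ins[OF d(3)], use \<sigma> ql sb in \<open>simp add: Jc Bsu\<close>, simp)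
          apply (rule segr_ins[OF d(4)], use \<sigma> ql sb in \<open>simp add: Jc Bsu\<close>, simp)
          apply (rule segr_here, use \<sigma> in \<open>simp add: At_def Bsu\<close>)
          done
      qed
      \<comment> \<open>The way back up: as parents are unique, the first \<open>D\<close> with an
        edge to \<open>b\<close> is \<open>s\<close>. The search then resumes with the candidate
        \<open>b + 1\<close>.\<close>
      have parent: "segr P x (J s b) (F, \<sigma>) (At s (Suc b))"
        if "ee s b" "Bs \<sigma>" "\<sigma> A = b" "\<sigma> B = 0" "\<sigma> D \<le> s" for s b \<sigma>
        using that
      proof (induction "s - \<sigma> D" arbitrary: \<sigma> rule: less_induct)
        case less
        note \<sigma> = less.prems(2-4)
        have sb: "s < b" using eelt[OF less.prems(1)] .
        have "seg P x (J s b) (F, \<sigma>) (\<lambda>c'. \<exists>\<sigma>'. c' = (g, \<sigma>') \<and> Bs \<sigma>' \<and> \<sigma>' A = b \<and> \<sigma>' B = 0 \<and>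
            \<sigma>' D = \<sigma> D \<and> \<sigma>' K = truth (ee (\<sigma> D) b))"
          apply (rule seg_mono[OF Q2[OF d(8)]])
          subgoal for c' using ql \<sigma> sb Bsc[OF \<sigma>(1)] by (cases c') (simp add: confined_def J_def g_def)
          subgoal for c' using \<sigma> Bsc[OF \<sigma>(1)] by (cases c') (simp add: eeR g_def)
          done
        then show ?case
        proof (rule segr_trans[OF seg_segr])
          fix c' assume "\<exists>\<sigma>'. c' = (g, \<sigma>') \<and> Bs \<sigma>' \<and> \<sigma>' A = b \<and> \<sigma>' B = 0 \<and> \<sigma>' D = \<sigma> D \<and> \<sigma>' K = truth (ee (\<sigma> D) b)"
          then obtain \<sigma>' where \<sigma>': "c' = (g, \<sigma>')" "Bs \<sigma>'" "\<sigma>' A = b" "\<sigma>' B = 0" "\<sigma>' D = \<sigma> D" "\<sigma>' K = truth (ee (\<sigma> D) b)"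
            by blast
          show "segr P x (J s b) c' (At s (Suc b))"
          proof (cases "\<sigma> D = s")
            case True
            have k1: "\<sigma>' K = Suc 0" using \<sigma>' True less.prems(1) by simp
            show ?thesis unfolding \<sigma>'(1)
              apply (rule segr_ins[OF h(1)], use \<sigma>' ql sb in \<open>simp add: Jc\<close>, simp add: k1 Bs0[OF \<sigma>'(2)])
              apply (rule segr_ins[OF h(2)], use \<sigma>' ql sb in \<open>simp add: Jc\<close>, simp)
              apply (rule segr_ins[OF h(3)], use \<sigma>' ql sb in \<open>simp add: Jc Bsu\<close>, simp)
              apply (rule segr_ins[OF h(4)], use \<sigma>' ql sb in \<open>simp add: Jc Bsu\<close>, simp)
              apply (rule segr_ins[OF h(5)], use \<sigma>' ql sb True in \<open>simp add: Jc Bsu\<close>, simp)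
              apply (rule segr_here, use \<sigma>' True in \<open>simp add: At_def Bsu\<close>)
              done
          next
            case False
            then have "\<not> ee (\<sigma> D) b" using eeun less.prems(1) by blast
            then have k0: "\<sigma>' K = 0" using \<sigma>' by simp
            have nx: "segr P x (J s b) (F, \<sigma>'(D := Suc (\<sigma>' D))) (At s (Suc b))"
              by (rule less.hyps) (use False \<sigma>' less.prems in \<open>auto simp: Bsu\<close>)
            show ?thesis unfolding \<sigma>'(1)
              apply (rule segr_ins[OF h(1)], use \<sigma>' ql sb in \<open>simp add: Jc\<close>, simp add: k0 Bs0[OF \<sigma>'(2)])
              apply (rule segr_ins[OF h(6)], use \<sigma>' ql sb in \<open>simp add: Jc\<close>, simp)
              apply (rule segr_ins[OF h(7)], use \<sigma>' ql sb in \<open>simp add: Jc Bsu\<close>)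
              using nx by simp
          qed
        qed
      qed
      have ascend: "seg P x (J s b) c (At s (Suc b))" if at: "At b 0 c" and s: "ee s b" "s \<ge> 1" for s b c
      proof -
        obtain \<sigma> where \<sigma>: "c = (L, \<sigma>)" "Bs \<sigma>" "\<sigma> A = b" "\<sigma> B = 0" using Atc[OF at] by blast
        \<comment> \<open>Having a parent that is at least 1, \<open>b\<close> is not the root, so
          the test against \<open>U\<close> does not end the search.\<close>
        have sb: "s < b" "b \<noteq> 0" "b \<noteq> Suc 0" using eelt[OF s(1)] s(2) by auto
        show ?thesis unfolding \<sigma>(1)
          apply (rule seg_ins[OF c(7)], use \<sigma> ql sb in \<open>simp add: Jc\<close>, simp add: \<sigma>(4) Bs0[OF \<sigma>(2)])
          apply (rule segr_ins[OF d(5)], use \<sigma> ql sb in \<open>simp add: Jc\<close>, simp add: \<sigma>(3) sb Bs0[OF \<sigma>(2)])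
          apply (rule segr_ins[OF d(6)], use \<sigma> ql sb in \<open>simp add: Jc\<close>, simp add: \<sigma>(3) sb Bs0[OF \<sigma>(2)])
          apply (rule segr_ins[OF d(7)], use \<sigma> ql sb in \<open>simp add: Jc\<close>, simp add: ql(9)[symmetric])
          apply (rule parent[OF s(1)])
          using \<sigma> by (simp_all add: Bsu)
      qed
      \<comment> \<open>The well-founded part of the tree: the nodes from which no infinite path
        starts.\<close>
      define ac where "ac = Wellfounded.accp (\<lambda>t s. ee s t)"
      have visit: "seg P x (J s b) c (At s (Suc b))"
        if at: "At s b c" and s: "1 \<le> s" "s < b"
          and sub: "ee s b \<Longrightarrow> (\<And>c. At b (Suc b) c \<Longrightarrow> seg P x (J b (Suc b)) c (At b 0))" for s b c
      proof (cases "ee s b")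
        case False
        then show ?thesis using try_no[OF at] s by simp
      next
        case True
        show ?thesis
        proof (rule seg_trans[OF try_yes[OF at _ True]])
          show "b > 0" using s by simp
          fix c' assume "At b (Suc b) c'"
          from sub[OF True this] have "seg P x (J s b) c' (At b 0)"
            by (rule seg_mono) (use s in \<open>auto intro: Jmono\<close>)
          then show "seg P x (J s b) c' (At s (Suc b))"
            by (rule seg_trans) (rule ascend[OF _ True s(1)])
        qed
      qed
      have lim_fixed: "l = L \<and> Bs \<sigma>"
        if q: "\<And>n c. Q n c \<Longrightarrow> \<exists>s b. At s b c" and j: "\<And>n e. Jn n e \<Longrightarrow> \<exists>s b. J s b e"
        and lim: "(\<forall>v. (\<forall>n e. Jn n e \<longrightarrow> v \<le> fst e) \<longrightarrow> (\<forall>n c. Q n c \<longrightarrow> fst c = v) \<longrightarrow> l = v) \<and>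
            (\<forall>i v. (\<forall>n e. Jn n e \<longrightarrow> v \<le> snd e i) \<longrightarrow> (\<forall>n c. Q n c \<longrightarrow> snd c i = v) \<longrightarrow> \<sigma> i = v) \<and>
            (\<forall>i. (\<forall>M. \<exists>N. \<forall>n\<ge>N. \<forall>e. Jn n e \<longrightarrow> snd e i = 0 \<or> M \<le> snd e i) \<longrightarrow> \<sigma> i = 0)"
        for Q Jn :: "nat \<Rightarrow> config \<Rightarrow> bool" and l \<sigma>
      proof -
        have fx: "\<sigma> i = v" if v: "\<And>\<sigma>'. Bs \<sigma>' \<Longrightarrow> \<sigma>' i = v" for i v
        proof (rule lim[THEN conjunct2, THEN conjunct1, THEN spec, THEN spec, THEN mp, THEN mp]; intro allI impI)
          fix n e assume "Jn n e"
          then show "v \<le> snd e i" using j v by (cases e) (fastforce simp: J_def)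
        next
          fix n c assume "Q n c"
          then show "snd c i = v" using q v by (cases c) (fastforce simp: At_def)
        qed
        have "l = L"
        proof (rule lim[THEN conjunct1, THEN spec, THEN mp, THEN mp]; intro allI impI)
          fix n e assume "Jn n e"
          then show "L \<le> fst e" using j by (cases e) (fastforce simp: J_def)
        next
          fix n c assume "Q n c"
          then show "fst c = L" using q by (cases c) (fastforce simp: At_def)
        qed
        moreover have "Bs \<sigma>" unfolding Bs_def
          by (intro conjI allI impI fx) (simp_all add: Bs_def)
        ultimately show ?thesis by blast
      qed
      \<comment> \<open>Induction on the well-founded part. The candidates from \<open>b\<close> on
        are dealt with one after the other, each in a segment of its own; in the limit
        \<open>A\<close> is \<open>s\<close>, its value at the start of every segment, and
        \<open>B\<close> overflows.\<close>
      have acc: "1 \<le> s \<Longrightarrow> (\<And>b c. s < b \<Longrightarrow> At s b c \<Longrightarrow> seg P x (J s b) c (At s 0))" if "ac s" for s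
        using that unfolding ac_def
      proof (induction s rule: accp.induct)
        case (accI s)
        note s1 = accI.prems(1)
        show ?case
        proof (rule seg_mono[OF seg_limit_regs[of "\<lambda>n. At s (b + n)" P x "\<lambda>n. J s (b + n)"]])
          fix n c' assume "At s (b + n) c'"
          then show "seg P x (J s (b + n)) c' (At s (b + Suc n))"
            using visit[of s "b + n" c'] accI s1 by simp
        next
          show "At s (b + 0) c" using accI.prems by simp
          show "J s b e" if "\<exists>n. J s (b + n) e" for e using that Jmono[of s _ e s b] by auto
          fix e' :: config
          obtain l \<sigma> where e': "e' = (l, \<sigma>)" by (cases e')
          assume lim0: "case e' of (l, \<sigma>) \<Rightarrow>
            (\<forall>v. (\<forall>n e. J s (b + n) e \<longrightarrow> v \<le> fst e) \<longrightarrow> (\<forall>n c. At s (b + n) c \<longrightarrow> fst c = v) \<longrightarrow> l = v) \<and>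
            (\<forall>i v. (\<forall>n e. J s (b + n) e \<longrightarrow> v \<le> snd e i) \<longrightarrow> (\<forall>n c. At s (b + n) c \<longrightarrow> snd c i = v) \<longrightarrow> \<sigma> i = v) \<and>
            (\<forall>i. (\<forall>M. \<exists>N. \<forall>n\<ge>N. \<forall>e. J s (b + n) e \<longrightarrow> snd e i = 0 \<or> M \<le> snd e i) \<longrightarrow> \<sigma> i = 0)"
          note lim = lim0[unfolded e' prod.case]
          have 1: "l = L \<and> Bs \<sigma>" by (rule lim_fixed[OF _ _ lim]) auto
          have 2: "\<sigma> A = s"
            by (rule lim[THEN conjunct2, THEN conjunct1, THEN spec, THEN spec, THEN mp, THEN mp])
              (auto simp: J_def At_def)
          have 3: "\<sigma> B = 0"
          proof (rule lim[THEN conjunct2, THEN conjunct2, THEN spec, THEN mp], intro allI)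
            fix M show "\<exists>N. \<forall>n\<ge>N. \<forall>e. J s (b + n) e \<longrightarrow> snd e B = 0 \<or> M \<le> snd e B"
              by (rule exI[of _ M]) (auto simp: J_def)
          qed
          show "At s 0 e'" using 1 2 3 by (simp add: At_def e')
        qed
      qed
      define I where "I = confined q H k \<rho>"
      have JI: "I c" if "J s b c" for s b c
        using that ql by (cases c) (simp add: J_def I_def confined_def Bs_def)
      define Fin where "Fin v = (\<lambda>(l, \<sigma>). l = H \<and> (\<forall>i<k. \<sigma> i = \<rho> i) \<and> \<sigma> k = truth v)" for v
      let ?\<rho>0 = "\<rho>(k := 0, U := Suc 0, A := Suc 0, B := Suc (Suc 0))"
      have At0: "At (Suc 0) (Suc (Suc 0)) (L, ?\<rho>0)" by (simp add: At_def Bs_def)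
      define ill where "ill \<longleftrightarrow> (\<exists>f. f 0 = Suc 0 \<and> (\<forall>n. ee (f n) (f (Suc n))))"
      have main: "segr P x I (L, ?\<rho>0) (Fin ill)"
      proof (cases "ac (Suc 0)")
        case True
        have "\<forall>f. f 0 = s \<longrightarrow> \<not> (\<forall>n. ee (f n) (f (Suc n)))" if "ac s" for s
          using that unfolding ac_def
        proof (induction s rule: accp.induct)
          case (accI s)
          show ?case
          proof (intro allI impI notI)
            fix f :: "nat \<Rightarrow> nat" assume f: "f 0 = s" "\<forall>n. ee (f n) (f (Suc n))"
            have "\<not> (\<forall>n. ee (f (Suc n)) (f (Suc (Suc n))))"
              using accI.IH[of "f (Suc 0)", rule_format, of "\<lambda>n. f (Suc n)"] f by metis
            then show False using f by blast
          qed
        qed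
        then have ill: "\<not> ill" using True unfolding ill_def by blast
        have "seg P x I (L, ?\<rho>0) (At (Suc 0) 0)"
          by (rule seg_mono[OF acc[OF True _ _ At0]]) (use JI in auto)
        then show ?thesis
        proof (rule segr_trans[OF seg_segr])
          fix c' assume "At (Suc 0) 0 c'"
          then obtain \<sigma> where \<sigma>: "c' = (L, \<sigma>)" "Bs \<sigma>" "\<sigma> A = Suc 0" "\<sigma> B = 0" using Atc by blast
          have I: "I (l, \<sigma>)" if "q \<le> l" "l < H" for l using \<sigma>(2) that by (simp add: I_def confined_def Bs_def)
          show "segr P x I c' (Fin ill)" unfolding \<sigma>(1)
            apply (rule segr_ins[OF c(7)], use ql in \<open>simp add: I\<close>, simp add: \<sigma>(4) Bs0[OF \<sigma>(2)])
            apply (rule segr_ins[OF d(5)], use ql in \<open>simp add: I\<close>, simp add: \<sigma>(3) Bs0[OF \<sigma>(2)])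
            apply (rule segr_ins[OF d(6)], use ql in \<open>simp add: I\<close>, simp add: \<sigma>(3) Bs0[OF \<sigma>(2)])
            apply (rule segr_here, use \<sigma>(2) ill in \<open>simp add: Fin_def Bs_def\<close>)
            done
        qed
      next
        case False
        \<comment> \<open>The least child outside the well-founded part: the subtrees of all smaller
          children are searched and left again, so that the machine follows the leftmost infinite
          path.\<close>
        define nx where "nx s = (LEAST t. ee s t \<and> \<not> ac t)" for s
        have nx: "ee s (nx s)" "\<not> ac (nx s)" "\<And>t. t < nx s \<Longrightarrow> ee s t \<Longrightarrow> ac t" if "\<not> ac s" for s
        proof -
          have "\<exists>t. ee s t \<and> \<not> ac t" using not_accp_down[of "\<lambda>t s. ee s t" s] that unfolding ac_def by blast
          then have "ee s (nx s) \<and> \<not> ac (nx s)" unfolding nx_def by (rule LeastI_ex)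
          then show "ee s (nx s)" "\<not> ac (nx s)" by auto
          show "\<And>t. t < nx s \<Longrightarrow> ee s t \<Longrightarrow> ac t" unfolding nx_def using not_less_Least by blast
        qed
        define f where "f = rec_nat (Suc 0) (\<lambda>_ s. nx s)"
        have f: "\<not> ac (f n)" for n by (induction n) (use False nx in \<open>auto simp: f_def\<close>)
        have fe: "ee (f n) (f (Suc n))" for n using nx(1)[OF f[of n]] by (simp add: f_def)
        have fl: "f n < f (Suc n)" for n using eelt[OF fe] .
        \<comment> \<open>Edges increase, so the path tends to infinity and both \<open>A\<close>
          and \<open>B\<close> overflow.\<close>
        have fn: "Suc n \<le> f n" for n
          by (induction n) (use fl in \<open>auto simp: f_def intro: Suc_leI le_less_trans\<close>)
        have f0: "f 0 = Suc 0" by (simp add: f_def)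
        have ill: "ill" unfolding ill_def using f0 fe by blast
        have go: "seg P x (J s b) c (At (nx s) (Suc (nx s)))"
          if "1 \<le> s" "\<not> ac s" "At s b c" "s < b" "b \<le> nx s" for s b c
          using that
        proof (induction "nx s - b" arbitrary: b c)
          case 0
          then show ?case using try_yes[of s b c] nx(1)[of s] by simp
        next
          case (Suc m)
          have "seg P x (J s b) c (At s (Suc b))"
          proof (rule visit)
            show "seg P x (J b (Suc b)) c' (At b 0)" if "ee s b" "At b (Suc b) c'" for c'
              using acc[of b] nx(3)[of s b] Suc that by simp
          qed (use Suc in auto)
          then show ?case
          proof (rule seg_trans)
            fix c' assume "At s (Suc b) c'"
            then have "seg P x (J s (Suc b)) c' (At (nx s) (Suc (nx s)))"
              using Suc.hyps(1)[of "Suc b" c'] Suc.hyps(2) Suc.prems by simp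
            then show "seg P x (J s b) c' (At (nx s) (Suc (nx s)))"
              by (rule seg_mono) (auto intro: Jmono)
          qed
        qed
        have "seg P x I (L, ?\<rho>0) (At 0 0)"
        proof (rule seg_mono[OF seg_limit_regs[of "\<lambda>n. At (f n) (Suc (f n))" P x "\<lambda>n. J (f n) (Suc (f n))"]])
          fix n c' assume "At (f n) (Suc (f n)) c'"
          then show "seg P x (J (f n) (Suc (f n))) c' (At (f (Suc n)) (Suc (f (Suc n))))"
            using go[of "f n" "Suc (f n)" c'] f[of n] fn[of n] fl[of n] by (simp add: f_def)
        next
          show "At (f 0) (Suc (f 0)) (L, ?\<rho>0)" using At0 f0 by simp
          show "I e" if "\<exists>n. J (f n) (Suc (f n)) e" for e using that JI by blast
          fix e' :: config
          obtain l \<sigma> where e': "e' = (l, \<sigma>)" by (cases e')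
          assume lim0: "case e' of (l, \<sigma>) \<Rightarrow>
            (\<forall>v. (\<forall>n e. J (f n) (Suc (f n)) e \<longrightarrow> v \<le> fst e) \<longrightarrow> (\<forall>n c. At (f n) (Suc (f n)) c \<longrightarrow> fst c = v) \<longrightarrow> l = v) \<and>
            (\<forall>i v. (\<forall>n e. J (f n) (Suc (f n)) e \<longrightarrow> v \<le> snd e i) \<longrightarrow> (\<forall>n c. At (f n) (Suc (f n)) c \<longrightarrow> snd c i = v) \<longrightarrow> \<sigma> i = v) \<and>
            (\<forall>i. (\<forall>M. \<exists>N. \<forall>n\<ge>N. \<forall>e. J (f n) (Suc (f n)) e \<longrightarrow> snd e i = 0 \<or> M \<le> snd e i) \<longrightarrow> \<sigma> i = 0)"
          note lim = lim0[unfolded e' prod.case]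
          have 1: "l = L \<and> Bs \<sigma>" by (rule lim_fixed[OF _ _ lim]) auto
          have fM: "M \<le> f n" if "M \<le> n" for M n using fn[of n] that by simp
          have 2: "\<sigma> A = 0"
          proof (rule lim[THEN conjunct2, THEN conjunct2, THEN spec, THEN mp], intro allI)
            fix M show "\<exists>N. \<forall>n\<ge>N. \<forall>e. J (f n) (Suc (f n)) e \<longrightarrow> snd e A = 0 \<or> M \<le> snd e A"
            proof (intro exI[of _ M] allI impI)
              fix n e assume "M \<le> n" "J (f n) (Suc (f n)) e"
              then show "snd e A = 0 \<or> M \<le> snd e A" using fM[of M n] by (auto simp: J_def)
            qed
          qed
          have 3: "\<sigma> B = 0"
          proof (rule lim[THEN conjunct2, THEN conjunct2, THEN spec, THEN mp], intro allI)
            fix M show "\<exists>N. \<forall>n\<ge>N. \<forall>e. J (f n) (Suc (f n)) e \<longrightarrow> snd e B = 0 \<or> M \<le> snd e B"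
            proof (intro exI[of _ M] allI impI)
              fix n e assume "M \<le> n" "J (f n) (Suc (f n)) e"
              then show "snd e B = 0 \<or> M \<le> snd e B" using fM[of M n] by (auto simp: J_def)
            qed
          qed
          show "At 0 0 e'" using 1 2 3 by (simp add: At_def e')
        qed
        then show ?thesis
        proof (rule segr_trans[OF seg_segr])
          fix c' assume "At 0 0 c'"
          then obtain \<sigma> where \<sigma>: "c' = (L, \<sigma>)" "Bs \<sigma>" "\<sigma> A = 0" "\<sigma> B = 0" using Atc by blast
          have I: "I (l, \<sigma>)" if "q \<le> l" "l < H" for l using \<sigma>(2) that by (simp add: I_def confined_def Bs_def)
          show "segr P x I c' (Fin ill)" unfolding \<sigma>(1)
            apply (rule segr_ins[OF c(7)], use ql in \<open>simp add: I\<close>, simp add: \<sigma>(4) Bs0[OF \<sigma>(2)])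
            apply (rule segr_ins[OF d(5)], use ql in \<open>simp add: I\<close>, simp add: \<sigma>(3) Bs0[OF \<sigma>(2)])
            apply (rule segr_ins[OF h(8)], use ql in \<open>simp add: I\<close>, simp)
            apply (rule segr_here, use \<sigma>(2) ill in \<open>simp add: Fin_def Bs_def H_def\<close>)
            done
        qed
      qed
      have Iq: "I (l, \<sigma>)" if "q \<le> l" "l < L" "\<forall>i<k. \<sigma> i = \<rho> i" for l \<sigma>
        using that ql by (simp add: I_def confined_def)
      have "seg P x I (q, \<rho>) (Fin ill)"
        apply (rule seg_ins[OF c(1)], use ql in \<open>simp add: Iq\<close>, simp)
        apply (rule segr_ins[OF c(2)], use ql in \<open>simp add: Iq\<close>, simp)
        apply (rule segr_ins[OF c(3)], use ql in \<open>simp add: Iq\<close>, simp)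
        apply (rule segr_ins[OF c(4)], use ql in \<open>simp add: Iq\<close>, simp)
        apply (rule segr_ins[OF c(5)], use ql in \<open>simp add: Iq\<close>, simp)
        apply (rule segr_ins[OF c(6)], use ql in \<open>simp add: Iq\<close>)
        using main by (simp add: L_def)
      then show "seg P x (confined q H k \<rho>) (q, \<rho>) (\<lambda>(l, \<sigma>). l = H \<and> (\<forall>i<k. \<sigma> i = \<rho> i) \<and>
          \<sigma> k = truth (\<exists>f. f 0 = Suc 0 \<and> (\<forall>n. ed x (\<lambda>i. \<rho> (\<tau> i)) (f n) (f (Suc n)))))"
        by (simp add: I_def Fin_def ill_def ee_def)
    qed
    then show "\<exists>Q. decides q k Q (\<lambda>x \<rho>. \<exists>f. f 0 = Suc 0 \<and> (\<forall>n. ed x (\<lambda>i. \<rho> (\<tau> i)) (f n) (f (Suc n))))" by blast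
  qed
qed

section \<open>Arithmetic and closed games\<close>

lemma computable_or:
  assumes "computable_rel R" "computable_rel S" shows "computable_rel (\<lambda>x \<rho>. R x \<rho> \<or> S x \<rho>)"
proof -
  have "computable_rel (\<lambda>x \<rho>. \<not> (\<not> R x \<rho> \<and> \<not> S x \<rho>))"
    by (rule computable_not, rule computable_and; rule computable_not, rule assms)
  then show ?thesis by (simp only: de_Morgan_conj not_not)
qed

lemma computable_imp:
  assumes "computable_rel R" "computable_rel S" shows "computable_rel (\<lambda>x \<rho>. R x \<rho> \<longrightarrow> S x \<rho>)"
  unfolding imp_conv_disj by (rule computable_or, rule computable_not, (rule assms)+)

lemma computable_all:
  assumes "computable_rel (\<lambda>x \<rho>. \<phi> x (\<lambda>i. \<rho> (Suc i)) (\<rho> 0))"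
  shows "computable_rel (\<lambda>x \<rho>. \<forall>n. \<phi> x \<rho> n)"
proof -
  have "computable_rel (\<lambda>x \<rho>. \<exists>n. \<not> \<phi> x \<rho> n)"
    by (rule computable_ex) (rule computable_not[OF assms])
  then have "computable_rel (\<lambda>x \<rho>. \<not> (\<exists>n. \<not> \<phi> x \<rho> n))" by (rule computable_not)
  then show ?thesis by (simp only: not_ex not_not)
qed

lemmas computable_intros = computable_eq computable_Suc computable_mem computable_not computable_and
  computable_or computable_imp computable_ex computable_all

section \<open>Arithmetic of pairs and lists\<close>

lemma computable_zero: "computable_rel (\<lambda>x \<rho>. \<rho> i = 0)"
proof -
  have "computable_rel (\<lambda>x \<rho>. \<not> (\<exists>n. \<rho> i = Suc n))" by (intro computable_intros)
  moreover have "(\<nexists>n. m = Suc n) \<longleftrightarrow> m = 0" for m by (cases m) auto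
  ultimately show ?thesis by (simp only:)
qed

lemma computable_add: "computable_rel (\<lambda>x \<rho>. \<rho> k = \<rho> i + \<rho> j)"
proof -
  have r: "rec_nat a (\<lambda>_ b. Suc b) n = a + n" for a n by (induction n) auto
  have "computable_rel (\<lambda>x \<rho>. \<rho> k = rec_nat (\<rho> i) (\<lambda>_ b. Suc b) (\<rho> j))"
    by (intro computable_rec computable_intros)
  then show ?thesis by (simp add: r)
qed

lemma computable_le: "computable_rel (\<lambda>x \<rho>. \<rho> i \<le> \<rho> j)"
proof -
  have "computable_rel (\<lambda>x \<rho>. \<exists>n. \<rho> j = \<rho> i + n)" by (intro computable_intros computable_add)
  then show ?thesis by (simp add: le_iff_add)
qed

lemma computable_less: "computable_rel (\<lambda>x \<rho>. \<rho> i < \<rho> j)"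
proof -
  have "computable_rel (\<lambda>x \<rho>. \<not> \<rho> j \<le> \<rho> i)" by (intro computable_intros computable_le)
  then show ?thesis by (simp add: not_le)
qed

text \<open>Serves the pairing function: \<open>prod_encode (m, n)\<close> is
  \<open>triangle (m + n) + m\<close>.\<close>

lemma computable_triangle: "computable_rel (\<lambda>x \<rho>. \<rho> i = triangle (\<rho> j))"
proof -
  let ?g = "\<lambda>n a. a + Suc n"
  have r: "rec_nat 0 ?g n = triangle n" for n by (induction n) auto
  have "computable_rel (\<lambda>x \<rho>. \<exists>m. m = Suc (\<rho> 0) \<and> \<rho> (Suc (Suc 0)) = \<rho> (Suc 0) + m)"
    by (intro computable_intros computable_add)
  then have "computable_rel (\<lambda>x \<rho>. \<rho> (Suc (Suc 0)) = ?g (\<rho> 0) (\<rho> (Suc 0)))" by simp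
  then have "computable_rel (\<lambda>x \<rho>. \<exists>z. z = 0 \<and> \<rho> i = rec_nat z ?g (\<rho> j))"
    by (intro computable_intros computable_rec computable_zero)
  moreover have "(\<exists>z. z = 0 \<and> a = rec_nat z ?g b) \<longleftrightarrow> a = triangle b" for a b using r[of b] by auto
  ultimately show ?thesis by (simp only:)
qed

lemma computable_pair: "computable_rel (\<lambda>x \<rho>. \<rho> k = prod_encode (\<rho> i, \<rho> j))"
proof -
  have "computable_rel (\<lambda>x \<rho>. \<exists>s. s = \<rho> i + \<rho> j \<and> (\<exists>t. t = triangle s \<and> \<rho> k = t + \<rho> i))"
    by (intro computable_intros computable_add computable_triangle)
  then show ?thesis by (simp add: prod_encode_def)
qed

lemma computable_Cons: "computable_rel (\<lambda>x \<rho>. \<rho> k = Suc (prod_encode (\<rho> i, \<rho> j)))"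
proof -
  have "computable_rel (\<lambda>x \<rho>. \<exists>s. s = prod_encode (\<rho> i, \<rho> j) \<and> \<rho> k = Suc s)"
    by (intro computable_intros computable_pair)
  then show ?thesis by simp
qed

definition tlc :: "nat \<Rightarrow> nat" where "tlc s = list_encode (tl (list_decode s))"
definition dropc :: "nat \<Rightarrow> nat \<Rightarrow> nat" where "dropc s n = list_encode (drop n (list_decode s))"

lemma computable_tlc: "computable_rel (\<lambda>x \<rho>. \<rho> i = tlc (\<rho> j))"
proof -
  have eq: "u = tlc s \<longleftrightarrow> (s = 0 \<and> u = 0) \<or> (\<exists>m. s = Suc (prod_encode (m, u)))" for s u
  proof (cases s)
    case 0 then show ?thesis by (simp add: tlc_def)
  next
    case (Suc p)
    obtain m v where "prod_decode p = (m, v)" by (cases "prod_decode p")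
    then have p: "p = prod_encode (m, v)" by (metis prod_decode_inverse)
    then show ?thesis using Suc by (auto simp: tlc_def)
  qed
  have "computable_rel (\<lambda>x \<rho>. (\<rho> j = 0 \<and> \<rho> i = 0) \<or> (\<exists>m. \<rho> j = Suc (prod_encode (m, \<rho> i))))"
    by (intro computable_intros computable_zero computable_Cons)
  then show ?thesis by (simp add: eq)
qed

lemma computable_dropc: "computable_rel (\<lambda>x \<rho>. \<rho> k = dropc (\<rho> i) (\<rho> j))"
proof -
  have r: "rec_nat s (\<lambda>_. tlc) n = dropc s n" for s n
    by (induction n) (auto simp: tlc_def dropc_def drop_Suc tl_drop)
  have "computable_rel (\<lambda>x \<rho>. \<rho> k = rec_nat (\<rho> i) (\<lambda>_. tlc) (\<rho> j))"
    by (intro computable_rec computable_tlc)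
  then show ?thesis by (simp add: r)
qed

text \<open>A relation and not a function: indices beyond the length have no value, so that a code
  is determined by this relation (\<open>nthc_ext\<close>).\<close>

definition nthc :: "nat \<Rightarrow> nat \<Rightarrow> nat \<Rightarrow> bool" where
  "nthc s i v \<longleftrightarrow> i < length (list_decode s) \<and> list_decode s ! i = v"

lemma list_encode_eq_Cons_iff: "list_encode xs = Suc (prod_encode (v, u)) \<longleftrightarrow> (\<exists>ys. xs = v # ys \<and> u = list_encode ys)"
  by (cases xs) auto

lemma dropc_eq_Cons: "dropc s i = Suc (prod_encode (v, u)) \<longleftrightarrow>
   nthc s i v \<and> u = dropc s (Suc i)"
proof (cases "i < length (list_decode s)")
  case True
  then have "drop i (list_decode s) = list_decode s ! i # drop (Suc i) (list_decode s)"
    by (rule Cons_nth_drop_Suc[symmetric])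
  then show ?thesis using True by (auto simp: dropc_def nthc_def list_encode_eq_Cons_iff)
qed (simp add: dropc_def nthc_def)

lemma computable_nthc: "computable_rel (\<lambda>x \<rho>. nthc (\<rho> i) (\<rho> j) (\<rho> k))"
proof -
  have "computable_rel (\<lambda>x \<rho>. \<exists>d. d = dropc (\<rho> i) (\<rho> j) \<and> (\<exists>u. d = Suc (prod_encode (\<rho> k, u))))"
    by (intro computable_intros computable_dropc computable_Cons)
  then show ?thesis by (simp add: dropc_eq_Cons)
qed

lemma computable_length: "computable_rel (\<lambda>x \<rho>. length (list_decode (\<rho> i)) = \<rho> j)"
proof -
  have eq: "length (list_decode s) = n \<longleftrightarrow> (\<forall>k. k < n \<longleftrightarrow> (\<exists>v. nthc s k v))" for s n
  proof
    assume "\<forall>k. k < n \<longleftrightarrow> (\<exists>v. nthc s k v)"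
    then have "k < n \<longleftrightarrow> k < length (list_decode s)" for k by (auto simp: nthc_def)
    then show "length (list_decode s) = n" by (metis linorder_neqE_nat nat_neq_iff)
  qed (auto simp: nthc_def)
  have "computable_rel (\<lambda>x \<rho>. \<forall>k. (k < \<rho> j \<longrightarrow> (\<exists>v. nthc (\<rho> i) k v)) \<and> ((\<exists>v. nthc (\<rho> i) k v) \<longrightarrow> k < \<rho> j))"
    by (intro computable_intros computable_less computable_nthc)
  then show ?thesis unfolding eq by (simp add: iff_conv_conj_imp)
qed

text \<open>The positions from which the second player wins the closed game in which the players alternately
  choose \<open>a\<close> and \<open>b\<close>; the second player wins at once if \<open>G\<close> holds, and otherwise must maintain \<open>H\<close>.\<close>

definition gset :: "(nat \<Rightarrow> nat \<Rightarrow> nat \<Rightarrow> bool) \<Rightarrow> (nat \<Rightarrow> nat \<Rightarrow> nat \<Rightarrow> bool) \<Rightarrow> nat set" where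
  "gset G H = gfp (\<lambda>V. {n. \<forall>a. \<exists>b. G n a b \<or> H n a b \<and> b \<in> V})"

lemma gset_mono: "mono (\<lambda>V. {n. \<forall>a. \<exists>b. G n a b \<or> H n a b \<and> b \<in> V})"
  by (rule monoI) blast

lemma gset_unfold: "n \<in> gset G H \<longleftrightarrow> (\<forall>a. \<exists>b. G n a b \<or> H n a b \<and> b \<in> gset G H)"
  unfolding gset_def by (subst gfp_unfold[OF gset_mono]) simp

lemma gset_coinduct:
  assumes "n \<in> V" "\<And>n a. n \<in> V \<Longrightarrow> \<exists>b. G n a b \<or> H n a b \<and> b \<in> V"
  shows "n \<in> gset G H"
proof -
  have "V \<subseteq> gset G H" unfolding gset_def by (rule gfp_upperbound) (use assms(2) in blast)
  then show ?thesis using assms(1) by blast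
qed

text \<open>Positions are counted from the end of the list. Paths grow by adding an element in
  front, and this leaves all earlier entries at their index.\<close>

definition lookup :: "nat \<Rightarrow> nat \<Rightarrow> nat \<Rightarrow> bool" where
  "lookup t k v \<longleftrightarrow> k < length (list_decode t) \<and> rev (list_decode t) ! k = v"

lemma computable_lookup: "computable_rel (\<lambda>x \<rho>. lookup (\<rho> i) (\<rho> j) (\<rho> k))"
proof -
  have eq: "lookup t n v \<longleftrightarrow> (\<exists>m. nthc t m v \<and> (\<exists>l. length (list_decode t) = l \<and> (\<exists>p. p = m + n \<and> l = Suc p)))" for t n v
  proof
    assume "lookup t n v"
    then show "\<exists>m. nthc t m v \<and> (\<exists>l. length (list_decode t) = l \<and> (\<exists>p. p = m + n \<and> l = Suc p))"
      by (intro exI[of _ "length (list_decode t) - Suc n"]) (auto simp: lookup_def nthc_def rev_nth)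
  next
    assume "\<exists>m. nthc t m v \<and> (\<exists>l. length (list_decode t) = l \<and> (\<exists>p. p = m + n \<and> l = Suc p))"
    then show "lookup t n v" by (auto simp: lookup_def nthc_def rev_nth)
  qed
  have "computable_rel (\<lambda>x \<rho>. \<exists>m. nthc (\<rho> i) m (\<rho> k) \<and> (\<exists>l. length (list_decode (\<rho> i)) = l \<and> (\<exists>p. p = m + \<rho> j \<and> l = Suc p)))"
    by (intro computable_intros computable_nthc computable_length computable_add)
  then show ?thesis unfolding eq .
qed

text \<open>Replies \<open>h\<close> of a winning strategy from \<open>n0\<close>: \<open>h\<close> is positive at \<open>(n, a)\<close> for the positions \<open>n\<close>
  that are claimed to be winning, and then exceeds the reply to \<open>a\<close> by one.\<close>

definition strategy_node ::
  "(nat \<Rightarrow> nat \<Rightarrow> nat \<Rightarrow> bool) \<Rightarrow> (nat \<Rightarrow> nat \<Rightarrow> nat \<Rightarrow> bool) \<Rightarrow> nat \<Rightarrow> nat \<Rightarrow> bool" where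
  "strategy_node G H n0 t \<longleftrightarrow> (\<forall>k v n a. lookup t k v \<longrightarrow> k = prod_encode (n, a) \<longrightarrow>
     (n = n0 \<longrightarrow> \<not> v = 0) \<and> (\<forall>b. v = Suc b \<longrightarrow> G n a b \<or> H n a b \<and>
       (\<forall>k' v' a'. lookup t k' v' \<longrightarrow> k' = prod_encode (b, a') \<longrightarrow> \<not> v' = 0)))"

text \<open>Winning positions form a greatest fixed point, so positional strategies suffice, and
  these are sequences \<open>h\<close> indexed by coded pairs of a position and a move. The finite
  initial segments of such sequences form a tree, whose nodes are shifted by one because
  \<open>computable_path\<close> starts at 1.\<close>

lemma gset_iff_path:
  "n0 \<in> gset G H \<longleftrightarrow> (\<exists>f. f 0 = Suc 0 \<and> (\<forall>j. \<exists>s. f j = Suc s \<and> (\<exists>t. f (Suc j) = Suc t \<and>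
     (\<exists>m. t = Suc (prod_encode (m, s))) \<and> strategy_node G H n0 t)))" (is "_ = (\<exists>f. ?P f)")
proof
  assume n0: "n0 \<in> gset G H"
  define r where "r n a = (SOME b. G n a b \<or> H n a b \<and> b \<in> gset G H)" for n a
  have r: "G n a (r n a) \<or> H n a (r n a) \<and> r n a \<in> gset G H" if "n \<in> gset G H" for n a
    unfolding r_def by (rule someI_ex) (use that gset_unfold in blast)
  define h where "h k = (case prod_decode k of (n, a) \<Rightarrow> if n \<in> gset G H then Suc (r n a) else 0)" for k
  define c where "c j = list_encode (rev (map h [0..<j]))" for j
  have lk: "lookup (c j) k v \<longleftrightarrow> k < j \<and> v = h k" for j k v
    by (auto simp: lookup_def c_def)
  have sn: "strategy_node G H n0 (c j)" for j
    unfolding strategy_node_def lk using r n0 by (auto simp: h_def split: if_splits)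
  have cS: "c (Suc j) = Suc (prod_encode (h j, c j))" for j by (simp add: c_def)
  have c0: "c 0 = 0" by (simp add: c_def)
  have "?P (\<lambda>j. Suc (c j))"
  proof (intro conjI allI)
    show "Suc (c 0) = Suc 0" using c0 by simp
    show "\<exists>s. Suc (c j) = Suc s \<and> (\<exists>t. Suc (c (Suc j)) = Suc t \<and>
        (\<exists>m. t = Suc (prod_encode (m, s))) \<and> strategy_node G H n0 t)" for j
      by (rule exI[of _ "c j"], rule conjI[OF refl], rule exI[of _ "c (Suc j)"], rule conjI[OF refl],
        rule conjI, rule exI[of _ "h j"], rule cS, rule sn)
  qed
  then show "\<exists>f. ?P f" by (rule exI[of ?P])
next
  assume "\<exists>f. ?P f"
  then obtain f where P: "?P f" by (rule exE)
  then have f0: "f 0 = Suc 0" by (rule conjunct1)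
  have f: "\<exists>s. f j = Suc s \<and> (\<exists>t. f (Suc j) = Suc t \<and>
     (\<exists>m. t = Suc (prod_encode (m, s))) \<and> strategy_node G H n0 t)" for j by (rule P[THEN conjunct2, THEN spec])
  define c where "c j = f j - 1" for j
  have c0: "c 0 = 0" by (simp add: c_def f0)
  have cS: "\<exists>m. c (Suc j) = Suc (prod_encode (m, c j))" "strategy_node G H n0 (c (Suc j))" for j
  proof -
    obtain s t m where "f j = Suc s" "f (Suc j) = Suc t" "t = Suc (prod_encode (m, s))" "strategy_node G H n0 t"
      using f[of j] by (elim exE conjE)
    then show "\<exists>m. c (Suc j) = Suc (prod_encode (m, c j))" "strategy_node G H n0 (c (Suc j))"
      by (auto simp: c_def)
  qed
  obtain h where h: "\<And>j. c (Suc j) = Suc (prod_encode (h j, c j))" using choice[of "\<lambda>j m. c (Suc j) = Suc (prod_encode (m, c j))"] cS(1) by blast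
  have cl: "c j = list_encode (rev (map h [0..<j]))" for j
    by (induction j) (simp_all add: c0 h)
  have lk: "lookup (c j) k v \<longleftrightarrow> k < j \<and> v = h k" for j k v
    by (auto simp: lookup_def cl)
  have sn: "(n = n0 \<longrightarrow> \<not> h k = 0) \<and> (\<forall>b. h k = Suc b \<longrightarrow> G n a b \<or> H n a b \<and>
      (\<forall>k' v' a'. k' < Suc j \<and> v' = h k' \<longrightarrow> k' = prod_encode (b, a') \<longrightarrow> \<not> v' = 0))"
    if "k < Suc j" "k = prod_encode (n, a)" for j k n a
    by (rule cS(2)[of j, unfolded strategy_node_def lk, THEN spec, THEN spec, THEN spec, THEN spec, THEN mp, THEN mp])
      (use that in simp_all)
  have *: "(n = n0 \<longrightarrow> \<not> h (prod_encode (n, a)) = 0) \<and>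
      (\<forall>b. h (prod_encode (n, a)) = Suc b \<longrightarrow> G n a b \<or> H n a b \<and> \<not> h (prod_encode (b, a')) = 0)" for n a a'
  proof (intro conjI allI impI)
    let ?k = "prod_encode (n, a)"
    show "\<not> h ?k = 0" if "n = n0" using sn[of ?k ?k n a] that by simp
    fix b assume b: "h ?k = Suc b"
    \<comment> \<open>An initial segment long enough to contain both the reply at
      \<open>(n, a)\<close> and the entry at \<open>(b, a')\<close>, where \<open>b\<close> is the
      position reached by that reply.\<close>
    define j where "j = max ?k (prod_encode (b, a'))"
    have j: "?k < Suc j" "prod_encode (b, a') < Suc j" by (auto simp: j_def)
    show "G n a b \<or> H n a b \<and> \<not> h (prod_encode (b, a')) = 0"
      using sn[OF j(1) refl, THEN conjunct2, THEN spec, THEN mp, OF b] j(2) by blast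
  qed
  show "n0 \<in> gset G H"
  proof (rule gset_coinduct[where V = "{n. \<forall>a. \<not> h (prod_encode (n, a)) = 0}"])
    show "n0 \<in> {n. \<forall>a. \<not> h (prod_encode (n, a)) = 0}" using * by blast
    fix n a assume "n \<in> {n. \<forall>a. \<not> h (prod_encode (n, a)) = 0}"
    then obtain b where b: "h (prod_encode (n, a)) = Suc b" using not0_implies_Suc by blast
    show "\<exists>b. G n a b \<or> H n a b \<and> b \<in> {n. \<forall>a. \<not> h (prod_encode (n, a)) = 0}"
      using *[of n a] b by (intro exI[of _ b]) blast
  qed
qed

lemma computable_strategy_node:
  assumes "computable_rel (\<lambda>x \<rho>. G x (\<lambda>i. \<rho> (Suc (Suc (Suc i)))) (\<rho> 0) (\<rho> (Suc 0)) (\<rho> (Suc (Suc 0))))"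
    and "computable_rel (\<lambda>x \<rho>. H x (\<lambda>i. \<rho> (Suc (Suc (Suc i)))) (\<rho> 0) (\<rho> (Suc 0)) (\<rho> (Suc (Suc 0))))"
  shows "computable_rel (\<lambda>x \<rho>. strategy_node (G x (\<lambda>l. \<rho> (\<sigma> l))) (H x (\<lambda>l. \<rho> (\<sigma> l))) (\<rho> i) (\<rho> j))"
proof -
  have ren: "computable_rel (\<lambda>x \<rho>. G x (\<lambda>l. \<rho> (\<sigma> l)) (\<rho> n) (\<rho> a) (\<rho> b))" if
    "computable_rel (\<lambda>x \<rho>. G x (\<lambda>i. \<rho> (Suc (Suc (Suc i)))) (\<rho> 0) (\<rho> (Suc 0)) (\<rho> (Suc (Suc 0))))"
    for G :: "nat set \<Rightarrow> (nat \<Rightarrow> nat) \<Rightarrow> nat \<Rightarrow> nat \<Rightarrow> nat \<Rightarrow> bool" and \<sigma> n a b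
    using computable_ren[OF that, of "case_nat n (case_nat a (case_nat b \<sigma>))"] by simp
  show ?thesis unfolding strategy_node_def
    by (intro computable_intros computable_lookup computable_pair computable_zero ren[OF assms(1)] ren[OF assms(2)])
qed

text \<open>A node contains its parent as a component of a pair, so parents are smaller and unique,
  as \<open>computable_path\<close> requires.\<close>

lemma computable_gset:
  assumes "computable_rel (\<lambda>x \<rho>. G x (\<lambda>i. \<rho> (Suc (Suc (Suc i)))) (\<rho> 0) (\<rho> (Suc 0)) (\<rho> (Suc (Suc 0))))"
    and "computable_rel (\<lambda>x \<rho>. H x (\<lambda>i. \<rho> (Suc (Suc (Suc i)))) (\<rho> 0) (\<rho> (Suc 0)) (\<rho> (Suc (Suc 0))))"
  shows "computable_rel (\<lambda>x \<rho>. \<rho> j \<in> gset (G x \<rho>) (H x \<rho>))"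
  unfolding gset_iff_path
proof (rule computable_path)
  show "computable_rel (\<lambda>x \<rho>. \<exists>s. \<rho> 0 = Suc s \<and> (\<exists>t. \<rho> (Suc 0) = Suc t \<and>
     (\<exists>m. t = Suc (prod_encode (m, s))) \<and> strategy_node (G x (\<lambda>i. \<rho> (Suc (Suc i)))) (H x (\<lambda>i. \<rho> (Suc (Suc i)))) (\<rho> (Suc (Suc j))) t))"
    by (intro computable_intros computable_Cons computable_strategy_node assms)
  fix x :: "nat set" and \<rho> :: "nat \<Rightarrow> nat" and s t
  assume st: "\<exists>s'. s = Suc s' \<and> (\<exists>t'. t = Suc t' \<and>
     (\<exists>m. t' = Suc (prod_encode (m, s'))) \<and> strategy_node (G x \<rho>) (H x \<rho>) (\<rho> j) t')"
  then obtain s' m where s: "s = Suc s'" "t = Suc (Suc (prod_encode (m, s')))" by blast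
  then show "s < t" using le_prod_encode_2[of s' m] by simp
  fix r assume "\<exists>s'. r = Suc s' \<and> (\<exists>t'. t = Suc t' \<and>
     (\<exists>m. t' = Suc (prod_encode (m, s'))) \<and> strategy_node (G x \<rho>) (H x \<rho>) (\<rho> j) t')"
  then obtain r' m' where "r = Suc r'" "t = Suc (Suc (prod_encode (m', r')))" by blast
  then show "s = r" using s by simp
qed

text \<open>Unlike for \<^const>\<open>computable_rel\<close>, one can argue by induction on the construction; this is what the
  computation of the forcing relation needs.\<close>

inductive definable :: "orel \<Rightarrow> bool" where
  base: "computable_rel (\<lambda>x. R) \<Longrightarrow> definable (\<lambda>x. R)"
| mem: "definable (\<lambda>x \<rho>. \<rho> i \<in> x)"
| neg: "definable R \<Longrightarrow> definable (\<lambda>x \<rho>. \<not> R x \<rho>)"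
| conj: "definable R \<Longrightarrow> definable S \<Longrightarrow> definable (\<lambda>x \<rho>. R x \<rho> \<and> S x \<rho>)"
| ex: "definable (\<lambda>x \<rho>. \<phi> x (\<lambda>i. \<rho> (Suc i)) (\<rho> 0)) \<Longrightarrow> definable (\<lambda>x \<rho>. \<exists>n. \<phi> x \<rho> n)"
| ren: "definable R \<Longrightarrow> definable (\<lambda>x \<rho>. R x (\<lambda>i. \<rho> (\<sigma> i)))"
| game: "definable (\<lambda>x \<rho>. G x (\<lambda>i. \<rho> (Suc (Suc (Suc i)))) (\<rho> 0) (\<rho> (Suc 0)) (\<rho> (Suc (Suc 0)))) \<Longrightarrow>
    definable (\<lambda>x \<rho>. H x (\<lambda>i. \<rho> (Suc (Suc (Suc i)))) (\<rho> 0) (\<rho> (Suc 0)) (\<rho> (Suc (Suc 0)))) \<Longrightarrow>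
    definable (\<lambda>x \<rho>. \<rho> j \<in> gset (G x \<rho>) (H x \<rho>))"

lemma definable_computable: "definable R \<Longrightarrow> computable_rel R"
proof (induction rule: definable.induct)
  case (ex \<phi>) show ?case by (rule computable_ex[OF ex.IH])
next
  case (game G H j) show ?case by (rule computable_gset[OF game.IH])
next
  case (ren R \<sigma>) show ?case by (rule computable_ren[OF ren.IH])
next
  case (conj R S) show ?case by (rule computable_and[OF conj.IH])
next
  case (neg R) show ?case by (rule computable_not[OF neg.IH])
next
  case (mem i) show ?case by (rule computable_mem)
qed

lemma definable_disj:
  assumes "definable R" "definable S" shows "definable (\<lambda>x \<rho>. R x \<rho> \<or> S x \<rho>)"
proof -
  have "definable (\<lambda>x \<rho>. \<not> (\<not> R x \<rho> \<and> \<not> S x \<rho>))"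
    by (rule definable.neg, rule definable.conj; rule definable.neg, rule assms)
  then show ?thesis by (simp only: de_Morgan_conj not_not)
qed

lemma definable_imp:
  assumes "definable R" "definable S" shows "definable (\<lambda>x \<rho>. R x \<rho> \<longrightarrow> S x \<rho>)"
  unfolding imp_conv_disj by (rule definable_disj, rule definable.neg, (rule assms)+)

lemma definable_all:
  assumes "definable (\<lambda>x \<rho>. \<phi> x (\<lambda>i. \<rho> (Suc i)) (\<rho> 0))"
  shows "definable (\<lambda>x \<rho>. \<forall>n. \<phi> x \<rho> n)"
proof -
  have "definable (\<lambda>x \<rho>. \<exists>n. \<not> \<phi> x \<rho> n)"
    by (rule definable.ex) (rule definable.neg[OF assms])
  then have "definable (\<lambda>x \<rho>. \<not> (\<exists>n. \<not> \<phi> x \<rho> n))" by (rule definable.neg)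
  then show ?thesis by (simp only: not_ex not_not)
qed

lemmas definable_intros = definable.mem definable.neg definable.conj definable.ex
  definable_disj definable_imp definable_all

lemmas definable_arith = computable_eq[THEN definable.base] computable_Suc[THEN definable.base]
  computable_zero[THEN definable.base] computable_add[THEN definable.base]
  computable_le[THEN definable.base] computable_less[THEN definable.base]
  computable_pair[THEN definable.base] computable_Cons[THEN definable.base]
  computable_nthc[THEN definable.base] computable_length[THEN definable.base]

lemma computable_imp_program:
  assumes "computable_rel (\<lambda>x \<rho>. x \<in> X)"
  shows "\<exists>P. \<forall>x. itrm_outputs P x (if x \<in> X then 1 else 0)"
proof -
  obtain n where n: "computable_at n (\<lambda>x \<rho>. x \<in> X)" using assms computable_rel_def by blast
  obtain Q where Q: "\<And>P x \<rho>. code_at P 0 Q \<Longrightarrow> seg P x (confined 0 (0 + length Q) n \<rho>) (0, \<rho>)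
     (\<lambda>(l, \<sigma>). l = 0 + length Q \<and> (\<forall>i<n. \<sigma> i = \<rho> i) \<and> \<sigma> n = truth (x \<in> X))"
    using fragment[OF n, of "\<lambda>i. i" n 0] by auto
  let ?P = "Q @ [Copy n 0]"
  have c: "code_at ?P 0 Q" "ins ?P (length Q) (Copy n 0)"
    using code_at_whole[of "[]" ?P] by simp_all
  have "itrm_outputs ?P x (if x \<in> X then 1 else 0)" for x
  proof -
    have "seg ?P x (\<lambda>_. True) (0, \<lambda>_. 0) (\<lambda>(l, \<sigma>). l = length Q \<and> \<sigma> n = truth (x \<in> X))"
      by (rule seg_mono[OF Q[OF c(1)]]) auto
    then have s: "seg ?P x (\<lambda>_. True) (0, \<lambda>_. 0) (\<lambda>(l, \<sigma>). l = length ?P \<and> \<sigma> 0 = truth (x \<in> X))"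
    proof (rule seg_segr_trans)
      fix d :: config assume "case d of (l, \<sigma>) \<Rightarrow> l = length Q \<and> \<sigma> n = truth (x \<in> X)"
      then obtain \<sigma> where \<sigma>: "d = (length Q, \<sigma>)" "\<sigma> n = truth (x \<in> X)" by (cases d) auto
      show "segr ?P x (\<lambda>_. True) d (\<lambda>(l, \<sigma>). l = length ?P \<and> \<sigma> 0 = truth (x \<in> X))"
        unfolding \<sigma>(1) by (rule segr_ins[OF c(2)], simp, rule segr_here) (simp add: \<sigma>)
    qed
    obtain C where C: "timeline ?P x C" using timeline_exists by blast
    define b :: omega1 where "b = (LEAST t. True)"
    have "\<forall>s. b \<le> s" unfolding b_def by (intro allI Least_le) simp
    then have Cb: "C b = (0, \<lambda>_. 0)" by (rule C[unfolded timeline_def, THEN conjunct1, THEN spec, THEN mp])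
    obtain t where "case C t of (l, \<sigma>) \<Rightarrow> l = length ?P \<and> \<sigma> 0 = truth (x \<in> X)"
      using s[unfolded seg_def, THEN spec, THEN spec, THEN mp, THEN mp, OF C Cb] by (elim exE conjE)
    then show ?thesis using timeline_outputs[OF C, of t] by (auto simp: truth_def split: prod.splits)
  qed
  then show ?thesis by blast
qed

section \<open>Category and Cohen forcing\<close>

definition cyl :: "nat \<Rightarrow> nat set set" where
  "cyl p = {y. \<forall>i v. nthc p i v \<longrightarrow> (i \<in> y \<longleftrightarrow> v \<noteq> 0)}"

text \<open>Any nonzero entry means membership, so every natural number codes a condition and
  quantifiers over conditions are number quantifiers. Consequently entries are compared only as to
  whether they vanish, by two implications to which the definability rules apply.\<close>

definition ext :: "nat \<Rightarrow> nat \<Rightarrow> bool" where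
  "ext q p \<longleftrightarrow> (\<forall>i v. nthc p i v \<longrightarrow> (\<exists>w. nthc q i w \<and> (v = 0 \<longrightarrow> w = 0) \<and> (w = 0 \<longrightarrow> v = 0)))"

definition approx :: "nat set \<Rightarrow> nat \<Rightarrow> nat" where
  "approx y n = list_encode (map (\<lambda>i. if i \<in> y then 1 else 0) [0..<n])"

lemma nthc_approx: "nthc (approx y n) i v \<longleftrightarrow> i < n \<and> v = (if i \<in> y then 1 else 0)"
  by (auto simp: nthc_def approx_def)

lemma nthc_unique: "nthc p i v \<Longrightarrow> nthc p i w \<Longrightarrow> v = w" by (simp add: nthc_def)

lemma ext_refl: "ext p p" by (auto simp: ext_def)

lemma ext_trans: "ext r q \<Longrightarrow> ext q p \<Longrightarrow> ext r p"
  unfolding ext_def by meson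

lemma ext_cyl: "ext q p \<Longrightarrow> y \<in> cyl q \<Longrightarrow> y \<in> cyl p"
  unfolding ext_def cyl_def mem_Collect_eq by (metis (full_types))

lemma in_cyl_approx: "y \<in> cyl (approx y n)" by (simp add: cyl_def nthc_approx)

lemma ext_approx: "y \<in> cyl p \<Longrightarrow> length (list_decode p) \<le> n \<Longrightarrow> ext (approx y n) p"
  unfolding ext_def nthc_approx by (auto simp: cyl_def nthc_def)

lemma common_ext:
  assumes "y \<in> cyl p" "y \<in> cyl q"
  obtains r where "ext r p" "ext r q" "y \<in> cyl r"
  using assms ext_approx[of y _ "max (length (list_decode p)) (length (list_decode q))"] in_cyl_approx
    that by (metis max.cobounded1 max.cobounded2)

section \<open>Meager sets in terms of cylinders\<close>

definition nwd :: "nat set set \<Rightarrow> bool" where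
  "nwd F \<longleftrightarrow> (\<forall>p. \<exists>q. ext q p \<and> cyl q \<inter> F = {})"

text \<open>Covering, where \<open>meager\<close> asks for equality, makes closure under subsets
  immediate; \<open>meager_reals_iff\<close> shows that the two notions agree.\<close>

definition mgr :: "nat set set \<Rightarrow> bool" where
  "mgr A \<longleftrightarrow> (\<exists>F. (\<forall>n :: nat. nwd (F n)) \<and> A \<subseteq> (\<Union>n. F n))"

lemma mgr_mono: "mgr B \<Longrightarrow> A \<subseteq> B \<Longrightarrow> mgr A"
  unfolding mgr_def by (meson subset_trans)

lemma nwd_mgr: "nwd A \<Longrightarrow> mgr A"
  unfolding mgr_def by (rule exI[of _ "\<lambda>_. A"]) simp

lemma mgr_UN_nat:
  assumes "\<And>n :: nat. mgr (A n)" shows "mgr (\<Union>n. A n)"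
proof -
  have "\<forall>n. \<exists>F. (\<forall>m :: nat. nwd (F m)) \<and> A n \<subseteq> (\<Union>m. F m)" using assms by (simp add: mgr_def)
  then obtain F where F: "\<And>n m. nwd (F n m)" "\<And>n. A n \<subseteq> (\<Union>m :: nat. F n m)" by metis
  show ?thesis unfolding mgr_def
  proof (intro exI[of _ "\<lambda>k. case prod_decode k of (n, m) \<Rightarrow> F n m"] conjI allI)
    show "nwd (case prod_decode k of (n, m) \<Rightarrow> F n m)" for k using F(1) by (simp split: prod.split)
    show "(\<Union>n. A n) \<subseteq> (\<Union>k. case prod_decode k of (n, m) \<Rightarrow> F n m)"
    proof
      fix y assume "y \<in> (\<Union>n. A n)"
      then obtain n m where "y \<in> F n m" using F(2) by blast
      then show "y \<in> (\<Union>k. case prod_decode k of (n, m) \<Rightarrow> F n m)"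
        by (intro UN_I[of "prod_encode (n, m)"]) simp_all
    qed
  qed
qed

lemma mgr_empty: "mgr {}" by (rule nwd_mgr) (auto simp: nwd_def intro: ext_refl)

lemma mgr_UN: "(\<And>i :: 'i :: countable. i \<in> I \<Longrightarrow> mgr (A i)) \<Longrightarrow> mgr (\<Union>i\<in>I. A i)"
proof -
  assume A: "\<And>i :: 'i. i \<in> I \<Longrightarrow> mgr (A i)"
  have "mgr (\<Union>n. if \<exists>i\<in>I. to_nat i = n then A (from_nat n) else {})"
    by (rule mgr_UN_nat) (auto simp: mgr_empty A)
  then show ?thesis by (rule mgr_mono) (fastforce intro!: exI[of _ "to_nat _"])
qed

lemma mgr_Un: "mgr A \<Longrightarrow> mgr B \<Longrightarrow> mgr (A \<union> B)"
  using mgr_UN[of UNIV "\<lambda>b. if b then A else B"] by (simp add: UNIV_bool Un_commute)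

text \<open>The Baire category theorem: \<open>p\<close> is extended step by step so as to leave
  each \<open>F n\<close>, and the conditions obtained have a common point.\<close>

lemma not_mgr_cyl: "\<not> mgr (cyl p)"
proof
  assume "mgr (cyl p)"
  then obtain F where F: "\<And>n :: nat. nwd (F n)" "cyl p \<subseteq> (\<Union>n. F n)" by (auto simp: mgr_def)
  have "\<forall>n q. \<exists>r. ext r q \<and> cyl r \<inter> F n = {}" using F(1) by (simp add: nwd_def)
  then obtain g where g: "\<And>n q. ext (g n q) q" "\<And>n q. cyl (g n q) \<inter> F n = {}" by metis
  define c where "c = rec_nat p g"
  have c: "c 0 = p" "c (Suc n) = g n (c n)" for n by (simp_all add: c_def)
  have mono: "m \<le> n \<Longrightarrow> ext (c n) (c m)" for m n
    by (induction n) (auto simp: le_Suc_eq ext_refl c(2) intro: ext_trans[OF g(1)])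
  \<comment> \<open>The common point; numbers that no condition decides are left out.\<close>
  define y where "y = {i. \<exists>n v. nthc (c n) i v \<and> v \<noteq> 0}"
  have "y \<in> cyl (c n)" for n
    unfolding cyl_def mem_Collect_eq
  proof (intro allI impI)
    fix i v assume v: "nthc (c n) i v"
    show "i \<in> y \<longleftrightarrow> v \<noteq> 0"
    proof
      assume "i \<in> y"
      then obtain m w where w: "nthc (c m) i w" "w \<noteq> 0" by (auto simp: y_def)
      obtain v' where v': "nthc (c (max m n)) i v'" "v' = 0 \<longrightarrow> v = 0" "v = 0 \<longrightarrow> v' = 0"
        using mono[of n "max m n"] v by (auto simp: ext_def)
      obtain w' where w': "nthc (c (max m n)) i w'" "w' = 0 \<longrightarrow> w = 0"
        using mono[of m "max m n"] w by (auto simp: ext_def)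
      show "v \<noteq> 0" using nthc_unique[OF v'(1) w'(1)] v' w' w by auto
    qed (use v in \<open>auto simp: y_def\<close>)
  qed
  then have "y \<in> cyl p" "\<And>n. y \<notin> F n" using c g(2) by (metis, metis disjoint_iff)
  then show False using F(2) by blast
qed

text \<open>Cohen forcing read as category: \<open>A\<close> is comeager in the cylinder. For the
  empty condition this is a statement about meagerness itself, which is how \<open>Z\<close> will be
  decided.\<close>

definition forces :: "nat set set \<Rightarrow> nat \<Rightarrow> bool" where
  "forces A p \<longleftrightarrow> mgr (cyl p - A)"

lemma forces_ext: "forces A p \<Longrightarrow> ext q p \<Longrightarrow> forces A q"
  unfolding forces_def by (erule mgr_mono) (auto dest: ext_cyl)

lemma forces_mono: "forces A p \<Longrightarrow> A \<subseteq> B \<Longrightarrow> forces B p"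
  unfolding forces_def by (erule mgr_mono) auto

lemma forces_consistent: "forces A p \<Longrightarrow> \<not> forces (- A) p"
proof
  assume "forces A p" "forces (- A) p"
  then have "mgr ((cyl p - A) \<union> (cyl p - - A))" unfolding forces_def by (rule mgr_Un)
  then have "mgr (cyl p)" by (rule mgr_mono) auto
  then show False using not_mgr_cyl by blast
qed

text \<open>The cylinders of the conditions forcing \<open>A\<close> cover \<open>cyl p\<close> up
  to a nowhere dense set, and there are only countably many conditions.\<close>

lemma forces_dense:
  assumes "\<And>q. ext q p \<Longrightarrow> \<exists>r. ext r q \<and> forces A r"
  shows "forces A p"
proof -
  define D where "D = {r. forces A r}"
  define N where "N = cyl p - (\<Union>r\<in>D. cyl r)"
  have "nwd N" unfolding nwd_def
  proof
    fix s
    show "\<exists>t. ext t s \<and> cyl t \<inter> N = {}"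
    proof (cases "cyl s \<inter> cyl p = {}")
      case True
      then show ?thesis using ext_refl[of s] by (intro exI[of _ s]) (auto simp: N_def)
    next
      case False
      then obtain y where "y \<in> cyl s" "y \<in> cyl p" by blast
      then obtain q where q: "ext q s" "ext q p" by (rule common_ext)
      obtain r where r: "ext r q" "forces A r" using assms[OF q(2)] by blast
      then show ?thesis using ext_trans[OF r(1) q(1)] by (intro exI[of _ r]) (auto simp: N_def D_def)
    qed
  qed
  moreover have "mgr (\<Union>r\<in>D. cyl r - A)" by (rule mgr_UN) (simp add: D_def forces_def)
  ultimately have "mgr (N \<union> (\<Union>r\<in>D. cyl r - A))" using mgr_Un nwd_mgr by blast
  then show ?thesis unfolding forces_def by (rule mgr_mono) (auto simp: N_def)
qed

lemma forces_UNIV: "forces UNIV p" by (simp add: forces_def mgr_empty)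

lemma forces_INT: "(\<And>n :: nat. forces (A n) p) \<Longrightarrow> forces (\<Inter>n. A n) p"
  unfolding forces_def by (rule mgr_mono[OF mgr_UN_nat[of "\<lambda>n. cyl p - A n"]]) auto

lemma forces_Int: "forces (A \<inter> B) p \<longleftrightarrow> forces A p \<and> forces B p"
proof
  assume "forces A p \<and> forces B p"
  then have "mgr ((cyl p - A) \<union> (cyl p - B))" unfolding forces_def by (intro mgr_Un) auto
  then show "forces (A \<inter> B) p" unfolding forces_def by (rule mgr_mono) auto
qed (auto intro: forces_mono)

text \<open>The Baire property in local form. It makes forcing of a complement equivalent to the
  absence of extensions forcing the set.\<close>

definition baire :: "nat set set \<Rightarrow> bool" where
  "baire A \<longleftrightarrow> (\<forall>p. forces A p \<or> (\<exists>q. ext q p \<and> forces (- A) q))"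

lemma forces_Compl:
  assumes "baire A" shows "forces (- A) p \<longleftrightarrow> (\<forall>q. ext q p \<longrightarrow> \<not> forces A q)"
proof
  assume "forces (- A) p"
  then show "\<forall>q. ext q p \<longrightarrow> \<not> forces A q" using forces_ext forces_consistent by blast
next
  assume *: "\<forall>q. ext q p \<longrightarrow> \<not> forces A q"
  show "forces (- A) p" by (rule forces_dense) (use * assms baire_def in blast)
qed

text \<open>From left to right the Baire property is used: a condition none of whose extensions
  forces any \<open>A n\<close> forces all the complements, hence the complement of the
  union.\<close>

lemma forces_UN:
  assumes "\<And>n :: nat. baire (A n)"
  shows "forces (\<Union>n. A n) p \<longleftrightarrow> (\<forall>q. ext q p \<longrightarrow> (\<exists>r. ext r q \<and> (\<exists>n. forces (A n) r)))"
proof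
  assume f: "forces (\<Union>n. A n) p"
  show "\<forall>q. ext q p \<longrightarrow> (\<exists>r. ext r q \<and> (\<exists>n. forces (A n) r))"
  proof (intro allI impI, rule ccontr)
    fix q assume q: "ext q p" and "\<not> (\<exists>r. ext r q \<and> (\<exists>n. forces (A n) r))"
    then have "forces (- A n) q" for n using forces_Compl[OF assms] by blast
    then have "forces (\<Inter>n. - A n) q" by (rule forces_INT)
    moreover have "(\<Inter>n. - A n) = - (\<Union>n. A n)" by blast
    ultimately show False using forces_ext[OF f q] forces_consistent by metis
  qed
next
  assume *: "\<forall>q. ext q p \<longrightarrow> (\<exists>r. ext r q \<and> (\<exists>n. forces (A n) r))"
  show "forces (\<Union>n. A n) p"
  proof (rule forces_dense)
    fix q assume "ext q p"
    then obtain r n where "ext r q" "forces (A n) r" using * by blast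
    then show "\<exists>r. ext r q \<and> forces (\<Union>n. A n) r" using forces_mono[of "A n" r "\<Union>n. A n"] by blast
  qed
qed

lemma baire_Compl:
  assumes "baire A" shows "baire (- A)"
  unfolding baire_def
proof
  fix p show "forces (- A) p \<or> (\<exists>q. ext q p \<and> forces (- (- A)) q)"
    using forces_Compl[OF assms, of p] by auto
qed

lemma baire_Int:
  assumes "baire A" "baire B" shows "baire (A \<inter> B)"
  unfolding baire_def
proof
  fix p
  have "\<exists>q. ext q p \<and> forces (- (A \<inter> B)) q" if C: "\<not> forces C p" "baire C" "A \<inter> B \<subseteq> C" for C
  proof -
    obtain q where "ext q p" "forces (- C) q" using C(1,2) by (auto simp: baire_def)
    then show ?thesis using forces_mono[of "- C" q "- (A \<inter> B)"] C(3) by blast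
  qed
  from this[of A] this[of B] show "forces (A \<inter> B) p \<or> (\<exists>q. ext q p \<and> forces (- (A \<inter> B)) q)"
    using assms by (auto simp: forces_Int)
qed

lemma baire_UN:
  assumes A: "\<And>n :: nat. baire (A n)" shows "baire (\<Union>n. A n)"
  unfolding baire_def
proof (intro allI disjCI)
  fix p assume *: "\<nexists>q. ext q p \<and> forces (- (\<Union>n. A n)) q"
  show "forces (\<Union>n. A n) p" unfolding forces_UN[OF A]
  proof (intro allI impI, rule ccontr)
    fix q assume q: "ext q p" "\<not> (\<exists>r. ext r q \<and> (\<exists>n. forces (A n) r))"
    then have "forces (- A n) q" for n using forces_Compl[OF A] by blast
    then have "forces (\<Inter>n. - A n) q" by (rule forces_INT)
    moreover have "(\<Inter>n. - A n) = - (\<Union>n. A n)" by blast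
    ultimately have "forces (- (\<Union>n. A n)) q" by (simp only:)
    then show False using * q(1) by blast
  qed
qed

text \<open>The forcing relation for the game operator is again given by a game, in which the players also
  extend conditions.\<close>

definition force_win :: "(nat set \<Rightarrow> nat \<Rightarrow> nat \<Rightarrow> nat \<Rightarrow> bool) \<Rightarrow> nat \<Rightarrow> nat \<Rightarrow> nat \<Rightarrow> bool" where
  "force_win G N M K \<longleftrightarrow> (\<exists>q n q' a q'' b. N = prod_encode (q, n) \<and> M = prod_encode (q', a) \<and>
     K = prod_encode (q'', b) \<and> (\<not> ext q' q \<or> ext q'' q' \<and> forces {y. G y n a b} q''))"

definition force_cont :: "(nat set \<Rightarrow> nat \<Rightarrow> nat \<Rightarrow> nat \<Rightarrow> bool) \<Rightarrow> nat \<Rightarrow> nat \<Rightarrow> nat \<Rightarrow> bool" where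
  "force_cont H N M K \<longleftrightarrow> (\<exists>q n q' a q'' b. N = prod_encode (q, n) \<and> M = prod_encode (q', a) \<and>
     K = prod_encode (q'', b) \<and> ext q'' q' \<and> forces {y. H y n a b} q'')"

text \<open>\<open>sound\<close>: apart from a meager set, every point in the cylinder of a good
  condition can follow the prescribed replies, since conditions, positions and moves are countable
  in number. \<open>complete\<close>: the pairs of a condition and a position whose loss is forced
  by no extension are closed under the game. As \<open>complete\<close> only assumes that the
  complement is nowhere forced below, the Baire property of the new set comes out as well.\<close>

lemma force_gset:
  assumes bG: "\<And>n a b. baire {y. G y n a b}" and bH: "\<And>n a b. baire {y. H y n a b}"
  shows "forces {y. n \<in> gset (G y) (H y)} p \<longleftrightarrow> prod_encode (p, n) \<in> gset (force_win G) (force_cont H)" (is ?A)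
    and "baire {y. n \<in> gset (G y) (H y)}" (is ?B)
proof -
  define good where "good q n \<longleftrightarrow> prod_encode (q, n) \<in> gset (force_win G) (force_cont H)" for q n
  define A where "A n = {y. n \<in> gset (G y) (H y)}" for n
  have good: "\<exists>q'' b. ext q'' q' \<and> (forces {y. G y n a b} q'' \<or> forces {y. H y n a b} q'' \<and> good q'' b)"
    if gq: "good q n" "ext q' q" for q n q' a
  proof -
    obtain K where K: "force_win G (prod_encode (q, n)) (prod_encode (q', a)) K \<or>
       force_cont H (prod_encode (q, n)) (prod_encode (q', a)) K \<and> K \<in> gset (force_win G) (force_cont H)"
      using gq(1)[unfolded good_def, THEN gset_unfold[THEN iffD1], THEN spec, of "prod_encode (q', a)"] by blast
    obtain q'' b where "K = prod_encode (q'', b)" by (metis prod_decode_inverse surj_pair)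
    then show ?thesis using K gq(2) by (auto simp: force_win_def force_cont_def good_def)
  qed
  have sound: "forces (A n0) p" if g0: "good p n0" for p n0
  proof -
    define U where "U n = (\<Union>q\<in>{q. good q n}. cyl q)" for n
    define S where "S n a = {q. \<exists>b. forces {y. G y n a b} q \<or> forces {y. H y n a b} q \<and> good q b}" for n a
    define E where "E n a = (\<Union>q\<in>S n a. cyl q)" for n a
    \<comment> \<open>The conditions that contain an answer to the move \<open>a\<close> are dense
      below every good condition, so almost every point of \<open>U n\<close> meets one of
      them.\<close>
    have "nwd (U n - E n a)" for n a unfolding nwd_def
    proof
      fix s
      show "\<exists>t. ext t s \<and> cyl t \<inter> (U n - E n a) = {}"
      proof (cases "cyl s \<inter> (U n - E n a) = {}")
        case True then show ?thesis using ext_refl by blast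
      next
        case False
        then obtain y q where y: "y \<in> cyl s" "y \<in> cyl q" "good q n" by (auto simp: U_def)
        then obtain q' where q': "ext q' s" "ext q' q" using common_ext[of y s q] by blast
        obtain q'' where "ext q'' q'" "q'' \<in> S n a" using good[OF y(3) q'(2), of a] by (auto simp: S_def)
        then show ?thesis using ext_trans[of q'' q' s] q' by (intro exI[of _ q'']) (auto simp: E_def)
      qed
    qed
    then have m1: "mgr (\<Union>n. \<Union>a. U n - E n a)" by (intro mgr_UN nwd_mgr)
    \<comment> \<open>The points at which a forced instance fails: a meager set for each of
      countably many instances.\<close>
    define M2 where "M2 G = (\<Union>(q, n, a, b)\<in>{(q, n, a, b). forces {y. G y n a b} q}. cyl q - {y. G y n a b})"
      for G :: "nat set \<Rightarrow> nat \<Rightarrow> nat \<Rightarrow> nat \<Rightarrow> bool"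
    have m2: "mgr (M2 G)" for G unfolding M2_def by (rule mgr_UN) (auto simp: forces_def)
    have "mgr ((\<Union>n. \<Union>a. U n - E n a) \<union> (M2 G \<union> M2 H))" by (intro mgr_Un m1 m2)
    moreover have "cyl p - A n0 \<subseteq> (\<Union>n. \<Union>a. U n - E n a) \<union> (M2 G \<union> M2 H)"
    proof
      fix y assume y: "y \<in> cyl p - A n0"
      show "y \<in> (\<Union>n. \<Union>a. U n - E n a) \<union> (M2 G \<union> M2 H)"
      proof (rule ccontr)
        assume "\<not> ?thesis"
        then have n1: "\<And>n a. y \<in> U n \<Longrightarrow> y \<in> E n a" and n2: "y \<notin> M2 G" "y \<notin> M2 H" by auto
        have fG: "G y n a b" if "y \<in> cyl q" "forces {y. G y n a b} q" for q n a b
        proof (rule ccontr)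
          assume "\<not> G y n a b"
          then have "y \<in> M2 G" unfolding M2_def using that by (intro UN_I[of "(q, n, a, b)"]) auto
          then show False using n2 by simp
        qed
        have fH: "H y n a b" if "y \<in> cyl q" "forces {y. H y n a b} q" for q n a b
        proof (rule ccontr)
          assume "\<not> H y n a b"
          then have "y \<in> M2 H" unfolding M2_def using that by (intro UN_I[of "(q, n, a, b)"]) auto
          then show False using n2 by simp
        qed
        have "n0 \<in> gset (G y) (H y)"
        proof (rule gset_coinduct[where V = "{n. y \<in> U n}"])
          show "n0 \<in> {n. y \<in> U n}" using y g0 by (auto simp: U_def)
          fix n a assume "n \<in> {n. y \<in> U n}"
          then obtain q where q: "q \<in> S n a" "y \<in> cyl q" using n1[of n a] by (auto simp: E_def)
          then obtain b where "forces {y. G y n a b} q \<or> forces {y. H y n a b} q \<and> good q b"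
            by (auto simp: S_def)
          then show "\<exists>b. G y n a b \<or> H y n a b \<and> b \<in> {n. y \<in> U n}"
            using fG[OF q(2), of n a b] fH[OF q(2), of n a b] q(2) by (intro exI[of _ b]) (auto simp: U_def)
        qed
        then show False using y by (simp add: A_def)
      qed
    qed
    ultimately show ?thesis unfolding forces_def by (rule mgr_mono)
  qed
  have complete: "good p n0" if np: "\<nexists>q. ext q p \<and> forces (- A n0) q" for p n0
    unfolding good_def
  proof (rule gset_coinduct[where V = "{N. \<exists>q n. N = prod_encode (q, n) \<and> (\<nexists>r. ext r q \<and> forces (- A n) r)}"])
    let ?V = "{N. \<exists>q n. N = prod_encode (q, n) \<and> (\<nexists>r. ext r q \<and> forces (- A n) r)}"
    show "prod_encode (p, n0) \<in> ?V" using np by blast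
    fix N M assume "N \<in> ?V"
    then obtain q n where N: "N = prod_encode (q, n)" and nV: "\<nexists>r. ext r q \<and> forces (- A n) r" by blast
    obtain q' a where M: "M = prod_encode (q', a)" by (metis prod_decode_inverse surj_pair)
    show "\<exists>K. force_win G N M K \<or> force_cont H N M K \<and> K \<in> ?V"
    proof (cases "ext q' q")
      \<comment> \<open>By the definition of \<open>force_win\<close>, a first player who does not
        extend the condition loses at once.\<close>
      case False
      then show ?thesis unfolding force_win_def N M by blast
    next
      case True
      have "\<exists>q'' b. ext q'' q' \<and> (forces {y. G y n a b} q'' \<or> forces {y. H y n a b} q'' \<and> (\<nexists>r. ext r q'' \<and> forces (- A b) r))"
      proof (rule ccontr)
        \<comment> \<open>Without a suitable reply, \<open>q'\<close> forces that every
          \<open>b\<close> fails against the move \<open>a\<close>, and hence that \<open>n\<close>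
          is lost.\<close>
        assume neg: "\<not> ?thesis"
        have 1: "forces (- {y. G y n a b}) q'" for b
          unfolding forces_Compl[OF bG] using neg by blast
        have 2: "forces (- ({y. H y n a b} \<inter> A b)) q'" for b
        proof (rule forces_dense)
          fix q'' assume q'': "ext q'' q'"
          show "\<exists>r. ext r q'' \<and> forces (- ({y. H y n a b} \<inter> A b)) r"
          proof (cases "forces {y. H y n a b} q''")
            case True
            then obtain r where "ext r q''" "forces (- A b) r" using neg q'' by blast
            then show ?thesis using forces_mono[of "- A b" r "- ({y. H y n a b} \<inter> A b)"] by blast
          next
            case False
            then obtain r where "ext r q''" "forces (- {y. H y n a b}) r" using bH baire_def by blast
            then show ?thesis using forces_mono[of "- {y. H y n a b}" r "- ({y. H y n a b} \<inter> A b)"] by blast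
          qed
        qed
        have "forces (\<Inter>b. - {y. G y n a b} \<inter> - ({y. H y n a b} \<inter> A b)) q'"
          by (rule forces_INT) (use 1 2 forces_Int in blast)
        moreover have "(\<Inter>b. - {y. G y n a b} \<inter> - ({y. H y n a b} \<inter> A b)) \<subseteq> - A n"
        proof
          fix y assume y: "y \<in> (\<Inter>b. - {y. G y n a b} \<inter> - ({y. H y n a b} \<inter> A b))"
          show "y \<in> - A n"
          proof
            assume "y \<in> A n"
            then obtain b where "G y n a b \<or> H y n a b \<and> b \<in> gset (G y) (H y)"
              unfolding A_def mem_Collect_eq by (subst (asm) gset_unfold) blast
            then show False using y by (auto simp: A_def)
          qed
        qed
        ultimately have "forces (- A n) q'" by (rule forces_mono)
        then show False using nV True by blast
      qed
      then obtain q'' b where "ext q'' q'" "forces {y. G y n a b} q'' \<or> forces {y. H y n a b} q'' \<and> (\<nexists>r. ext r q'' \<and> forces (- A b) r)"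
        by blast
      then show ?thesis unfolding force_win_def force_cont_def N M by blast
    qed
  qed
  have "forces (A n) p \<longleftrightarrow> good p n"
  proof
    assume "forces (A n) p"
    then have "\<nexists>q. ext q p \<and> forces (- A n) q" using forces_ext forces_consistent by blast
    then show "good p n" by (rule complete)
  qed (rule sound)
  then show ?A by (simp add: A_def good_def)
  show ?B unfolding baire_def A_def[symmetric] using complete sound by blast
qed

section \<open>Definability of forcing\<close>

lemma definable_ext: "definable (\<lambda>x \<rho>. ext (\<rho> i) (\<rho> j))"
  unfolding ext_def by (intro definable_intros definable_arith)

lemma join_even: "m + m \<in> x \<oplus>\<^sub>J y \<longleftrightarrow> m \<in> x" and join_odd: "Suc (m + m) \<in> x \<oplus>\<^sub>J y \<longleftrightarrow> m \<in> y"
proof -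
  have "m + m = 2 * i \<longleftrightarrow> i = m" "m + m \<noteq> Suc (2 * i)" "Suc (m + m) \<noteq> 2 * i" for i by presburger+
  then show "m + m \<in> x \<oplus>\<^sub>J y \<longleftrightarrow> m \<in> x" "Suc (m + m) \<in> x \<oplus>\<^sub>J y \<longleftrightarrow> m \<in> y"
    by (auto simp: join_def)
qed

lemma forces_mem: "forces {y. m \<in> y} p \<longleftrightarrow> (\<exists>v. nthc p m v \<and> \<not> v = 0)" and baire_mem: "baire {y. m \<in> y}"
proof -
  have a: "\<exists>q. ext q p \<and> forces (- {y. m \<in> y}) q" if no: "\<not> (\<exists>v. nthc p m v \<and> \<not> v = 0)" for p
  proof -
    \<comment> \<open>A point of \<open>cyl p\<close> that omits \<open>m\<close>; a sufficiently
      long initial segment of it extends \<open>p\<close> and decides against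
      \<open>m\<close>.\<close>
    define y where "y = {i. i \<noteq> m \<and> (\<exists>v. nthc p i v \<and> v \<noteq> 0)}"
    have y: "y \<in> cyl p" using no nthc_unique unfolding cyl_def y_def by blast
    define q where "q = approx y (max (Suc m) (length (list_decode p)))"
    have "ext q p" unfolding q_def by (rule ext_approx[OF y]) simp
    moreover have "nthc q m 0" by (simp add: q_def nthc_approx y_def)
    then have "cyl q \<subseteq> - {y. m \<in> y}" by (auto simp: cyl_def)
    then have "forces (- {y. m \<in> y}) q" unfolding forces_def using mgr_mono[OF mgr_empty] by blast
    ultimately show ?thesis by blast
  qed
  have b: "forces {y. m \<in> y} p" if "nthc p m v" "\<not> v = 0" for p v
  proof -
    have "cyl p \<subseteq> {y. m \<in> y}" using that by (auto simp: cyl_def)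
    then show ?thesis unfolding forces_def using mgr_mono[OF mgr_empty] by blast
  qed
  show "forces {y. m \<in> y} p \<longleftrightarrow> (\<exists>v. nthc p m v \<and> \<not> v = 0)"
    using a[of p] b[of p] forces_ext forces_consistent by blast
  show "baire {y. m \<in> y}" unfolding baire_def using a b by blast
qed

lemma forces_const: "forces {y. P} p \<longleftrightarrow> P" and baire_const: "baire {y. P}"
proof -
  have e: "\<not> forces {} p" for p using not_mgr_cyl[of p] by (simp add: forces_def)
  show "forces {y. P} p \<longleftrightarrow> P" using e[of p] forces_UNIV[of p] by (cases P) auto
  show "baire {y. P}" using forces_UNIV ext_refl by (cases P) (auto simp: baire_def)
qed

text \<open>Induction on the construction of \<open>R\<close>. The Baire property is carried along
  because negation, quantifier and game need it for their constituents. Base relations are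
  independent of the oracle, hence forced iff true; membership is answered by \<open>x\<close> on
  even numbers and by the condition on odd ones.\<close>

theorem definable_forces:
  assumes "definable R"
  shows "definable (\<lambda>x \<rho>. forces {y. R (x \<oplus>\<^sub>J y) (\<lambda>i. \<rho> (\<sigma> i))} (\<rho> k))"
    and "baire {y. R (x \<oplus>\<^sub>J y) \<rho>}"
proof -
  \<comment> \<open>In the induction the condition is variable 0 and the other variables are
    shifted; any other arrangement is a renaming.\<close>
  have rnm: "definable (\<lambda>x \<rho>. forces {y. R (x \<oplus>\<^sub>J y) (\<lambda>i. \<rho> (\<sigma> i))} (\<rho> k))"
    if "definable (\<lambda>x \<rho>. forces {y. R (x \<oplus>\<^sub>J y) (\<lambda>i. \<rho> (Suc i))} (\<rho> 0))" for R :: orel and \<sigma> k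
    using definable.ren[OF that, of "case_nat k \<sigma>"] by simp
  have "definable (\<lambda>x \<rho>. forces {y. R (x \<oplus>\<^sub>J y) (\<lambda>i. \<rho> (Suc i))} (\<rho> 0)) \<and> (\<forall>x \<rho>. baire {y. R (x \<oplus>\<^sub>J y) \<rho>})"
    using assms
  proof (induction rule: definable.induct)
    case (base R)
    have "definable (\<lambda>x \<rho>. R (\<lambda>i. \<rho> (Suc i)))"
      by (rule definable.base, rule computable_ren[of "\<lambda>x. R" Suc], rule base)
    then show ?case unfolding forces_const using baire_const by blast
  next
    case (mem i)
    have e: "m + m = m' + m' \<longleftrightarrow> m' = m" "m + m \<noteq> Suc (m' + m')" "Suc (m + m) \<noteq> m' + m'" for m m' :: nat
      by presburger+
    have par: "\<exists>m. n = m + m \<or> n = Suc (m + m)" for n :: nat by presburger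
    have b: "baire {y. n \<in> x \<oplus>\<^sub>J y}" for n x
    proof -
      obtain m where "n = m + m \<or> n = Suc (m + m)" using par by blast
      then show ?thesis using baire_const[of "m \<in> x"] baire_mem[of m] by (auto simp: join_even join_odd)
    qed
    have f: "forces {y. n \<in> x \<oplus>\<^sub>J y} p \<longleftrightarrow> (\<exists>m. n = m + m \<and> m \<in> x \<or> (\<exists>k. k = m + m \<and> n = Suc k \<and> (\<exists>v. nthc p m v \<and> \<not> v = 0)))" for n x p
    proof -
      obtain m where "n = m + m \<or> n = Suc (m + m)" using par by blast
      then show ?thesis
      proof
        assume n: "n = m + m"
        have "{y. n \<in> x \<oplus>\<^sub>J y} = {y. m \<in> x}" by (simp only: n join_even)
        then have "forces {y. n \<in> x \<oplus>\<^sub>J y} p \<longleftrightarrow> m \<in> x" by (simp only: forces_const)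
        then show ?thesis by (simp add: n e)
      next
        assume n: "n = Suc (m + m)"
        have "{y. n \<in> x \<oplus>\<^sub>J y} = {y. m \<in> y}" by (simp only: n join_odd)
        then have "forces {y. n \<in> x \<oplus>\<^sub>J y} p \<longleftrightarrow> (\<exists>v. nthc p m v \<and> \<not> v = 0)" by (simp only: forces_mem)
        then show ?thesis by (simp add: n e)
      qed
    qed
    show ?case unfolding f by (intro conjI allI b definable_intros definable_arith)
  next
    case (neg R)
    have b: "baire {y. R (x \<oplus>\<^sub>J y) \<rho>}" for x \<rho> using neg.IH by blast
    have c: "{y. \<not> R (x \<oplus>\<^sub>J y) \<rho>} = - {y. R (x \<oplus>\<^sub>J y) \<rho>}" for x \<rho> by blast
    show ?case unfolding c forces_Compl[OF b]
      by (intro conjI allI baire_Compl b definable_intros definable_ext rnm[OF conjunct1[OF neg.IH]])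
  next
    case (conj R S)
    have b: "baire {y. R (x \<oplus>\<^sub>J y) \<rho>}" "baire {y. S (x \<oplus>\<^sub>J y) \<rho>}" for x \<rho> using conj.IH by blast+
    have c: "{y. R (x \<oplus>\<^sub>J y) \<rho> \<and> S (x \<oplus>\<^sub>J y) \<rho>} = {y. R (x \<oplus>\<^sub>J y) \<rho>} \<inter> {y. S (x \<oplus>\<^sub>J y) \<rho>}" for x \<rho> by blast
    show ?case unfolding c forces_Int
      by (intro conjI allI baire_Int b definable.conj conjunct1[OF conj.IH(1)] conjunct1[OF conj.IH(2)])
  next
    case (ex \<phi>)
    have b: "baire {y. \<phi> (x \<oplus>\<^sub>J y) \<rho> n}" for x \<rho> n
      using conjunct2[OF ex.IH, THEN spec, THEN spec, of x "case_nat n \<rho>"] by simp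
    have r: "definable (\<lambda>x \<rho>. forces {y. \<phi> (x \<oplus>\<^sub>J y) (\<lambda>i. \<rho> (\<sigma> i)) (\<rho> a)} (\<rho> k))" for \<sigma> a k
      using rnm[OF conjunct1[OF ex.IH], of "case_nat a \<sigma>" k] by simp
    have c: "{y. \<exists>n. \<phi> (x \<oplus>\<^sub>J y) \<rho> n} = (\<Union>n. {y. \<phi> (x \<oplus>\<^sub>J y) \<rho> n})" for x \<rho> by blast
    show ?case unfolding c forces_UN[OF b]
      by (intro conjI allI baire_UN b definable_intros definable_ext r)
  next
    case (ren R \<sigma>)
    have b: "baire {y. R (x \<oplus>\<^sub>J y) \<rho>}" for x \<rho> using ren.IH by blast
    show ?case by (intro conjI allI b rnm[OF conjunct1[OF ren.IH]])
  next
    case (game G H j)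
    have b: "baire {y. G (x \<oplus>\<^sub>J y) \<rho> n a b}" "baire {y. H (x \<oplus>\<^sub>J y) \<rho> n a b}" for x \<rho> n a b
      using conjunct2[OF game.IH(1), THEN spec, THEN spec, of x "case_nat n (case_nat a (case_nat b \<rho>))"]
        conjunct2[OF game.IH(2), THEN spec, THEN spec, of x "case_nat n (case_nat a (case_nat b \<rho>))"] by simp_all
    have r: "definable (\<lambda>x \<rho>. forces {y. G (x \<oplus>\<^sub>J y) (\<lambda>i. \<rho> (\<sigma> i)) (\<rho> n) (\<rho> a) (\<rho> b)} (\<rho> k))"
      "definable (\<lambda>x \<rho>. forces {y. H (x \<oplus>\<^sub>J y) (\<lambda>i. \<rho> (\<sigma> i)) (\<rho> n) (\<rho> a) (\<rho> b)} (\<rho> k))" for \<sigma> n a b k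
      using rnm[OF conjunct1[OF game.IH(1)], of "case_nat n (case_nat a (case_nat b \<sigma>))" k]
        rnm[OF conjunct1[OF game.IH(2)], of "case_nat n (case_nat a (case_nat b \<sigma>))" k] by simp_all
    note fg = force_gset[of "\<lambda>y. G (x \<oplus>\<^sub>J y) \<rho>" "\<lambda>y. H (x \<oplus>\<^sub>J y) \<rho>" for x \<rho>, OF b]
    \<comment> \<open>The \<open>game\<close> clause applies again: moves are coded pairs of a
      condition and a number, and the forcing of \<open>G\<close> and \<open>H\<close> is definable
      by induction hypothesis.\<close>
    have g: "definable (\<lambda>x \<rho>. \<rho> 0 \<in> gset (force_win (\<lambda>y. G (x \<oplus>\<^sub>J y) (\<lambda>i. \<rho> (Suc (Suc i)))))
        (force_cont (\<lambda>y. H (x \<oplus>\<^sub>J y) (\<lambda>i. \<rho> (Suc (Suc i))))))"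
      by (rule definable.game; unfold force_win_def force_cont_def;
        intro definable_intros definable_arith definable_ext r)
    have "definable (\<lambda>x \<rho>. \<exists>N. N = prod_encode (\<rho> 0, \<rho> (Suc j)) \<and> N \<in> gset (force_win (\<lambda>y. G (x \<oplus>\<^sub>J y) (\<lambda>i. \<rho> (Suc i))))
        (force_cont (\<lambda>y. H (x \<oplus>\<^sub>J y) (\<lambda>i. \<rho> (Suc i)))))"
      by (intro definable_intros definable_arith g)
    then show ?case using fg(2) by (simp add: fg(1))
  qed
  then show "definable (\<lambda>x \<rho>. forces {y. R (x \<oplus>\<^sub>J y) (\<lambda>i. \<rho> (\<sigma> i))} (\<rho> k))" "baire {y. R (x \<oplus>\<^sub>J y) \<rho>}"
    using rnm by blast+
qed

section \<open>Configurations and their reachability facts\<close>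

lemma computable_const: "computable_rel (\<lambda>x \<rho>. \<rho> i = c)"
proof (induction c arbitrary: i)
  case 0 show ?case by (rule computable_zero)
next
  case (Suc c)
  have "computable_rel (\<lambda>x \<rho>. \<exists>n. n = c \<and> \<rho> i = Suc n)" by (intro computable_intros Suc)
  then show ?case by simp
qed

lemmas definable_const = computable_const[THEN definable.base]

lemma definable_bex_finite:
  assumes "finite A" "\<And>a. a \<in> A \<Longrightarrow> definable (R a)"
  shows "definable (\<lambda>x \<rho>. \<exists>a\<in>A. R a x \<rho>)"
  using assms
proof (induction A rule: finite_induct)
  case empty
  have "computable_rel (\<lambda>x \<rho>. \<not> \<rho> 0 = \<rho> 0)" by (intro computable_intros)
  then have "definable (\<lambda>x \<rho>. \<not> \<rho> 0 = \<rho> 0)" by (rule definable.base)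
  then show ?case by simp
next
  case (insert a A)
  have "definable (\<lambda>x \<rho>. R a x \<rho> \<or> (\<exists>a\<in>A. R a x \<rho>))"
    by (rule definable_disj) (use insert in auto)
  then show ?case by (simp only: bex_simps(5))
qed

lemma definable_mem_finite:
  assumes "finite A" shows "definable (\<lambda>x \<rho>. \<rho> i \<in> A)"
proof -
  have "definable (\<lambda>x \<rho>. \<exists>a\<in>A. \<rho> i = a)" by (rule definable_bex_finite[OF assms definable_const])
  then show ?thesis by simp
qed

text \<open>The complement of a closed game is an inductive definition: \<open>a\<close> is the rule
  applied, \<open>B\<close> its side condition, and the \<open>b\<close> with \<open>H n a b\<close>
  are its premises.\<close>

definition lset :: "(nat \<Rightarrow> nat \<Rightarrow> bool) \<Rightarrow> (nat \<Rightarrow> nat \<Rightarrow> nat \<Rightarrow> bool) \<Rightarrow> nat set" where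
  "lset B H = - gset (\<lambda>n a b. \<not> B n a) H"

lemma lset_intro: "B n a \<Longrightarrow> (\<And>b. H n a b \<Longrightarrow> b \<in> lset B H) \<Longrightarrow> n \<in> lset B H"
  unfolding lset_def using gset_unfold[of n "\<lambda>n a b. \<not> B n a" H] by blast

lemma lset_induct:
  assumes "n \<in> lset B H" "\<And>n a. B n a \<Longrightarrow> (\<And>b. H n a b \<Longrightarrow> Q b) \<Longrightarrow> Q n"
  shows "Q n"
proof (rule ccontr)
  assume "\<not> Q n"
  then have "n \<in> gset (\<lambda>n a b. \<not> B n a) H"
    by (intro gset_coinduct[where V = "{n. \<not> Q n}"]) (use assms(2) in blast)+
  then show False using assms(1) by (simp add: lset_def)
qed

lemma definable_lset:
  assumes "definable (\<lambda>x \<rho>. B x (\<rho> 0) (\<rho> (Suc 0)))"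
    and "definable (\<lambda>x \<rho>. H x (\<rho> 0) (\<rho> (Suc 0)) (\<rho> (Suc (Suc 0))))"
  shows "definable (\<lambda>x \<rho>. \<rho> i \<in> lset (B x) (H x))"
proof -
  have "definable (\<lambda>x \<rho>. \<rho> i \<in> gset (\<lambda>n a b. \<not> B x n a) (H x))"
    by (rule definable.game) (intro definable.neg assms)+
  then have "definable (\<lambda>x \<rho>. \<not> \<rho> i \<in> gset (\<lambda>n a b. \<not> B x n a) (H x))" by (rule definable.neg)
  then show ?thesis by (simp only: lset_def Compl_iff)
qed

section \<open>Machine steps on coded configurations\<close>

definition setc :: "nat \<Rightarrow> nat \<Rightarrow> nat \<Rightarrow> nat \<Rightarrow> bool" where
  "setc c i v d \<longleftrightarrow> d = list_encode ((list_decode c)[i := v])"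

lemma nthc_ext: "d = e \<longleftrightarrow> (\<forall>k w. nthc d k w \<longleftrightarrow> nthc e k w)"
proof
  assume *: "\<forall>k w. nthc d k w \<longleftrightarrow> nthc e k w"
  have "k < length (list_decode d) \<longleftrightarrow> k < length (list_decode e)" for k
    using * unfolding nthc_def by blast
  then have l: "length (list_decode d) = length (list_decode e)" by (meson linorder_neqE_nat less_irrefl)
  have "list_decode d = list_decode e"
    by (rule nth_equalityI[OF l]) (use * in \<open>auto simp: nthc_def\<close>)
  then show "d = e" by (metis list_decode_inverse)
qed simp

lemma definable_setc: "definable (\<lambda>x \<rho>. setc (\<rho> i) (\<rho> j) (\<rho> k) (\<rho> l))"
proof -
  have n: "nthc (list_encode ((list_decode c)[i := v])) k w \<longleftrightarrow>
      (k = i \<and> w = v \<and> (\<exists>u. nthc c k u)) \<or> (\<not> k = i \<and> nthc c k w)" for c i v k w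
    by (cases "k = i") (auto simp: nthc_def)
  have eq: "setc c i v d \<longleftrightarrow> (\<forall>k w. (nthc d k w \<longrightarrow> (k = i \<and> w = v \<and> (\<exists>u. nthc c k u)) \<or> (\<not> k = i \<and> nthc c k w)) \<and>
     ((k = i \<and> w = v \<and> (\<exists>u. nthc c k u)) \<or> (\<not> k = i \<and> nthc c k w) \<longrightarrow> nthc d k w))" for c i v d
    unfolding setc_def nthc_ext[of d] n by (simp only: iff_conv_conj_imp simp_thms)
  show ?thesis unfolding eq by (intro definable_intros definable_arith)
qed

fun regs :: "instr \<Rightarrow> nat set" where
  "regs (Zero n) = {n}" | "regs (Succ n) = {n}" | "regs (Copy m n) = {m, n}"
| "regs (Jump m n q) = {m, n}" | "regs (Query n) = {n}"

text \<open>The rules for definability apply to relations between variables, so constants and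
  successors are introduced by existential quantifiers; many formulas below have their form for this
  reason.\<close>

definition fetch :: "nat \<Rightarrow> nat \<Rightarrow> nat \<Rightarrow> bool" where
  "fetch n c v \<longleftrightarrow> (\<exists>i. i = Suc n \<and> nthc c i v)"
definition put :: "nat \<Rightarrow> nat \<Rightarrow> nat \<Rightarrow> nat \<Rightarrow> bool" where
  "put n c v d \<longleftrightarrow> (\<exists>i. i = Suc n \<and> setc c i v d)"
definition jumpto :: "nat \<Rightarrow> nat \<Rightarrow> nat \<Rightarrow> bool" where
  "jumpto q c d \<longleftrightarrow> (\<exists>z. z = 0 \<and> (\<exists>l. l = q \<and> setc c z l d))"
definition advance :: "nat \<Rightarrow> nat \<Rightarrow> bool" where
  "advance c d \<longleftrightarrow> (\<exists>z. z = 0 \<and> (\<exists>l. nthc c z l \<and> (\<exists>k. k = Suc l \<and> setc c z k d)))"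

lemma definable_fetch: "definable (\<lambda>x \<rho>. fetch n (\<rho> i) (\<rho> j))"
  unfolding fetch_def by (intro definable_intros definable_arith definable_const)
lemma definable_put: "definable (\<lambda>x \<rho>. put n (\<rho> i) (\<rho> j) (\<rho> k))"
  unfolding put_def by (intro definable_intros definable_setc definable_const)
lemma definable_jumpto: "definable (\<lambda>x \<rho>. jumpto q (\<rho> i) (\<rho> j))"
  unfolding jumpto_def by (intro definable_intros definable_setc definable_const)
lemma definable_advance: "definable (\<lambda>x \<rho>. advance (\<rho> i) (\<rho> j))"
  unfolding advance_def by (intro definable_intros definable_setc definable_const definable_arith)

fun instr_rel :: "instr \<Rightarrow> nat set \<Rightarrow> nat \<Rightarrow> nat \<Rightarrow> bool" where
  "instr_rel (Zero n) x c d = (\<exists>e. advance c e \<and> (\<exists>v. v = 0 \<and> put n e v d))"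
| "instr_rel (Succ n) x c d = (\<exists>e. advance c e \<and> (\<exists>w. fetch n c w \<and> (\<exists>v. v = Suc w \<and> put n e v d)))"
| "instr_rel (Copy m n) x c d = (\<exists>e. advance c e \<and> (\<exists>v. fetch m c v \<and> put n e v d))"
| "instr_rel (Jump m n q) x c d = (\<exists>v. fetch m c v \<and> (\<exists>w. fetch n c w \<and>
     (v = w \<and> jumpto q c d \<or> \<not> v = w \<and> advance c d)))"
| "instr_rel (Query n) x c d = (\<exists>e. advance c e \<and> (\<exists>w. fetch n c w \<and>
     (\<exists>v. (w \<in> x \<and> v = 1 \<or> \<not> w \<in> x \<and> v = 0) \<and> put n e v d)))"

lemma definable_instr_rel: "definable (\<lambda>x \<rho>. instr_rel I x (\<rho> i) (\<rho> j))"
  by (cases I; simp only: instr_rel.simps;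
    intro definable_intros definable_fetch definable_put definable_jumpto definable_advance
      definable_const definable_arith)

definition step_rel :: "program \<Rightarrow> nat set \<Rightarrow> nat \<Rightarrow> nat \<Rightarrow> bool" where
  "step_rel P x c d \<longleftrightarrow> (\<exists>z. z = 0 \<and> (\<exists>l. nthc c z l \<and>
     ((\<exists>n. n = length P \<and> n \<le> l) \<and> d = c \<or> (\<exists>j\<in>{..<length P}. l = j \<and> instr_rel (P ! j) x c d))))"

lemma definable_step_rel: "definable (\<lambda>x \<rho>. step_rel P x (\<rho> i) (\<rho> j))"
  unfolding step_rel_def
  by (intro definable_intros definable_const definable_arith definable_bex_finite finite_lessThan definable_instr_rel)

text \<open>Component \<open>0\<close> is the program line and component \<open>n + 1\<close> is register \<open>n\<close>, so a program that only
  mentions registers \<open>n\<close> with \<open>n + 1 < m\<close> is determined by the first \<open>m\<close> components.\<close>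

definition code :: "nat \<Rightarrow> config \<Rightarrow> nat" where
  "code m c = list_encode (map (\<lambda>i. comp_of i c) [0..<m])"

lemma nthc_code: "nthc (code m c) i v \<longleftrightarrow> i < m \<and> v = comp_of i c"
  by (auto simp: nthc_def code_def)

lemma length_code: "length (list_decode (code m c)) = m" by (simp add: code_def)

lemma code_eqI:
  assumes "length (list_decode d) = m" "\<And>i v. nthc d i v \<Longrightarrow> comp_of i c = v"
  shows "code m c = d"
  unfolding nthc_ext[of "code m c"] nthc_code
  using assms by (auto simp: nthc_def)

lemma setc_code: "setc (code m c) i v d \<longleftrightarrow> d = list_encode (map ((\<lambda>j. comp_of j c)(i := v)) [0..<m])"
proof -
  have "(map (\<lambda>j. comp_of j c) [0..<m])[i := v] = map ((\<lambda>j. comp_of j c)(i := v)) [0..<m]"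
    by (rule nth_equalityI) (auto simp: nth_list_update)
  then show ?thesis by (simp add: setc_def code_def)
qed

lemma put_code: "put n (code m (l, R)) v d \<longleftrightarrow> d = code m (l, R(n := v))"
proof -
  have "(\<lambda>j. comp_of j (l, R))(Suc n := v) = (\<lambda>j. comp_of j (l, R(n := v)))"
    by (rule ext) (auto simp: comp_of_def split: nat.split)
  then show ?thesis unfolding put_def by (simp add: setc_code) (simp add: code_def)
qed

lemma line_code: "setc (code m (l, R)) 0 k d \<longleftrightarrow> d = code m (k, R)"
proof -
  have "(\<lambda>j. comp_of j (l, R))(0 := k) = (\<lambda>j. comp_of j (k, R))"
    by (rule ext) (auto simp: comp_of_def split: nat.split)
  then show ?thesis by (simp add: setc_code) (simp add: code_def)
qed

lemma jumpto_code: "jumpto q (code m (l, R)) d \<longleftrightarrow> d = code m (q, R)"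
  by (simp add: jumpto_def line_code)

lemma advance_code: "0 < m \<Longrightarrow> advance (code m (l, R)) d \<longleftrightarrow> d = code m (Suc l, R)"
  by (simp add: advance_def nthc_code line_code) (simp add: comp_of_def)

lemma fetch_code: "Suc n < m \<Longrightarrow> fetch n (code m (l, R)) v \<longleftrightarrow> v = R n"
  by (simp add: fetch_def nthc_code) (simp add: comp_of_def)

lemma instr_rel_code:
  assumes "\<forall>n\<in>regs I. Suc n < m" "0 < m"
  shows "instr_rel I x (code m (l, R)) d \<longleftrightarrow> d = code m (exec x I (l, R))"
  using assms by (cases I) (auto simp: advance_code put_code fetch_code jumpto_code)

lemma step_rel_code:
  assumes "\<forall>I\<in>set P. \<forall>n\<in>regs I. Suc n < m" "0 < m"
  shows "step_rel P x (code m c) d \<longleftrightarrow> d = code m (nxt P x c)"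
proof -
  obtain l R where c: "c = (l, R)" by (cases c)
  have "nthc (code m c) 0 k \<longleftrightarrow> k = l" for k using assms(2) by (auto simp: nthc_code c comp_of_def)
  moreover have "l < length P \<Longrightarrow> instr_rel (P ! l) x (code m c) d \<longleftrightarrow> d = code m (exec x (P ! l) c)"
    unfolding c by (rule instr_rel_code) (use assms in auto)
  ultimately show ?thesis unfolding step_rel_def
    by (cases "l < length P") (auto simp: nxt_def c)
qed

text \<open>The floor \<open>v\<close> may be shorter than \<open>c\<close>; the code 0 of the empty
  list imposes no bound.\<close>

definition ge :: "nat \<Rightarrow> nat \<Rightarrow> bool" where
  "ge c v \<longleftrightarrow> (\<forall>i a. nthc v i a \<longrightarrow> (\<exists>b. nthc c i b \<and> a \<le> b))"

text \<open>Components in \<open>A\<close> are exempt because they tend to infinity instead of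
  returning to their limit value.\<close>

definition hit :: "nat set \<Rightarrow> nat \<Rightarrow> nat \<Rightarrow> nat \<Rightarrow> bool" where
  "hit A k e u \<longleftrightarrow> (\<forall>i j. k = prod_encode (i, j) \<longrightarrow> \<not> i \<in> A \<longrightarrow> (\<forall>a. nthc u i a \<longrightarrow> nthc e i a))"

definition reach_fact :: "nat \<Rightarrow> nat \<Rightarrow> nat \<Rightarrow> nat" where
  "reach_fact v c d = prod_encode (0, prod_encode (v, prod_encode (c, d)))"
definition round_fact :: "nat \<Rightarrow> nat \<Rightarrow> nat \<Rightarrow> nat \<Rightarrow> nat" where
  "round_fact u c k n = prod_encode (1, prod_encode (u, prod_encode (c, prod_encode (k, n))))"

lemma fact_simps [simp]:
  "reach_fact v c d = reach_fact v' c' d' \<longleftrightarrow> v = v' \<and> c = c' \<and> d = d'"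
  "round_fact u c k n = round_fact u' c' k' n' \<longleftrightarrow> u = u' \<and> c = c' \<and> k = k' \<and> n = n'"
  "reach_fact v c d \<noteq> round_fact u c' k n" "round_fact u c' k n \<noteq> reach_fact v c d"
  by (auto simp: reach_fact_def round_fact_def)

lemma definable_reach_fact: "definable (\<lambda>x \<rho>. \<rho> i = reach_fact (\<rho> v) (\<rho> c) (\<rho> d))"
proof -
  have "definable (\<lambda>x \<rho>. \<exists>p. p = prod_encode (\<rho> c, \<rho> d) \<and> (\<exists>q. q = prod_encode (\<rho> v, p) \<and>
     (\<exists>z. z = 0 \<and> \<rho> i = prod_encode (z, q))))"
    by (intro definable_intros definable_arith definable_const)
  then show ?thesis by (simp add: reach_fact_def)
qed

lemma definable_round_fact: "definable (\<lambda>x \<rho>. \<rho> i = round_fact (\<rho> u) (\<rho> c) (\<rho> k) (\<rho> n))"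
proof -
  have "definable (\<lambda>x \<rho>. \<exists>s. s = prod_encode (\<rho> k, \<rho> n) \<and> (\<exists>p. p = prod_encode (\<rho> c, s) \<and> (\<exists>q. q = prod_encode (\<rho> u, p) \<and>
     (\<exists>z. z = 1 \<and> \<rho> i = prod_encode (z, q)))))"
    by (intro definable_intros definable_arith definable_const)
  then show ?thesis by (simp add: round_fact_def)
qed

definition choice_code :: "nat \<Rightarrow> nat \<Rightarrow> nat" where "choice_code t e = prod_encode (t, e)"

lemma choice_code_eq [simp]: "choice_code t e = choice_code t' e' \<longleftrightarrow> t = t' \<and> e = e'"
  by (simp add: choice_code_def)

lemma definable_choice_code: "definable (\<lambda>x \<rho>. \<rho> i = choice_code t (\<rho> j))"
proof -
  have "definable (\<lambda>x \<rho>. \<exists>z. z = t \<and> \<rho> i = prod_encode (z, \<rho> j))"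
    by (intro definable_intros definable_arith definable_const)
  then show ?thesis by (simp add: choice_code_def)
qed

text \<open>Rules for \<open>reach_fact v c d\<close>, saying that \<open>c\<close> leads to \<open>d\<close> while the components stay above the
  vector \<open>v\<close>, and \<open>round_fact u c k n\<close>, saying that from \<open>c\<close> one can hit the components of \<open>u\<close> with the
  numbers \<open>k, \<dots>, k + n - 1\<close> in turn while staying above \<open>u\<close>. Here the component with number \<open>k\<close> is the
  first element of the pair coded by \<open>k\<close>, so that every component is hit again and again.
  Choices: 0 (nothing to do), 1 (successor step), 2 (limit without overflow), 3 (limit with overflow),
  4 (next hit).\<close>

definition side :: "program \<Rightarrow> nat \<Rightarrow> (nat \<Rightarrow> nat \<Rightarrow> bool) \<Rightarrow> nat set \<Rightarrow> nat \<Rightarrow> nat \<Rightarrow> bool" where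
  "side P m Ov x f a \<longleftrightarrow>
    (\<exists>v c d. f = reach_fact v c d \<and> (\<exists>e.
       a = choice_code 0 e \<and> c = d \<and> ge c v \<or>
       a = choice_code 1 e \<and> step_rel P x e d \<and> ge d v \<or>
       (\<exists>l. l = m \<and> length (list_decode d) = l) \<and> ge d v \<and>
         (a = choice_code 2 e \<or> a = choice_code 3 e \<and> Ov d e))) \<or>
    (\<exists>u c k n. f = round_fact u c k n \<and> (\<exists>e.
       a = choice_code 0 e \<and> n = 0 \<or> a = choice_code 4 e \<and> \<not> n = 0 \<and> hit {} k e u))"

text \<open>A limit without overflow has one premise for every number \<open>n\<close> of rounds;
  all start from the same \<open>e\<close>, and as the machine is deterministic they describe
  stretches of one approach to the limit. An overflow speaks of an infinite path, which is
  coinductive, and therefore enters through \<open>side\<close> with facts of a lower level.\<close>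

definition premise :: "program \<Rightarrow> nat set \<Rightarrow> nat \<Rightarrow> nat \<Rightarrow> nat \<Rightarrow> bool" where
  "premise P x f a g \<longleftrightarrow> (\<exists>e.
    (\<exists>v c d. f = reach_fact v c d \<and>
      ((a = choice_code 1 e \<or> a = choice_code 2 e \<or> a = choice_code 3 e) \<and> g = reach_fact v c e \<or>
       a = choice_code 2 e \<and> (\<exists>z. z = 0 \<and> (\<exists>n. g = round_fact d e z n)))) \<or>
    (\<exists>u c k n. f = round_fact u c k n \<and> a = choice_code 4 e \<and>
      ((\<exists>c'. step_rel P x c c' \<and> g = reach_fact u c' e) \<or>
       (\<exists>k'. k' = Suc k \<and> (\<exists>n'. n = Suc n' \<and> g = round_fact u e k' n')))))"

text \<open>\<open>w\<close> is the floor for stretch \<open>n\<close> of a climb. On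
  \<open>A\<close> it is positive already for \<open>n = 0\<close>, which rules out a reset of these
  components on the way.\<close>

definition raised :: "nat set \<Rightarrow> nat \<Rightarrow> nat \<Rightarrow> nat \<Rightarrow> bool" where
  "raised A d n w \<longleftrightarrow> (\<forall>i b. (nthc w i b \<longrightarrow> (\<exists>a. nthc d i a \<and> (i \<in> A \<and> b = Suc n \<or> \<not> i \<in> A \<and> b = a))) \<and>
     (\<forall>a. nthc d i a \<and> (i \<in> A \<and> b = Suc n \<or> \<not> i \<in> A \<and> b = a) \<longrightarrow> nthc w i b))"

definition climb_pos :: "nat \<Rightarrow> nat \<Rightarrow> nat \<Rightarrow> nat" where
  "climb_pos n e d = prod_encode (n, prod_encode (e, d))"

lemma climb_pos_eq [simp]: "climb_pos n e d = climb_pos n' e' d' \<longleftrightarrow> n = n' \<and> e = e' \<and> d = d'"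
  by (simp add: climb_pos_def)

lemma definable_climb_pos: "definable (\<lambda>x \<rho>. \<rho> i = climb_pos (\<rho> n) (\<rho> e) (\<rho> d))"
proof -
  have "definable (\<lambda>x \<rho>. \<exists>p. p = prod_encode (\<rho> e, \<rho> d) \<and> \<rho> i = prod_encode (\<rho> n, p))"
    by (intro definable_intros definable_arith)
  then show ?thesis by (simp add: climb_pos_def)
qed

text \<open>A one-player game, for which \<open>gset\<close> asks for an infinite path. The counter
  \<open>n\<close> in the position determines both the floor of the components in \<open>A\<close>
  and the component to be hit next.\<close>

definition climb :: "program \<Rightarrow> nat set \<Rightarrow> nat set \<Rightarrow> nat set \<Rightarrow> nat \<Rightarrow> nat \<Rightarrow> nat \<Rightarrow> bool" where
  "climb P A W x N a M \<longleftrightarrow> (\<exists>n e d e'. N = climb_pos n e d \<and> (\<exists>n'. n' = Suc n \<and> M = climb_pos n' e' d) \<and>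
     (\<exists>w c'. raised A d n w \<and> step_rel P x e c' \<and> (\<exists>f. f = reach_fact w c' e' \<and> f \<in> W)) \<and> hit A n e' d)"

text \<open>From \<open>e\<close> the components in \<open>A\<close> tend to infinity, using only facts from \<open>W\<close>, and the limit is \<open>d\<close>.\<close>

definition overflow :: "program \<Rightarrow> nat \<Rightarrow> nat set \<Rightarrow> nat set \<Rightarrow> nat \<Rightarrow> nat \<Rightarrow> bool" where
  "overflow P m W x d e \<longleftrightarrow> (\<exists>A\<in>Pow {..<m}. (\<forall>i. i \<in> A \<longrightarrow> (\<exists>z. z = 0 \<and> nthc d i z)) \<and>
     (\<exists>z. z = 0 \<and> (\<exists>N. N = climb_pos z e d \<and> N \<in> gset (\<lambda>_ _ _. False) (climb P A W x))))"

text \<open>The level bounds the number of components that may overflow. A component that overflows at a limit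
  cannot overflow on the way there once it stays positive, because it would be reset to \<open>0\<close>; so the
  approach to the limit only needs facts of a lower level.\<close>

primrec facts :: "program \<Rightarrow> nat \<Rightarrow> nat \<Rightarrow> nat set \<Rightarrow> nat set" where
  "facts P m 0 x = lset (side P m (\<lambda>_ _. False) x) (premise P x)"
| "facts P m (Suc k) x = lset (side P m (overflow P m (facts P m k x) x) x) (premise P x)"

lemma definable_ge: "definable (\<lambda>x \<rho>. ge (\<rho> i) (\<rho> j))"
  unfolding ge_def by (intro definable_intros definable_arith)

lemma definable_hit: "finite A \<Longrightarrow> definable (\<lambda>x \<rho>. hit A (\<rho> k) (\<rho> e) (\<rho> u))"
  unfolding hit_def by (intro definable_intros definable_arith definable_mem_finite)

lemma definable_raised: "finite A \<Longrightarrow> definable (\<lambda>x \<rho>. raised A (\<rho> d) (\<rho> n) (\<rho> w))"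
  unfolding raised_def by (intro definable_intros definable_arith definable_mem_finite)

lemma definable_premise: "definable (\<lambda>x \<rho>. premise P x (\<rho> i) (\<rho> j) (\<rho> k))"
  unfolding premise_def
  by (intro definable_intros definable_arith definable_const definable_reach_fact definable_round_fact
    definable_choice_code definable_step_rel)

lemma definable_false: "definable (\<lambda>x \<rho>. False)"
  using definable_bex_finite[of "{}" "\<lambda>a x \<rho>. False"] by simp

lemma definable_facts: "definable (\<lambda>x \<rho>. \<rho> i \<in> facts P m k x)"
proof (induction k arbitrary: i)
  have s: "definable (\<lambda>x \<rho>. side P m (Ov x) x (\<rho> i) (\<rho> j))" if Ov: "\<And>i j. definable (\<lambda>x \<rho>. Ov x (\<rho> i) (\<rho> j))" for i j Ov
    unfolding side_def
    by (intro definable_intros definable_arith definable_const definable_reach_fact definable_round_fact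
      definable_choice_code definable_step_rel definable_ge definable_hit finite.emptyI Ov)
  case 0
  show ?case unfolding facts.simps by (rule definable_lset) (rule s[of "\<lambda>_ _ _. False", OF definable_false], rule definable_premise)
  case (Suc k)
  have c: "definable (\<lambda>x \<rho>. climb P A (facts P m k x) x (\<rho> i) (\<rho> j) (\<rho> l))" if "finite A" for A i j l
    unfolding climb_def
    by (intro definable_intros definable_arith definable_climb_pos definable_raised definable_step_rel definable_reach_fact
      definable_hit Suc that)
  have g: "definable (\<lambda>x \<rho>. \<rho> i \<in> gset (\<lambda>_ _ _. False) (climb P A (facts P m k x) x))" if "finite A" for A i
    by (rule definable.game) (intro definable_false c[OF that])+
  have o: "definable (\<lambda>x \<rho>. overflow P m (facts P m k x) x (\<rho> i) (\<rho> j))" for i j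
    unfolding overflow_def
  proof (rule definable_bex_finite)
    fix A assume "A \<in> Pow {..<m}"
    then have "finite A" using finite_subset by blast
    then show "definable (\<lambda>x \<rho>. (\<forall>i'. i' \<in> A \<longrightarrow> (\<exists>z. z = 0 \<and> nthc (\<rho> i) i' z)) \<and>
        (\<exists>z. z = 0 \<and> (\<exists>N. N = climb_pos z (\<rho> j) (\<rho> i) \<and>
          N \<in> gset (\<lambda>_ _ _. False) (climb P A (facts P m k x) x))))"
      by (intro definable_intros definable_arith definable_const definable_climb_pos g definable_mem_finite)
  qed simp
  show ?case unfolding facts.simps by (rule definable_lset) (intro s o definable_premise)+
qed

section \<open>Soundness of the facts\<close>

text \<open>Of two well-orders one embeds into the other, and the runs along them agree. If it is
  the run on \<open>omega1\<close> that embeds, it must halt too, because a halting computation has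
  countable length.\<close>

lemma outputs_timeline:
  assumes T: "timeline P x C" and out: "itrm_outputs P x n"
  shows "\<exists>t. length P \<le> fst (C t) \<and> snd (C t) 0 = n"
proof -
  obtain r :: "nat set rel" and D t where D: "itrm_computation P x r D" and t: "t \<in> Field r"
    and h: "length P \<le> fst (D t)" "snd (D t) 0 = n" using out unfolding itrm_outputs_def by blast
  have W: "Well_order r" using D by (simp add: itrm_computation_def)
  \<comment> \<open>All times up to and including the first halting one.\<close>
  define S where "S = {u. \<forall>v<u. fst (C v) < length P}"
  have C: "itrm_computation P x (Restr le1 S) C"
    by (rule timeline_computation[OF T]) (auto simp: S_def)
  have FS: "Field (Restr le1 S) = S" by (auto simp: Field_def)
  define b :: omega1 where "b = (LEAST t. True)"
  have b: "b \<le> u" for u unfolding b_def by (rule Least_le) simp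
  have bS: "b \<in> S" using b by (auto simp: S_def not_less[symmetric])
  obtain p where p: "p \<in> Field r" "\<And>a. a \<in> Field r \<Longrightarrow> (p, a) \<in> r"
    using wo_min[OF W t, of "\<lambda>_. True"] by blast
  have pm: "underS r p = {}" using p(2) wo_not_less[OF W] by (auto simp: underS_def Field_def)
  have "C b = (0, \<lambda>_. 0)" by (rule T[unfolded timeline_def, THEN conjunct1, THEN spec, THEN mp]) (use b in blast)
  moreover have "D p = (0, \<lambda>_. 0)" using D p(1) pm by (simp add: itrm_computation_def)
  ultimately have st: "C b = D p" by simp
  have I1: "interval_from r p (Field r)" using p by (auto simp: interval_from_def Field_def)
  have I2: "interval_from (Restr le1 S) b S" using b bS by (auto simp: interval_from_def FS)
  have R1: "Restr r (Field r) = r" by (auto simp: Field_def)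
  have R2: "Restr (Restr le1 S) S = Restr le1 S" by auto
  have WS: "Well_order (Restr le1 S)" using C by (simp add: itrm_computation_def)
  then consider f where "embed r (Restr le1 S) f" | f where "embed (Restr le1 S) r f"
    using wellorders_totally_ordered[OF W] by blast
  then show ?thesis
  proof cases
    case 1
    have "C (f t) = D t" using interval_embed(3)[OF D C I1 I2 st _ t] 1 by (simp add: R1 R2)
    then show ?thesis using h by metis
  next
    case 2
    have e: "D (f u) = C u" "f u \<in> Field r" if "u \<in> S" for u
      using interval_embed(3,2)[OF C D I2 I1 st[symmetric] _ that] 2 by (simp_all add: R1 R2)
    show ?thesis
    proof (cases "\<exists>u. length P \<le> fst (C u)")
      case False
      then have "S = UNIV" by (auto simp: S_def not_le)
      have "inj_on f S" using embed_inj_on[OF WS 2] by (simp only: FS)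
      moreover have "countable (f ` S)"
        by (rule countable_subset[OF _ halting_countable[OF D t h(1)]]) (use e(2) in blast)
      ultimately have "countable S" by (rule countable_image_inj_on[rotated])
      then show ?thesis using uncountable_omega1 \<open>S = UNIV\<close> by simp
    next
      case True
      define u where "u = (LEAST u. length P \<le> fst (C u))"
      have u: "length P \<le> fst (C u)" unfolding u_def using True by (rule LeastI_ex)
      have "u \<in> S" unfolding S_def u_def using not_less_Least not_less by blast
      note eu = e[OF this]
      \<comment> \<open>A computation does not continue after halting, so two halting times
        coincide.\<close>
      have "f u = t"
      proof (rule ccontr)
        assume "f u \<noteq> t"
        then have "f u \<in> underS r t \<or> t \<in> underS r (f u)"
          using wo_le_cases[OF W eu(2) t] by (auto simp: underS_def)
        then show False using running_before[OF D] eu(1) u h(1) by (metis not_less)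
      qed
      then show ?thesis using eu(1) u h by metis
    qed
  qed
qed

text \<open>The recursion is on the last round, so that a stretch of \<open>n + 1\<close> rounds
  contains one of \<open>n\<close> rounds with the same start. The floor does not apply at the start
  \<open>s\<close> itself.\<close>

primrec rounds :: "nat \<Rightarrow> (omega1 \<Rightarrow> config) \<Rightarrow> nat \<Rightarrow> nat \<Rightarrow> nat \<Rightarrow> omega1 \<Rightarrow> omega1 \<Rightarrow> bool" where
  "rounds m C u k 0 s t \<longleftrightarrow> t = s"
| "rounds m C u k (Suc n) s t \<longleftrightarrow> (\<exists>t1. rounds m C u k n s t1 \<and> t1 < t \<and>
     (\<forall>r. t1 < r \<longrightarrow> r \<le> t \<longrightarrow> ge (code m (C r)) u) \<and> hit {} (k + n) (code m (C t)) u)"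

text \<open>Bridges two directions of recursion: the facts split off the first round,
  \<open>rounds\<close> the last one.\<close>

lemma rounds_Cons:
  assumes "s < t1" "\<And>r. s < r \<Longrightarrow> r \<le> t1 \<Longrightarrow> ge (code m (C r)) u" "hit {} k (code m (C t1)) u"
    "rounds m C u (Suc k) n t1 t"
  shows "rounds m C u k (Suc n) s t"
  using assms(4)
proof (induction n arbitrary: t)
  case 0
  then show ?case using assms by auto
next
  case (Suc n)
  then obtain t2 where t2: "rounds m C u (Suc k) n t1 t2" "t2 < t"
    "\<forall>r. t2 < r \<longrightarrow> r \<le> t \<longrightarrow> ge (code m (C r)) u" "hit {} (Suc k + n) (code m (C t)) u"
    by (auto simp del: rounds.simps(1))
  have "rounds m C u k (Suc n) s t2" by (rule Suc.IH[OF t2(1)])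
  then show ?case unfolding rounds.simps(2)[of m C u k "Suc n"] using t2(2-4) by (intro exI[of _ t2]) simp
qed

lemma rounds_ge: "rounds m C u k n s t \<Longrightarrow> s \<le> t \<and> (\<forall>r. s < r \<longrightarrow> r \<le> t \<longrightarrow> ge (code m (C r)) u)"
proof (induction n arbitrary: t)
  case (Suc n)
  then obtain t1 where t1: "rounds m C u k n s t1" "t1 < t" "\<forall>r. t1 < r \<longrightarrow> r \<le> t \<longrightarrow> ge (code m (C r)) u"
    by auto
  show ?case using Suc.IH[OF t1(1)] t1(2,3) by (meson less_imp_le not_less order_trans)
qed auto

lemma ge_code: "ge (code m c) v \<longleftrightarrow> (\<forall>i a. nthc v i a \<longrightarrow> i < m \<and> a \<le> comp_of i c)"
  by (auto simp: ge_def nthc_code)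

lemma nthc_length: "length (list_decode d) = m \<Longrightarrow> nthc d i a \<Longrightarrow> i < m"
  by (simp add: nthc_def)

text \<open>The stretches for different \<open>n\<close> are given independently of each other.
  Taking the least possible end time for each \<open>n\<close> makes the end times increase, so that
  they have a common limit.\<close>

lemma rounds_limit:
  assumes T: "timeline P x C" and d: "length (list_decode d) = m" and ex: "\<And>n. \<exists>t. rounds m C d 0 n s t"
  shows "\<exists>l>s. code m (C l) = d \<and> (\<forall>u. s < u \<longrightarrow> u < l \<longrightarrow> ge (code m (C u)) d)"
proof -
  define \<tau> where "\<tau> n = (LEAST t. rounds m C d 0 n s t)" for n
  have \<tau>: "rounds m C d 0 n s (\<tau> n)" for n unfolding \<tau>_def by (rule LeastI_ex[OF ex])
  have lt: "\<tau> n < \<tau> (Suc n)" for n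
  proof -
    obtain t1 where "rounds m C d 0 n s t1" "t1 < \<tau> (Suc n)" using \<tau>[of "Suc n"] by auto
    then show ?thesis unfolding \<tau>_def[of n] by (meson Least_le le_less_trans)
  qed
  obtain l where l: "olimit l" "\<And>n. \<tau> n < l" "\<And>u. u < l \<Longrightarrow> \<exists>n. u < \<tau> n" using osup[of \<tau>, OF lt] by blast
  have mono: "\<tau> a \<le> \<tau> b" if "a \<le> b" for a b
    using lift_Suc_mono_le[of \<tau>, OF _ that] lt by (simp add: less_imp_le)
  have s: "s = \<tau> 0" using \<tau>[of 0] by simp
  have ge: "ge (code m (C u)) d" if u: "s < u" "u < l" for u
  proof -
    obtain n where "u < \<tau> n" using l(3)[OF u(2)] by blast
    then show ?thesis using rounds_ge[OF \<tau>[of n]] u(1) by simp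
  qed
  have "code m (C l) = d"
  proof (rule code_eqI[OF d])
    fix i a assume a: "nthc d i a"
    show "comp_of i (C l) = a"
    proof (rule timeline_lim_eqI[OF T l(1) l(2)[of 1]])
      fix u assume "\<tau> 1 \<le> u" "u < l"
      then show "a \<le> comp_of i (C u)" using ge[of u] a lt[of 0] s by (auto simp: ge_code)
    next
      fix u assume "u < l"
      then obtain n where n: "u < \<tau> n" using l(3) by blast
      \<comment> \<open>Round \<open>k\<close> is devoted to component \<open>i\<close> and, as
        \<open>n \<le> k\<close>, ends after \<open>u\<close>.\<close>
      define k where "k = prod_encode (i, n)"
      have "n \<le> Suc k" unfolding k_def using le_prod_encode_2[of n i] by simp
      then have "u < \<tau> (Suc k)" using mono n by (meson less_le_trans)
      moreover have "hit {} k (code m (C (\<tau> (Suc k)))) d" using \<tau>[of "Suc k"] by auto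
      then have "comp_of i (C (\<tau> (Suc k))) = a" using a by (auto simp: hit_def k_def nthc_code)
      ultimately show "\<exists>u'\<ge>u. u' < l \<and> comp_of i (C u') = a"
        using l(2) by (intro exI[of _ "\<tau> (Suc k)"]) simp
    qed
  qed
  then show ?thesis using ge l(2)[of 0] s by blast
qed

context
  fixes P :: program and m :: nat
  assumes wf: "\<forall>I\<in>set P. \<forall>n\<in>regs I. Suc n < m" and m0: "0 < m"
begin

text \<open>The demand concerns all times \<open>s\<close> at which \<open>c\<close> is the code;
  this is what allows premises to be applied in the middle of a run.\<close>

definition sound :: "(omega1 \<Rightarrow> config) \<Rightarrow> nat \<Rightarrow> bool" where
  "sound C f \<longleftrightarrow> (\<forall>v c d s. f = reach_fact v c d \<longrightarrow> code m (C s) = c \<longrightarrow>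
      (\<exists>t\<ge>s. code m (C t) = d \<and> (\<forall>u. s \<le> u \<longrightarrow> u \<le> t \<longrightarrow> ge (code m (C u)) v))) \<and>
    (\<forall>u c k n s. f = round_fact u c k n \<longrightarrow> code m (C s) = c \<longrightarrow> (\<exists>t. rounds m C u k n s t))"

definition sound_limit :: "(omega1 \<Rightarrow> config) \<Rightarrow> (nat \<Rightarrow> nat \<Rightarrow> bool) \<Rightarrow> bool" where
  "sound_limit C Ov \<longleftrightarrow> (\<forall>d e s. Ov d e \<longrightarrow> length (list_decode d) = m \<longrightarrow> code m (C s) = e \<longrightarrow>
     (\<exists>l>s. code m (C l) = d \<and> (\<forall>u. s < u \<longrightarrow> u < l \<longrightarrow> ge (code m (C u)) d)))"

lemma step_timeline: "timeline P x C \<Longrightarrow> step_rel P x (code m (C s)) d \<longleftrightarrow> d = code m (C (osuc s))"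
  by (simp add: step_rel_code[OF wf m0] timeline_def)

lemma ge_trans: "ge c d \<Longrightarrow> ge d v \<Longrightarrow> ge c v"
  unfolding ge_def by (meson order_trans)

lemma lset_sound:
  assumes T: "timeline P x C" and Ov: "sound_limit C Ov"
    and f: "f \<in> lset (side P m Ov x) (premise P x)"
  shows "sound C f"
  using f
proof (rule lset_induct)
  fix f a assume side: "side P m Ov x f a" and prem: "\<And>g. premise P x f a g \<Longrightarrow> sound C g"
  show "sound C f" unfolding sound_def
  proof (intro conjI allI impI)
    fix v c d s assume f: "f = reach_fact v c d" and c: "code m (C s) = c"
    let ?goal = "\<exists>t\<ge>s. code m (C t) = d \<and> (\<forall>u. s \<le> u \<longrightarrow> u \<le> t \<longrightarrow> ge (code m (C u)) v)"
    have pre: "\<exists>t\<ge>s. code m (C t) = e \<and> (\<forall>u. s \<le> u \<longrightarrow> u \<le> t \<longrightarrow> ge (code m (C u)) v)"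
      if "a = choice_code 1 e \<or> a = choice_code 2 e \<or> a = choice_code 3 e" for e
    proof -
      have "sound C (reach_fact v c e)" by (rule prem) (use that f in \<open>auto simp: premise_def\<close>)
      then show ?thesis using c unfolding sound_def by blast
    qed
    have lim: ?goal if t: "t \<ge> s" "\<forall>u. s \<le> u \<longrightarrow> u \<le> t \<longrightarrow> ge (code m (C u)) v"
      and l: "l > t" "code m (C l) = d" "\<forall>u. t < u \<longrightarrow> u < l \<longrightarrow> ge (code m (C u)) d" and dv: "ge d v" for t l
    proof (intro exI[of _ l] conjI allI impI)
      show "s \<le> l" using t(1) l(1) by simp
      fix u assume u: "s \<le> u" "u \<le> l"
      consider "u \<le> t" | "t < u" "u < l" | "u = l" using u by force
      then show "ge (code m (C u)) v"
      proof cases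
        case 2 then show ?thesis using l(3) dv ge_trans by blast
      qed (use t u l dv in auto)
    qed (rule l(2))
    obtain e where "a = choice_code 0 e \<and> c = d \<and> ge c v \<or>
       a = choice_code 1 e \<and> step_rel P x e d \<and> ge d v \<or>
       length (list_decode d) = m \<and> ge d v \<and> (a = choice_code 2 e \<or> a = choice_code 3 e \<and> Ov d e)"
      using side unfolding side_def f by auto
    then consider "c = d" "ge c v" | "a = choice_code 1 e" "step_rel P x e d" "ge d v"
      | "a = choice_code 2 e" "length (list_decode d) = m" "ge d v"
      | "a = choice_code 3 e" "Ov d e" "length (list_decode d) = m" "ge d v" by blast
    then show ?goal
    proof cases
      case 1
      then show ?thesis using c by (intro exI[of _ s]) auto
    next
      case 2
      obtain t where t: "t \<ge> s" "code m (C t) = e" "\<forall>u. s \<le> u \<longrightarrow> u \<le> t \<longrightarrow> ge (code m (C u)) v"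
        using pre 2 by blast
      have d: "d = code m (C (osuc t))" using 2(2) t(2) step_timeline[OF T, of t d] by simp
      show ?thesis
        by (rule lim[OF t(1,3), of "osuc t"]) (use d 2(3) in \<open>auto simp: less_osuc_iff\<close>)
    next
      case 3
      obtain t where t: "t \<ge> s" "code m (C t) = e" "\<forall>u. s \<le> u \<longrightarrow> u \<le> t \<longrightarrow> ge (code m (C u)) v"
        using pre 3 by blast
      have "\<exists>t'. rounds m C d 0 n t t'" for n
      proof -
        have "sound C (round_fact d e 0 n)" by (rule prem) (use 3 f in \<open>auto simp: premise_def\<close>)
        then show ?thesis using t(2) unfolding sound_def by blast
      qed
      then obtain l where "l > t" "code m (C l) = d" "\<forall>u. t < u \<longrightarrow> u < l \<longrightarrow> ge (code m (C u)) d"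
        using rounds_limit[OF T 3(2)] by blast
      then show ?thesis using lim[OF t(1,3)] 3(3) by blast
    next
      case 4
      obtain t where t: "t \<ge> s" "code m (C t) = e" "\<forall>u. s \<le> u \<longrightarrow> u \<le> t \<longrightarrow> ge (code m (C u)) v"
        using pre 4 by blast
      obtain l where "l > t" "code m (C l) = d" "\<forall>u. t < u \<longrightarrow> u < l \<longrightarrow> ge (code m (C u)) d"
        using Ov 4 t(2) unfolding sound_limit_def by blast
      then show ?thesis using lim[OF t(1,3)] 4(4) by blast
    qed
  next
    fix u c k n s assume f: "f = round_fact u c k n" and c: "code m (C s) = c"
    obtain e where "a = choice_code 0 e \<and> n = 0 \<or> a = choice_code 4 e \<and> n \<noteq> 0 \<and> hit {} k e u"
      using side unfolding side_def f by auto
    then consider "n = 0" | n' where "n = Suc n'" "a = choice_code 4 e" "hit {} k e u"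
      using not0_implies_Suc by blast
    then show "\<exists>t. rounds m C u k n s t"
    proof cases
      case (2 n')
      have "sound C (reach_fact u (code m (C (osuc s))) e)"
        by (rule prem) (use 2 f c step_timeline[OF T, of s] in \<open>auto simp: premise_def\<close>)
      then obtain t1 where t1: "t1 \<ge> osuc s" "code m (C t1) = e" "\<forall>r. osuc s \<le> r \<longrightarrow> r \<le> t1 \<longrightarrow> ge (code m (C r)) u"
        unfolding sound_def by blast
      have "sound C (round_fact u e (Suc k) n')"
        by (rule prem) (use 2 f in \<open>auto simp: premise_def\<close>)
      then obtain t where t: "rounds m C u (Suc k) n' t1 t" using t1(2) unfolding sound_def by blast
      have "rounds m C u k (Suc n') s t"
        by (rule rounds_Cons[OF _ _ _ t]) (use t1 2 osuc_le less_le_trans[OF osuc_gt] in auto)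
      then show ?thesis using 2 by blast
    qed simp
  qed
qed

text \<open>An infinite path in \<open>climb\<close> marks increasing times of the run. At their
  supremum the components in \<open>A\<close> have overflowed, since the floors tend to infinity,
  while the others take their values in \<open>d\<close> cofinally often and stay above
  them.\<close>

lemma overflow_sound:
  assumes T: "timeline P x C" and W: "\<And>f. f \<in> W \<Longrightarrow> sound C f"
  shows "sound_limit C (overflow P m W x)"
  unfolding sound_limit_def
proof (intro allI impI)
  fix d e s assume ov: "overflow P m W x d e" and d: "length (list_decode d) = m" and e: "code m (C s) = e"
  obtain A where A: "A \<subseteq> {..<m}" "\<And>i. i \<in> A \<Longrightarrow> nthc d i 0"
    and g0: "climb_pos 0 e d \<in> gset (\<lambda>_ _ _. False) (climb P A W x)"
    using ov unfolding overflow_def by auto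
  let ?V = "gset (\<lambda>_ _ _. False) (climb P A W x)"
  define Q where "Q n t \<longleftrightarrow> climb_pos n (code m (C t)) d \<in> ?V" for n t
  define low where "low n r \<longleftrightarrow> (\<forall>i a. nthc d i a \<longrightarrow> (if i \<in> A then Suc n else a) \<le> comp_of i (C r))" for n r
  have ex: "\<exists>t'>t. Q (Suc n) t' \<and> (\<forall>r. t < r \<longrightarrow> r \<le> t' \<longrightarrow> low n r) \<and> hit A n (code m (C t')) d"
    if q: "Q n t" for n t
  proof -
    obtain b where b: "climb P A W x (climb_pos n (code m (C t)) d) 0 b" "b \<in> ?V"
      using q[unfolded Q_def, THEN gset_unfold[THEN iffD1], THEN spec, of 0] by blast
    then obtain e' w c' where e': "b = climb_pos (Suc n) e' d" "raised A d n w" "step_rel P x (code m (C t)) c'"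
      "reach_fact w c' e' \<in> W" "hit A n e' d" unfolding climb_def by auto
    have "c' = code m (C (osuc t))" using e'(3) step_timeline[OF T] by simp
    then obtain t' where t': "t' \<ge> osuc t" "code m (C t') = e'"
      "\<forall>u. osuc t \<le> u \<longrightarrow> u \<le> t' \<longrightarrow> ge (code m (C u)) w"
      using W[OF e'(4)] unfolding sound_def by blast
    have "low n r" if r: "t < r" "r \<le> t'" for r
    proof -
      have "ge (code m (C r)) w" using t'(3) osuc_le[OF r(1)] r(2) by blast
      moreover have "nthc w i (if i \<in> A then Suc n else a)" if "nthc d i a" for i a
        using e'(2) that unfolding raised_def by auto
      ultimately show ?thesis unfolding low_def ge_code by blast
    qed
    moreover have "t < t'" using t'(1) osuc_gt less_le_trans by blast
    moreover have "Q (Suc n) t'" using b(2) e'(1) t'(2) by (simp add: Q_def)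
    ultimately show ?thesis using e'(5) t'(2) by blast
  qed
  define nx where "nx n t = (SOME t'. t' > t \<and> Q (Suc n) t' \<and> (\<forall>r. t < r \<longrightarrow> r \<le> t' \<longrightarrow> low n r) \<and> hit A n (code m (C t')) d)" for n t
  have nx: "nx n t > t \<and> Q (Suc n) (nx n t) \<and> (\<forall>r. t < r \<longrightarrow> r \<le> nx n t \<longrightarrow> low n r) \<and> hit A n (code m (C (nx n t))) d"
    if "Q n t" for n t unfolding nx_def by (rule someI_ex) (rule ex[OF that])
  define \<tau> where "\<tau> = rec_nat s nx"
  have t0: "\<tau> 0 = s" and tS: "\<tau> (Suc n) = nx n (\<tau> n)" for n by (simp_all add: \<tau>_def)
  have Q: "Q n (\<tau> n)" for n
  proof (induction n)
    case 0 then show ?case using g0 e by (simp add: Q_def t0)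
  next
    case (Suc n) then show ?case using nx tS by simp
  qed
  have lt: "\<tau> n < \<tau> (Suc n)" and low: "\<And>r. \<tau> n < r \<Longrightarrow> r \<le> \<tau> (Suc n) \<Longrightarrow> low n r"
    and hit: "hit A n (code m (C (\<tau> (Suc n)))) d" for n
    using nx[OF Q[of n]] by (simp_all add: tS)
  obtain l where l: "olimit l" "\<And>n. \<tau> n < l" "\<And>u. u < l \<Longrightarrow> \<exists>n. u < \<tau> n" using osup[of \<tau>, OF lt] by blast
  have mono: "\<tau> a \<le> \<tau> b" if "a \<le> b" for a b
    using lift_Suc_mono_le[of \<tau>, OF _ that] lt by (simp add: less_imp_le)
  have lown: "\<exists>n\<ge>N. low n u" if u: "\<tau> N < u" "u < l" for u N
  proof -
    define k where "k = (LEAST k. u \<le> \<tau> k)"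
    have k: "u \<le> \<tau> k" unfolding k_def using l(3)[OF u(2)] by (meson LeastI less_imp_le)
    have "N < k" using k u(1) mono by (meson leD le_less_linear order_trans)
    then obtain n where n: "k = Suc n" by (cases k) auto
    then have "\<tau> n < u" using not_less_Least[of n "\<lambda>k. u \<le> \<tau> k"] by (simp add: k_def)
    then have "low n u" using low k n by simp
    then show ?thesis using n \<open>N < k\<close> by (intro exI[of _ n]) auto
  qed
  have ge: "ge (code m (C u)) d" if u: "s < u" "u < l" for u
  proof -
    obtain n where "low n u" using lown[of 0 u] u t0 by auto
    then show ?thesis unfolding ge_code low_def
      using A(2) nthc_unique nthc_length[OF d] by (metis (full_types) le0)
  qed
  have "code m (C l) = d"
  proof (rule code_eqI[OF d])
    fix i a assume a: "nthc d i a"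
    show "comp_of i (C l) = a"
    proof (cases "i \<in> A")
      case True
      then have "a = 0" using A(2) a nthc_unique by blast
      moreover have "comp_of i (C l) = 0"
      proof (rule timeline_lim_zeroI[OF T l(1)])
        fix M
        have "M \<le> comp_of i (C u)" if u: "\<tau> (Suc M) \<le> u" "u < l" for u
        proof -
          have "\<tau> M < u" using lt[of M] u(1) by (rule less_le_trans)
          then obtain n where n: "n \<ge> M" "low n u" using lown[OF _ u(2)] by blast
          have "(if i \<in> A then Suc n else a) \<le> comp_of i (C u)" using n(2) a unfolding low_def by blast
          then show ?thesis using True n(1) by simp
        qed
        then show "\<exists>s<l. \<forall>u\<ge>s. u < l \<longrightarrow> comp_of i (C u) = 0 \<or> M \<le> comp_of i (C u)"
          using l(2) by blast
      qed
      ultimately show ?thesis by simp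
    next
      case False
      show ?thesis
      proof (rule timeline_lim_eqI[OF T l(1) l(2)[of 1]])
        fix u assume "\<tau> 1 \<le> u" "u < l"
        then show "a \<le> comp_of i (C u)" using ge[of u] a lt[of 0] t0 by (auto simp: ge_code)
      next
        fix u assume "u < l"
        then obtain n where n: "u < \<tau> n" using l(3) by blast
        define k where "k = prod_encode (i, n)"
        have "n \<le> Suc k" unfolding k_def using le_prod_encode_2[of n i] by simp
        then have "u < \<tau> (Suc k)" using mono n by (meson less_le_trans)
        moreover have "comp_of i (C (\<tau> (Suc k))) = a"
          using hit[of k] a False by (auto simp: hit_def k_def nthc_code)
        ultimately show "\<exists>u'\<ge>u. u' < l \<and> comp_of i (C u') = a"
          using l(2) by (intro exI[of _ "\<tau> (Suc k)"]) simp
      qed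
    qed
  qed
  then show "\<exists>l>s. code m (C l) = d \<and> (\<forall>u. s < u \<longrightarrow> u < l \<longrightarrow> ge (code m (C u)) d)"
    using ge l(2)[of 0] t0 by blast
qed

lemma facts_sound: "timeline P x C \<Longrightarrow> f \<in> facts P m k x \<Longrightarrow> sound C f"
proof (induction k arbitrary: f)
  case 0
  show ?case by (rule lset_sound[OF 0(1) _ 0(2)[unfolded facts.simps]]) (simp add: sound_limit_def)
next
  case (Suc k)
  show ?case
    by (rule lset_sound[OF Suc(2) overflow_sound[OF Suc(2) Suc.IH] Suc(3)[unfolded facts.simps]]) (rule Suc(2))
qed

end

section \<open>Completeness of the facts\<close>

lemma timeline_lim_cases:
  assumes T: "timeline P x C" and l: "olimit t"
  shows "(\<exists>s<t. \<forall>u. s \<le> u \<longrightarrow> u < t \<longrightarrow> comp_of i (C t) \<le> comp_of i (C u)) \<and>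
      (\<forall>s<t. \<exists>u. s \<le> u \<and> u < t \<and> comp_of i (C u) = comp_of i (C t)) \<or>
    comp_of i (C t) = 0 \<and> (\<forall>M. \<exists>s<t. \<forall>u. s \<le> u \<longrightarrow> u < t \<longrightarrow> M \<le> comp_of i (C u))"
proof -
  have "underS le1 t \<noteq> {}" using l by (auto simp: olimit_def)
  from lim_val_cases[OF Well_order_le1 this, of "\<lambda>s. comp_of i (C s)"]
  show ?thesis unfolding timeline_lim[OF T l, symmetric] by (simp add: Ball_def Bex_def conj_comms) meson
qed

text \<open>A maximum of finitely many stages. Applied to the components of a configuration, it
  gives one stage from which all floors hold.\<close>

lemma finite_tail:
  fixes s t :: omega1 and m :: nat
  assumes "s < t" "\<And>i. i < m \<Longrightarrow> \<exists>z<t. \<forall>u. z \<le> u \<longrightarrow> u < t \<longrightarrow> Q i u"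
  shows "\<exists>z\<ge>s. z < t \<and> (\<forall>i<m. \<forall>u. z \<le> u \<longrightarrow> u < t \<longrightarrow> Q i u)"
  using assms(2)
proof (induction m)
  case 0 then show ?case using assms(1) by auto
next
  case (Suc m)
  obtain z where z: "z \<ge> s" "z < t" "\<And>i u. i < m \<Longrightarrow> z \<le> u \<Longrightarrow> u < t \<Longrightarrow> Q i u" using Suc by (metis less_SucI)
  obtain z' where z': "z' < t" "\<And>u. z' \<le> u \<Longrightarrow> u < t \<Longrightarrow> Q m u" using Suc.prems[of m] by blast
  have "Q i u" if "i < Suc m" "max z z' \<le> u" "u < t" for i u
    using z(3)[of i u] z'(2)[of u] that by (auto simp: less_Suc_eq)
  then show ?case using z z' by (intro exI[of _ "max z z'"]) (auto simp: le_max_iff_disj)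
qed

context
  fixes P :: program and m :: nat and x :: "nat set"
begin

lemma facts_unfold: "facts P m k x = lset (side P m (case k of 0 \<Rightarrow> \<lambda>_ _. False
    | Suc j \<Rightarrow> overflow P m (facts P m j x) x) x) (premise P x)"
  by (cases k) simp_all

lemma reach_refl: "ge c v \<Longrightarrow> reach_fact v c c \<in> facts P m k x"
  unfolding facts_unfold[of k]
  by (rule lset_intro[where a = "choice_code 0 0"]) (auto simp: side_def premise_def)

lemma reach_step:
  assumes "reach_fact v c e \<in> facts P m k x" "step_rel P x e d" "ge d v"
  shows "reach_fact v c d \<in> facts P m k x"
  unfolding facts_unfold[of k]
proof (rule lset_intro[where a = "choice_code 1 e"], unfold facts_unfold[symmetric])
  show "g \<in> facts P m k x" if "premise P x (reach_fact v c d) (choice_code 1 e) g" for g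
    using that assms(1) by (auto simp: premise_def)
qed (use assms(2,3) in \<open>auto simp: side_def\<close>)

lemma reach_limit:
  assumes "reach_fact v c e \<in> facts P m k x" "length (list_decode d) = m" "ge d v"
    "\<And>n. round_fact d e 0 n \<in> facts P m k x"
  shows "reach_fact v c d \<in> facts P m k x"
  unfolding facts_unfold[of k]
proof (rule lset_intro[where a = "choice_code 2 e"], unfold facts_unfold[symmetric])
  show "g \<in> facts P m k x" if "premise P x (reach_fact v c d) (choice_code 2 e) g" for g
    using that assms(1,4) by (auto simp: premise_def)
qed (use assms(2,3) in \<open>auto simp: side_def\<close>)

lemma reach_overflow:
  assumes "reach_fact v c e \<in> facts P m (Suc k) x" "length (list_decode d) = m" "ge d v"
    "overflow P m (facts P m k x) x d e"
  shows "reach_fact v c d \<in> facts P m (Suc k) x"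
  unfolding facts.simps(2)
proof (rule lset_intro[where a = "choice_code 3 e"], unfold facts.simps(2)[symmetric])
  show "g \<in> facts P m (Suc k) x" if "premise P x (reach_fact v c d) (choice_code 3 e) g" for g
    using that assms(1) by (auto simp: premise_def simp del: facts.simps)
qed (use assms(2-4) in \<open>auto simp: side_def\<close>)

lemma round_zero: "round_fact u c k 0 \<in> facts P m l x"
  unfolding facts_unfold[of l]
  by (rule lset_intro[where a = "choice_code 0 0"]) (auto simp: side_def premise_def)

lemma round_Suc:
  assumes "\<And>c'. step_rel P x c c' \<Longrightarrow> reach_fact u c' e \<in> facts P m l x" "hit {} k e u"
    "round_fact u e (Suc k) n \<in> facts P m l x"
  shows "round_fact u c k (Suc n) \<in> facts P m l x"
  unfolding facts_unfold[of l]
proof (rule lset_intro[where a = "choice_code 4 e"], unfold facts_unfold[symmetric])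
  show "g \<in> facts P m l x" if "premise P x (round_fact u c k (Suc n)) (choice_code 4 e) g" for g
    using that assms(1,3) by (auto simp: premise_def)
qed (use assms(2) in \<open>auto simp: side_def\<close>)

text \<open>Induction on the end \<open>t\<close>. \<open>S\<close> collects the components that may
  overflow after \<open>s\<close> and up to \<open>t\<close>, and \<open>k\<close> bounds their
  number. All of \<open>s\<close>, \<open>v\<close>, \<open>S\<close> and \<open>k\<close> vary,
  since the stretches before a limit start later, have another floor and may overflow in fewer
  components.\<close>

lemma facts_complete:
  assumes wf: "\<forall>I\<in>set P. \<forall>n\<in>regs I. Suc n < m" and m0: "0 < m" and T: "timeline P x C"
  assumes "s \<le> t" "\<And>u. s \<le> u \<Longrightarrow> u \<le> t \<Longrightarrow> ge (code m (C u)) v"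
    and "S \<subseteq> {..<m}" "card S \<le> k"
    and "\<And>u i. s < u \<Longrightarrow> u \<le> t \<Longrightarrow> olimit u \<Longrightarrow> i < m \<Longrightarrow>
      (\<forall>M. \<exists>z<u. \<forall>w. z \<le> w \<longrightarrow> w < u \<longrightarrow> M \<le> comp_of i (C w)) \<Longrightarrow> comp_of i (C u) = 0 \<Longrightarrow> i \<in> S"
  shows "reach_fact v (code m (C s)) (code m (C t)) \<in> facts P m k x"
  using assms(4-)
proof (induction t arbitrary: s v S k rule: less_induct)
  case (less t)
  note IH = less.IH and st = less.prems(1) and fl = less.prems(2) and S = less.prems(3,4) and ov = less.prems(5)
  have step: "step_rel P x (code m (C u)) d \<longleftrightarrow> d = code m (C (osuc u))" for u d
    by (rule step_timeline[OF wf m0 T])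
  show ?case
  proof (cases "s = t")
    case True
    then show ?thesis using fl by (auto intro: reach_refl)
  next
    case False
    then have slt: "s < t" using st by simp
    show ?thesis
    proof (cases t rule: omega1_cases)
      case bot
      then show ?thesis using slt by (simp add: not_less[symmetric])
    next
      case (suc p)
      have sp: "s \<le> p" using slt suc by (simp add: less_osuc_iff)
      have "reach_fact v (code m (C s)) (code m (C p)) \<in> facts P m k x"
        by (rule IH[OF _ sp _ S]) (use suc fl ov less_imp_le[OF osuc_gt[of p]] in \<open>auto intro: order_trans\<close>)
      then show ?thesis by (rule reach_step) (use step suc fl st in auto)
    next
      case lim
      \<comment> \<open>The components for which the first alternative of
        \<open>timeline_lim_cases\<close> fails, so that they overflow at \<open>t\<close>.\<close>
      define A where "A = {i. i < m \<and> \<not> ((\<exists>z<t. \<forall>u. z \<le> u \<longrightarrow> u < t \<longrightarrow> comp_of i (C t) \<le> comp_of i (C u)) \<and>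
        (\<forall>z<t. \<exists>u. z \<le> u \<and> u < t \<and> comp_of i (C u) = comp_of i (C t)))}"
      have A: "comp_of i (C t) = 0" "\<And>M. \<exists>z<t. \<forall>u. z \<le> u \<longrightarrow> u < t \<longrightarrow> M \<le> comp_of i (C u)" if "i \<in> A" for i
        using timeline_lim_cases[OF T lim, of i] that unfolding A_def by blast+
      have nA: "\<exists>z<t. \<forall>u. z \<le> u \<longrightarrow> u < t \<longrightarrow> comp_of i (C t) \<le> comp_of i (C u)"
        "\<And>z. z < t \<Longrightarrow> \<exists>u. z \<le> u \<and> u < t \<and> comp_of i (C u) = comp_of i (C t)" if "i < m" "i \<notin> A" for i
        using that unfolding A_def by blast+
      have Am: "A \<subseteq> {..<m}" by (auto simp: A_def)
      have AS: "A \<subseteq> S"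
      proof
        fix i assume i: "i \<in> A"
        show "i \<in> S" by (rule ov[OF slt order_refl lim]) (use i A[OF i] Am in auto)
      qed
      define d where "d = code m (C t)"
      have dl: "length (list_decode d) = m" by (simp add: d_def length_code)
      have dn: "nthc d i a \<longleftrightarrow> i < m \<and> a = comp_of i (C t)" for i a by (simp add: d_def nthc_code)
      have dv: "ge d v" unfolding d_def using fl st by blast
      \<comment> \<open>A stage \<open>z\<close> from which the components in \<open>A\<close> are
        positive and no other component falls below its limit value.\<close>
      have "\<exists>z\<ge>s. z < t \<and> (\<forall>i<m. \<forall>u. z \<le> u \<longrightarrow> u < t \<longrightarrow> (if i \<in> A then 1 else comp_of i (C t)) \<le> comp_of i (C u))"
      proof (rule finite_tail[OF slt])
        fix i assume "i < m"
        then show "\<exists>z<t. \<forall>u. z \<le> u \<longrightarrow> u < t \<longrightarrow> (if i \<in> A then 1 else comp_of i (C t)) \<le> comp_of i (C u)"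
          using nA(1)[of i] A(2)[of i 1] by (cases "i \<in> A") simp_all
      qed
      then obtain z where z: "z \<ge> s" "z < t"
        and zt: "\<And>i u. i < m \<Longrightarrow> z \<le> u \<Longrightarrow> u < t \<Longrightarrow> (if i \<in> A then 1 else comp_of i (C t)) \<le> comp_of i (C u)" by blast
      \<comment> \<open>If the pair \<open>j\<close> does not name a component outside
        \<open>A\<close>, there is nothing to hit and \<open>y\<close> itself will do.\<close>
      have hits: "\<exists>t1\<ge>y. t1 < t \<and> hit A j (code m (C t1)) d" if y: "y < t" for y j
      proof -
        obtain i l where j: "j = prod_encode (i, l)" by (metis prod_decode_inverse surj_pair)
        show ?thesis
        proof (cases "i < m \<and> i \<notin> A")
          case True
          then obtain u where "y \<le> u" "u < t" "comp_of i (C u) = comp_of i (C t)" using nA(2)[of i y] y by blast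
          then show ?thesis using True by (intro exI[of _ u]) (auto simp: hit_def j dn nthc_code)
        next
          case False
          then show ?thesis using y by (intro exI[of _ y]) (auto simp: hit_def j dn)
        qed
      qed
      have sub: "i \<in> S" if "s < u" "u < t" "olimit u" "i < m"
        "\<forall>M. \<exists>z<u. \<forall>w. z \<le> w \<longrightarrow> w < u \<longrightarrow> M \<le> comp_of i (C w)" "comp_of i (C u) = 0" for u i
        using ov[of u i] that by simp
      have next_lt: "osuc u < t" if "u < t" for u using lim that by (simp add: olimit_def)
      \<comment> \<open>Up to \<open>z\<close> the level remains \<open>k\<close>; only the
        stretches after \<open>z\<close> can be treated at a lower one.\<close>
      have rz: "reach_fact v (code m (C s)) (code m (C z)) \<in> facts P m k x"
        by (rule IH[OF z(2) z(1) _ S]) (use z fl ov in \<open>auto intro: less_imp_le order_trans\<close>)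
      show ?thesis
      proof (cases "A = {}")
        case True
        have "round_fact d (code m (C u)) j n \<in> facts P m k x" if "z \<le> u" "u < t" for u j n
          using that
        proof (induction n arbitrary: u j)
          case 0 then show ?case by (simp add: round_zero)
        next
          case (Suc n)
          obtain t1 where t1: "t1 \<ge> osuc u" "t1 < t" "hit {} j (code m (C t1)) d"
            using hits[OF next_lt[OF Suc.prems(2)]] True by blast
          have zu: "z < osuc u" using Suc.prems(1) by (simp add: less_osuc_iff)
          show ?case
          proof (rule round_Suc[OF _ t1(3)])
            fix c' assume "step_rel P x (code m (C u)) c'"
            then have c': "c' = code m (C (osuc u))" by (simp add: step)
            show "reach_fact d c' (code m (C t1)) \<in> facts P m k x" unfolding c'
            proof (rule IH[OF t1(2,1) _ S])
              fix w assume w: "osuc u \<le> w" "w \<le> t1"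
              have "z \<le> w" "w < t" using w zu t1(2) by (auto intro: less_imp_le order_trans le_less_trans)
              then show "ge (code m (C w)) d" unfolding ge_code dn using zt True by auto
            next
              fix w i assume w: "osuc u < w" "w \<le> t1" "olimit w" "i < m"
                "\<forall>M. \<exists>z<w. \<forall>wa\<ge>z. wa < w \<longrightarrow> M \<le> comp_of i (C wa)" "comp_of i (C w) = 0"
              have "s < w" "w < t" using z(1) zu w(1,2) t1(2) by (auto intro: le_less_trans less_trans)
              then show "i \<in> S" using sub w(3-6) by blast
            qed
          next
            show "round_fact d (code m (C t1)) (Suc j) n \<in> facts P m k x"
              by (rule Suc.IH) (use zu t1 in \<open>auto intro: less_imp_le order_trans\<close>)
          qed
        qed
        then have "round_fact d (code m (C z)) 0 n \<in> facts P m k x" for n using z(2) by simp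
        then show ?thesis unfolding d_def[symmetric] by (rule reach_limit[OF rz dl dv])
      next
        case False
        have fS: "finite S" using S(1) finite_subset by blast
        have "card A \<le> card S" by (rule card_mono[OF fS AS])
        moreover have "card A \<noteq> 0" using False AS fS by (meson card_0_eq finite_subset)
        ultimately obtain k' where k': "k = Suc k'" using S(2) by (cases k) auto
        have S': "S - A \<subseteq> {..<m}" "card (S - A) \<le> k'"
          using S card_Diff_subset[OF finite_subset[OF AS fS] AS] \<open>card A \<noteq> 0\<close> k' by auto
        \<comment> \<open>The invariant of the climb: counter \<open>n\<close> may be claimed at
          \<open>u\<close> once the components in \<open>A\<close> stay above \<open>n\<close> from
          \<open>u\<close> until \<open>t\<close>.\<close>
        let ?V = "{N. \<exists>n u. N = climb_pos n (code m (C u)) d \<and> z \<le> u \<and> u < t \<and>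
           (\<forall>i\<in>A. \<forall>w. u \<le> w \<longrightarrow> w < t \<longrightarrow> Suc n \<le> comp_of i (C w))}"
        have "climb_pos 0 (code m (C z)) d \<in> gset (\<lambda>_ _ _. False) (climb P A (facts P m k' x) x)"
        proof (rule gset_coinduct[where V = ?V])
          have "\<forall>i\<in>A. \<forall>w. z \<le> w \<longrightarrow> w < t \<longrightarrow> Suc 0 \<le> comp_of i (C w)" using zt Am by fastforce
          then show "climb_pos 0 (code m (C z)) d \<in> ?V" using z(2) by blast
          fix N a assume "N \<in> ?V"
          then obtain n u where N: "N = climb_pos n (code m (C u)) d" and u: "z \<le> u" "u < t"
            and uA: "\<And>i w. i \<in> A \<Longrightarrow> u \<le> w \<Longrightarrow> w < t \<Longrightarrow> Suc n \<le> comp_of i (C w)" by blast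
          have "\<exists>y\<ge>osuc u. y < t \<and> (\<forall>i<m. \<forall>w. y \<le> w \<longrightarrow> w < t \<longrightarrow> i \<in> A \<longrightarrow> Suc (Suc n) \<le> comp_of i (C w))"
          proof (rule finite_tail[OF next_lt[OF u(2)]])
            fix i
            show "\<exists>z<t. \<forall>w. z \<le> w \<longrightarrow> w < t \<longrightarrow> i \<in> A \<longrightarrow> Suc (Suc n) \<le> comp_of i (C w)"
              using A(2)[of i "Suc (Suc n)"] z(2) by (cases "i \<in> A") auto
          qed
          then obtain y where y: "y \<ge> osuc u" "y < t"
            and yA: "\<And>i w. i < m \<Longrightarrow> y \<le> w \<Longrightarrow> w < t \<Longrightarrow> i \<in> A \<Longrightarrow> Suc (Suc n) \<le> comp_of i (C w)" by blast
          obtain t1 where t1: "t1 \<ge> y" "t1 < t" "hit A n (code m (C t1)) d" using hits[OF y(2)] by blast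
          have ut1: "osuc u \<le> t1" using y(1) t1(1) by (rule order_trans)
          have zu: "z < osuc u" using u(1) by (simp add: less_osuc_iff)
          define w where "w = list_encode (map (\<lambda>i. if i \<in> A then Suc n else comp_of i (C t)) [0..<m])"
          have wn: "nthc w i b \<longleftrightarrow> i < m \<and> b = (if i \<in> A then Suc n else comp_of i (C t))" for i b
            by (auto simp: nthc_def w_def)
          have rw: "raised A d n w" unfolding raised_def wn dn by auto
          have "reach_fact w (code m (C (osuc u))) (code m (C t1)) \<in> facts P m k' x"
          proof (rule IH[OF t1(2) ut1 _ S'])
            fix r assume r: "osuc u \<le> r" "r \<le> t1"
            have rr: "z \<le> r" "r < t" "u \<le> r" using r zu t1(2) less_imp_le[OF osuc_gt[of u]]
              by (auto intro: less_imp_le order_trans le_less_trans)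
            have "(if i \<in> A then Suc n else comp_of i (C t)) \<le> comp_of i (C r)" if "i < m" for i
              using zt[of i r] uA[of i r] rr that by (cases "i \<in> A") simp_all
            then show "ge (code m (C r)) w" unfolding ge_code wn by simp
          next
            fix r i assume r: "osuc u < r" "r \<le> t1" "olimit r" "i < m"
                "\<forall>M. \<exists>z<r. \<forall>wa\<ge>z. wa < r \<longrightarrow> M \<le> comp_of i (C wa)" "comp_of i (C r) = 0"
            have rr: "s < r" "r < t" "u \<le> r" using z(1) zu r(1,2) t1(2) less_trans[OF osuc_gt r(1)]
              by (auto intro: le_less_trans less_trans)
            then have "i \<in> S" using sub r(3-6) by blast
            \<comment> \<open>A component in \<open>A\<close> is at least \<open>n + 1\<close> at
              \<open>r\<close>, so it has not been reset there; this is the gain of a level.\<close>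
            moreover have "i \<notin> A" using uA[of i r] rr r(6) by auto
            ultimately show "i \<in> S - A" by blast
          qed
          then have "climb P A (facts P m k' x) x N a (climb_pos (Suc n) (code m (C t1)) d)"
            unfolding climb_def N using rw step t1(3) by blast
          moreover have "\<forall>i\<in>A. \<forall>w. t1 \<le> w \<longrightarrow> w < t \<longrightarrow> Suc (Suc n) \<le> comp_of i (C w)"
            using yA Am t1(1) by (auto intro: order_trans)
          then have "climb_pos (Suc n) (code m (C t1)) d \<in> ?V"
            using t1(2) ut1 zu by (auto intro: less_imp_le less_le_trans)
          ultimately show "\<exists>b. False \<or> climb P A (facts P m k' x) x N a b \<and> b \<in> ?V" by blast
        qed
        then have "overflow P m (facts P m k' x) x d (code m (C z))"
          unfolding overflow_def using Am A(1) by (intro bexI[of _ A]) (auto simp: dn)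
        then show ?thesis unfolding d_def[symmetric] k'
          by (intro reach_overflow[OF _ dl dv]) (use rz k' in auto)
      qed
    qed
  qed
qed

end

text \<open>Output 1 means that the code of some halting configuration with 1 in register 0 is
  reachable. Level \<open>m\<close> suffices because a configuration has only \<open>m\<close>
  relevant components. For the converse, a halted run is frozen, so its halting configuration is
  unique.\<close>

theorem decided_definable:
  assumes dec: "\<And>x. itrm_outputs P x (if x \<in> X then 1 else 0)"
  shows "definable (\<lambda>x \<rho>. x \<in> X)"
proof -
  have "finite (insert 0 (\<Union>I\<in>set P. regs I))"
  proof -
    have "finite (regs I)" for I by (cases I) auto
    then show ?thesis by blast
  qed
  then obtain N where N: "\<forall>n\<in>insert 0 (\<Union>I\<in>set P. regs I). n < N"
    using finite_nat_set_iff_bounded by blast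
  define m where "m = Suc N"
  have wf: "\<forall>I\<in>set P. \<forall>n\<in>regs I. Suc n < m" and m0: "0 < m" and m1: "Suc 0 < m" using N by (auto simp: m_def)
  define c0 where "c0 = code m (0, \<lambda>_. 0)"
  \<comment> \<open>The floor \<open>z = 0\<close> is empty. With \<open>i = Suc 0\<close>, the
    clause \<open>nthc d i i\<close> says that component 1, which is register 0, contains 1.\<close>
  have eq: "x \<in> X \<longleftrightarrow> (\<exists>d. (\<exists>z. z = 0 \<and> (\<exists>c. c = c0 \<and> (\<exists>f. f = reach_fact z c d \<and> f \<in> facts P m m x))) \<and>
     (\<exists>z. z = 0 \<and> (\<exists>l. nthc d z l \<and> (\<exists>n. n = length P \<and> n \<le> l))) \<and> (\<exists>i. i = Suc 0 \<and> nthc d i i))" for x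
  proof -
    obtain C where T: "timeline P x C" using timeline_exists by blast
    define b :: omega1 where "b = (LEAST t. True)"
    have b: "b \<le> u" for u unfolding b_def by (rule Least_le) simp
    have Cb: "C b = (0, \<lambda>_. 0)" by (rule T[unfolded timeline_def, THEN conjunct1, THEN spec, THEN mp]) (use b in blast)
    obtain t where t: "length P \<le> fst (C t)" "snd (C t) 0 = (if x \<in> X then 1 else 0)"
      using outputs_timeline[OF T dec] by blast
    have "reach_fact 0 (code m (C b)) (code m (C t)) \<in> facts P m m x"
      by (rule facts_complete[where S = "{..<m}", OF wf m0 T b]) (auto simp: ge_def nthc_def)
    then have r: "reach_fact 0 c0 (code m (C t)) \<in> facts P m m x" by (simp add: Cb c0_def)
    show ?thesis
    proof
      assume "x \<in> X"
      then have "nthc (code m (C t)) 0 (fst (C t))" "nthc (code m (C t)) (Suc 0) (Suc 0)"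
        using t(2) m1 by (auto simp: nthc_code comp_of_def)
      then show "\<exists>d. (\<exists>z. z = 0 \<and> (\<exists>c. c = c0 \<and> (\<exists>f. f = reach_fact z c d \<and> f \<in> facts P m m x))) \<and>
         (\<exists>z. z = 0 \<and> (\<exists>l. nthc d z l \<and> (\<exists>n. n = length P \<and> n \<le> l))) \<and> (\<exists>i. i = Suc 0 \<and> nthc d i i)"
        using r t(1) by blast
    next
      assume "\<exists>d. (\<exists>z. z = 0 \<and> (\<exists>c. c = c0 \<and> (\<exists>f. f = reach_fact z c d \<and> f \<in> facts P m m x))) \<and>
         (\<exists>z. z = 0 \<and> (\<exists>l. nthc d z l \<and> (\<exists>n. n = length P \<and> n \<le> l))) \<and> (\<exists>i. i = Suc 0 \<and> nthc d i i)"
      then obtain d l where d: "reach_fact 0 c0 d \<in> facts P m m x" "nthc d 0 l" "length P \<le> l" "nthc d (Suc 0) (Suc 0)"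
        by (elim exE conjE) simp
      have "code m (C b) = c0" by (simp add: Cb c0_def)
      then obtain t' where t': "code m (C t') = d"
        using facts_sound[OF wf m0 T d(1), unfolded sound_def[OF wf m0], THEN conjunct1, THEN spec, THEN spec,
          THEN spec, THEN spec, THEN mp, THEN mp, OF refl] by blast
      have "comp_of 0 (C t') = l" "comp_of (Suc 0) (C t') = Suc 0"
        using d(2,4) nthc_code[of m "C t'"] unfolding t' by metis+
      then have h: "length P \<le> fst (C t')" "snd (C t') 0 = 1"
        using d(3) by (simp_all add: comp_of_def)
      have "C t = C t'"
      proof (cases "t \<le> t'")
        case True then show ?thesis by (rule timeline_halted[OF T t(1), symmetric])
      next
        case False
        then have "t' \<le> t" by simp
        then show ?thesis by (rule timeline_halted[OF T h(1)])
      qed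
      then have "(if x \<in> X then 1 else 0) = (1 :: nat)" using t(2) h(2) by (simp only:)
      then show "x \<in> X" by (rule contrapos_pp) simp
    qed
  qed
  show ?thesis unfolding eq
    by (intro definable_intros definable_arith definable_const definable_reach_fact definable_facts)
qed

section \<open>Meager sets and the main theorem\<close>

abbreviation chi :: "nat set \<Rightarrow> nat \<Rightarrow> bool" where "chi \<equiv> \<lambda>x n. n \<in> x"

lemma cyl_approx: "z \<in> cyl (approx y n) \<longleftrightarrow> (\<forall>i<n. i \<in> z \<longleftrightarrow> i \<in> y)"
  by (auto simp: cyl_def nthc_approx)

lemma cyl_agree: "y \<in> cyl p \<Longrightarrow> \<forall>i<length (list_decode p). i \<in> y \<longleftrightarrow> i \<in> z \<Longrightarrow> z \<in> cyl p"
  by (auto simp: cyl_def nthc_def)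

lemma cyl_nonempty: "\<exists>y. y \<in> cyl p" using not_mgr_cyl[of p] mgr_empty by (metis ex_in_conv)

lemma inj_chi: "inj chi" by (auto simp: inj_def fun_eq_iff)

lemma chi_Collect: "chi {n. f n} = f" by simp

lemma open_chi_cyl: "open (chi ` cyl p)"
proof -
  have "chi ` cyl p = (\<Inter>i\<in>{..<length (list_decode p)}. (\<lambda>f. f i) -` {list_decode p ! i \<noteq> 0})"
  proof (intro equalityI subsetI)
    fix f assume "f \<in> (\<Inter>i\<in>{..<length (list_decode p)}. (\<lambda>f. f i) -` {list_decode p ! i \<noteq> 0})"
    then have "{n. f n} \<in> cyl p" by (auto simp: cyl_def nthc_def)
    then show "f \<in> chi ` cyl p" by (rule rev_image_eqI) simp
  qed (auto simp: cyl_def nthc_def)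
  moreover have "open ((\<lambda>f :: nat \<Rightarrow> bool. f i) -` {b})" for i b
    by (intro open_vimage open_discrete continuous_on_product_coordinates)
  ultimately show ?thesis by (simp add: open_INT)
qed

lemma chi_cyl_basis:
  assumes "open U" "f \<in> U"
  shows "\<exists>p. {n. f n} \<in> cyl p \<and> chi ` cyl p \<subseteq> U"
proof -
  have "openin (product_topology (\<lambda>i. euclidean) UNIV) U" using assms(1) by (simp add: open_fun_def)
  from product_topology_open_contains_basis[OF this assms(2)]
  obtain X where X: "f \<in> (\<Pi>\<^sub>E i\<in>UNIV. X i)" "finite {i. X i \<noteq> topspace euclidean}" "(\<Pi>\<^sub>E i\<in>UNIV. X i) \<subseteq> U"
    by blast
  obtain n where n: "\<forall>i\<in>{i. X i \<noteq> topspace euclidean}. i < n"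
    using X(2) finite_nat_set_iff_bounded by blast
  have "chi z \<in> U" if z: "z \<in> cyl (approx {n. f n} n)" for z
  proof -
    have "chi z i \<in> X i" for i
    proof (cases "i < n")
      case True
      then have "chi z i = f i" using z by (simp add: cyl_approx)
      then show ?thesis using X(1) by (auto simp: PiE_def Pi_def)
    next
      case False
      then have "X i = UNIV" using n by auto
      then show ?thesis by simp
    qed
    then show ?thesis using X(3) by (auto simp: PiE_def Pi_def)
  qed
  then show ?thesis using in_cyl_approx by blast
qed

text \<open>Cylinders form a basis, and an open set misses the closure of a set iff it misses the
  set itself.\<close>

lemma nowhere_dense_chi: "nowhere_dense (chi ` F) \<longleftrightarrow> nwd F"
proof
  assume nd: "nowhere_dense (chi ` F)"
  show "nwd F" unfolding nwd_def
  proof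
    fix p
    have "\<not> chi ` cyl p \<subseteq> closure (chi ` F)"
    proof
      assume "chi ` cyl p \<subseteq> closure (chi ` F)"
      then have "chi ` cyl p \<subseteq> interior (closure (chi ` F))" using open_chi_cyl by (rule interior_maximal)
      then show False using nd cyl_nonempty[of p] by (auto simp: nowhere_dense_def)
    qed
    then obtain y where y: "y \<in> cyl p" "chi y \<in> - closure (chi ` F)"
      unfolding image_subset_iff by (meson ComplI)
    obtain q where q: "{n. chi y n} \<in> cyl q" "chi ` cyl q \<subseteq> - closure (chi ` F)"
      using chi_cyl_basis[OF _ y(2)] by (auto simp: open_Compl)
    have "y \<in> cyl q" using q(1) by simp
    then obtain r where r: "ext r p" "ext r q" by (rule common_ext[OF y(1)])
    have False if w: "w \<in> cyl r" "w \<in> F" for w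
    proof -
      have "chi w \<in> closure (chi ` F)" by (rule subsetD[OF closure_subset imageI[OF w(2)]])
      moreover have "chi w \<in> - closure (chi ` F)"
        by (rule subsetD[OF q(2) imageI[OF ext_cyl[OF r(2) w(1)]]])
      ultimately show False by simp
    qed
    then have "cyl r \<inter> F = {}" by blast
    then show "\<exists>q. ext q p \<and> cyl q \<inter> F = {}" using r(1) by blast
  qed
next
  assume nwd: "nwd F"
  show "nowhere_dense (chi ` F)" unfolding nowhere_dense_def
  proof (rule ccontr)
    assume "interior (closure (chi ` F)) \<noteq> {}"
    then obtain f where "f \<in> interior (closure (chi ` F))" by blast
    then obtain p where p: "chi ` cyl p \<subseteq> interior (closure (chi ` F))"
      using chi_cyl_basis[OF open_interior] by blast
    obtain q where q: "ext q p" "cyl q \<inter> F = {}" using nwd unfolding nwd_def by blast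
    have "chi ` cyl q \<inter> chi ` F = {}" by (simp only: image_Int[OF inj_chi, symmetric] q(2) image_empty)
    then have "chi ` cyl q \<inter> closure (chi ` F) = {}"
      by (simp only: open_Int_closure_eq_empty[OF open_chi_cyl])
    moreover have "chi ` cyl q \<subseteq> chi ` cyl p" using ext_cyl[OF q(1)] by (intro image_mono subsetI)
    then have "chi ` cyl q \<subseteq> closure (chi ` F)" by (rule order_trans[OF order_trans[OF _ p] interior_subset])
    ultimately have "chi ` cyl q = {}" by (simp only: Int_absorb2)
    then show False using cyl_nonempty[of q] by simp
  qed
qed

lemma nwd_subset: "nwd F \<Longrightarrow> A \<subseteq> F \<Longrightarrow> nwd A"
  unfolding nwd_def by (meson disjoint_iff subsetD)

lemma meager_reals_iff: "meager_reals X \<longleftrightarrow> mgr X"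
proof
  assume "meager_reals X"
  then obtain F where F: "\<And>n. nowhere_dense (F n)" "chi ` X = (\<Union>n :: nat. F n)"
    unfolding meager_reals_def meager_def by blast
  have "F n = chi ` (chi -` F n)" for n using surj_image_vimage_eq[of chi] chi_Collect by (metis surjI)
  then have "nwd (chi -` F n)" for n using F(1)[of n] nowhere_dense_chi by metis
  moreover have "X \<subseteq> (\<Union>n. chi -` F n)" using F(2) by blast
  ultimately show "mgr X" unfolding mgr_def by (intro exI[of _ "\<lambda>n. chi -` F n"]) blast
next
  assume "mgr X"
  then obtain F where F: "\<And>n :: nat. nwd (F n)" "X \<subseteq> (\<Union>n. F n)" unfolding mgr_def by blast
  have "nowhere_dense (chi ` (X \<inter> F n))" for n
    unfolding nowhere_dense_chi by (rule nwd_subset[OF F(1)]) blast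
  moreover have "chi ` X = (\<Union>n. chi ` (X \<inter> F n))" using F(2) by blast
  ultimately show "meager_reals X"
    unfolding meager_reals_def meager_def by (intro exI[of _ "\<lambda>n. chi ` (X \<inter> F n)"]) blast
qed

text \<open>\<open>bad n q\<close> collects the \<open>x\<close> for which no extension of
  \<open>q\<close> avoids the section of \<open>F n\<close>. Each of these countably many sets is
  nowhere dense, and outside their union the section of \<open>X\<close> is covered by nowhere dense
  sets.\<close>

lemma kuratowski_ulam:
  assumes "mgr X" shows "mgr {x. \<not> mgr {y. x \<oplus>\<^sub>J y \<in> X}}"
proof -
  obtain F where F: "\<And>n :: nat. nwd (F n)" "X \<subseteq> (\<Union>n. F n)" using assms unfolding mgr_def by blast
  define bad where "bad n q = {x. \<not> (\<exists>q'. ext q' q \<and> (\<forall>y\<in>cyl q'. x \<oplus>\<^sub>J y \<notin> F n))}" for n q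
  have bad: "nwd (bad n q)" for n q
    unfolding nwd_def
  proof
    fix p
    obtain x1 y1 where x1: "x1 \<in> cyl p" and y1: "y1 \<in> cyl q" using cyl_nonempty by metis
    \<comment> \<open>Fixing the first \<open>2 * K + 1\<close> bits of a join fixes enough bits of
      its halves to keep them in \<open>cyl p\<close> and \<open>cyl q\<close>.\<close>
    define K where "K = length (list_decode p) + length (list_decode q)"
    obtain t where t: "ext t (approx (x1 \<oplus>\<^sub>J y1) (Suc (K + K)))" "cyl t \<inter> F n = {}"
      using F(1)[of n] unfolding nwd_def by blast
    obtain z where z: "z \<in> cyl t" using cyl_nonempty by blast
    define x0 where "x0 = {i. i + i \<in> z}"
    define y0 where "y0 = {i. Suc (i + i) \<in> z}"
    have par: "\<exists>i. j = i + i \<or> j = Suc (i + i)" for j :: nat by presburger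
    have zj: "z = x0 \<oplus>\<^sub>J y0"
    proof (rule set_eqI)
      fix j
      obtain i where "j = i + i \<or> j = Suc (i + i)" using par by blast
      then show "j \<in> z \<longleftrightarrow> j \<in> x0 \<oplus>\<^sub>J y0" by (auto simp: join_even join_odd x0_def y0_def)
    qed
    have ag: "\<forall>j<Suc (K + K). j \<in> z \<longleftrightarrow> j \<in> x1 \<oplus>\<^sub>J y1" using ext_cyl[OF t(1) z] by (simp add: cyl_approx)
    have x0: "x0 \<in> cyl p"
    proof (rule cyl_agree[OF x1], intro allI impI)
      fix i assume "i < length (list_decode p)"
      then have "i + i < Suc (K + K)" by (simp add: K_def)
      then show "i \<in> x1 \<longleftrightarrow> i \<in> x0" using ag[rule_format, of "i + i"] by (simp add: zj join_even)
    qed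
    have y0: "y0 \<in> cyl q"
    proof (rule cyl_agree[OF y1], intro allI impI)
      fix i assume "i < length (list_decode q)"
      then have "Suc (i + i) < Suc (K + K)" by (simp add: K_def)
      then show "i \<in> y1 \<longleftrightarrow> i \<in> y0" using ag[rule_format, of "Suc (i + i)"] by (simp add: zj join_odd)
    qed
    \<comment> \<open>\<open>M\<close> bits of each half determine the part of the join that
      \<open>t\<close> mentions; the summand \<open>K\<close> makes the two approximations extend
      \<open>p\<close> and \<open>q\<close>.\<close>
    define M where "M = K + length (list_decode t)"
    have in_t: "x \<oplus>\<^sub>J y \<in> cyl t" if "x \<in> cyl (approx x0 M)" "y \<in> cyl (approx y0 M)" for x y
    proof (rule cyl_agree[OF z], intro allI impI)
      fix j assume j: "j < length (list_decode t)"
      obtain i where i: "j = i + i \<or> j = Suc (i + i)" using par by blast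
      then have "i < M" using j by (auto simp: M_def)
      then show "j \<in> z \<longleftrightarrow> j \<in> x \<oplus>\<^sub>J y" using i that by (auto simp: zj join_even join_odd cyl_approx)
    qed
    have e: "ext (approx x0 M) p" "ext (approx y0 M) q"
      by (rule ext_approx[OF x0], simp add: M_def K_def, rule ext_approx[OF y0], simp add: M_def K_def)
    have "cyl (approx x0 M) \<inter> bad n q = {}"
      using e(2) in_t t(2) unfolding bad_def by blast
    then show "\<exists>r. ext r p \<and> cyl r \<inter> bad n q = {}" using e(1) by blast
  qed
  have "mgr (\<Union>n. \<Union>q. bad n q)" by (intro mgr_UN nwd_mgr bad)
  moreover have "{x. \<not> mgr {y. x \<oplus>\<^sub>J y \<in> X}} \<subseteq> (\<Union>n. \<Union>q. bad n q)"
  proof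
    fix x assume x: "x \<in> {x. \<not> mgr {y. x \<oplus>\<^sub>J y \<in> X}}"
    show "x \<in> (\<Union>n. \<Union>q. bad n q)"
    proof (rule ccontr)
      assume "x \<notin> (\<Union>n. \<Union>q. bad n q)"
      then have nb: "\<exists>q'. ext q' q \<and> (\<forall>y\<in>cyl q'. x \<oplus>\<^sub>J y \<notin> F n)" for n q by (simp add: bad_def)
      have "nwd {y. x \<oplus>\<^sub>J y \<in> F n}" for n unfolding nwd_def
      proof
        fix q
        obtain q' where "ext q' q" "\<forall>y\<in>cyl q'. x \<oplus>\<^sub>J y \<notin> F n" using nb by blast
        then show "\<exists>q'. ext q' q \<and> cyl q' \<inter> {y. x \<oplus>\<^sub>J y \<in> F n} = {}" by (intro exI[of _ q']) auto
      qed
      then have "mgr (\<Union>n. {y. x \<oplus>\<^sub>J y \<in> F n})" by (intro mgr_UN nwd_mgr)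
      moreover have "{y. x \<oplus>\<^sub>J y \<in> X} \<subseteq> (\<Union>n. {y. x \<oplus>\<^sub>J y \<in> F n})" using F(2) by blast
      ultimately have "mgr {y. x \<oplus>\<^sub>J y \<in> X}" by (rule mgr_mono)
      then show False using x by simp
    qed
  qed
  ultimately show ?thesis by (rule mgr_mono)
qed

text \<open>Relative decidability presents the oracle as \<open>y \<oplus>\<^sub>J a\<close>,
  whereas the section at \<open>a\<close> is about \<open>a \<oplus>\<^sub>J y\<close>.\<close>

definition swap :: "nat set \<Rightarrow> nat set" where
  "swap z = {n. \<exists>m. n = m + m \<and> Suc (m + m) \<in> z \<or> n = Suc (m + m) \<and> m + m \<in> z}"

lemma swap_join: "swap (y \<oplus>\<^sub>J x) = x \<oplus>\<^sub>J y"
proof (rule set_eqI)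
  fix j :: nat
  have e: "m + m = m' + m' \<longleftrightarrow> m' = m" "m + m \<noteq> Suc (m' + m')" "Suc (m + m) \<noteq> m' + m'" for m m' :: nat
    by presburger+
  have "\<exists>i. j = i + i \<or> j = Suc (i + i)" by presburger
  then obtain i where "j = i + i \<or> j = Suc (i + i)" by blast
  then show "j \<in> swap (y \<oplus>\<^sub>J x) \<longleftrightarrow> j \<in> x \<oplus>\<^sub>J y"
    by (elim disjE) (simp_all add: swap_def join_even join_odd e)
qed

text \<open>Base relations are independent of the oracle and the closure clauses pass through
  unchanged, so only membership has to be rewritten.\<close>

lemma definable_swap: "definable R \<Longrightarrow> definable (\<lambda>x. R (swap x))"
proof (induction rule: definable.induct)
  case (base R) show ?case by (rule definable.base[OF base])
next
  case (mem i)
  have "definable (\<lambda>x \<rho>. \<exists>m. \<exists>k. k = m + m \<and> (\<exists>l. l = Suc k \<and> (\<rho> i = k \<and> l \<in> x \<or> \<rho> i = l \<and> k \<in> x)))"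
    by (intro definable_intros definable_arith)
  then show ?case by (simp add: swap_def)
next
  case (neg R) show ?case by (rule definable.neg[OF neg.IH])
next
  case (conj R S) show ?case by (rule definable.conj[OF conj.IH])
next
  case (ex \<phi>) show ?case by (rule definable.ex[OF ex.IH])
next
  case (ren R \<sigma>) show ?case by (rule definable.ren[OF ren.IH])
next
  case (game G H j) show ?case by (rule definable.game[OF game.IH])
qed

theorem theorem17:
  fixes a b :: "nat set"
  assumes "\<not> itrm_random (a \<oplus>\<^sub>J b)"
  shows "\<not> itrm_random a \<or> \<not> itrm_random_in a b"
proof -
  obtain X P where X: "meager_reals X" "a \<oplus>\<^sub>J b \<in> X" and P: "\<And>x. itrm_outputs P x (if x \<in> X then 1 else 0)"
    using assms unfolding itrm_random_def itrm_decidable_def by blast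
  have D: "definable (\<lambda>x \<rho>. x \<in> X)" by (rule decided_definable[OF P])
  \<comment> \<open>The code 0 is the empty condition: it forces the complement of a section iff the
    section is meager.\<close>
  have c0: "cyl 0 = UNIV" by (auto simp: cyl_def nthc_def)
  have f0: "forces {y. \<not> x \<oplus>\<^sub>J y \<in> X} 0 \<longleftrightarrow> mgr {y. x \<oplus>\<^sub>J y \<in> X}" for x
  proof -
    have "cyl 0 - {y. \<not> x \<oplus>\<^sub>J y \<in> X} = {y. x \<oplus>\<^sub>J y \<in> X}" using c0 by blast
    then show ?thesis by (simp only: forces_def)
  qed
  define Z where "Z = {x. \<not> mgr {y. x \<oplus>\<^sub>J y \<in> X}}"
  show ?thesis
  proof (cases "a \<in> Z")
    case True
    have "definable (\<lambda>x \<rho>. \<exists>p. p = 0 \<and> \<not> forces {y. \<not> x \<oplus>\<^sub>J y \<in> X} p)"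
      by (intro definable_intros definable_const definable_forces(1)[OF definable.neg[OF D]])
    then have "definable (\<lambda>x \<rho>. x \<in> Z)" by (simp add: f0 Z_def)
    then have "itrm_decidable Z"
      unfolding itrm_decidable_def by (intro computable_imp_program definable_computable)
    moreover have "meager_reals Z"
      using kuratowski_ulam X(1) unfolding meager_reals_iff Z_def by blast
    ultimately show ?thesis using True unfolding itrm_random_def by blast
  next
    case False
    define Y where "Y = {y. a \<oplus>\<^sub>J y \<in> X}"
    have "definable (\<lambda>z \<rho>. swap z \<in> X)" by (rule definable_swap[OF D])
    then have "computable_rel (\<lambda>z \<rho>. z \<in> {z. swap z \<in> X})" using definable_computable by simp
    then obtain Q where Q: "\<And>z. itrm_outputs Q z (if z \<in> {z. swap z \<in> X} then 1 else 0)"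
      using computable_imp_program by blast
    have "itrm_outputs Q (y \<oplus>\<^sub>J a) (if y \<in> Y then 1 else 0)" for y
      using Q[of "y \<oplus>\<^sub>J a"] by (simp add: swap_join Y_def)
    then have "itrm_decidable_in a Y" unfolding itrm_decidable_in_def by blast
    moreover have "meager_reals Y" using False unfolding meager_reals_iff Z_def Y_def by simp
    moreover have "b \<in> Y" using X(2) by (simp add: Y_def)
    ultimately show ?thesis unfolding itrm_random_in_def by blast
  qed
qed

end
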